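(* Let $q=e^{2\pi i/3}$ and $s^4=1$. Suppose that the ground state eigenvectors $|\Psi_L(z_1,\dots,z_L;\zeta_0,\zeta_L)\rangle=\sum_\alpha\psi^L_\alpha|\alpha\rangle$ ($L\ge 0$, $|\Psi_0\rangle=1$) of the two-boundary TL(1) transfer matrices are normalised so that they satisfy the $q$KZ equation, that every component $\psi^L_\alpha$ is a Laurent polynomial in $z_1^2,\dots,z_L^2$ whose exponents of each $z_i^2$ lie between $-(2L-1)$ and $2L-1$, and that they satisfy for all $L$ the recursions $$|\Psi_L\rangle\big|_{z_{i+1}=qz_i}=p_i\,\varphi_i|\Psi_{L-2}(\dots,z_{i-1},z_{i+2},\dots;\zeta_0,\zeta_L)\rangle\quad (1\le i\le L-1),$$ $$|\Psi_L\rangle\big|_{z_1=q\zeta_0}=r_0\,\widetilde\varphi_0|\Psi_{L-1}(z_2,\dots,z_L;q\zeta_0,\zeta_L)\rangle,\qquad |\Psi_L\rangle\big|_{z_L=\zeta_L/q}=r_L\,\widetilde\varphi_L|\Psi_{L-1}(z_1,\dots,z_{L-1};\zeta_0,\zeta_L/q)\rangle,$$ with proportionality factors $$p_i=k(z_i,\zeta_0)^2k(z_i,\zeta_L)^2\prod_{j\ne i,i+1}k(z_i,z_j)^4,\quad r_0=-k(\zeta_0,\zeta_L)\prod_{i=2}^Lk(\zeta_0,z_i)^2,\quad r_L=-s^2k\big(\tfrac1{s\zeta_L},s\zeta_0\big)\prod_{i=1}^{L-1}k\big(\tfrac1{s\zeta_L},sz_i\big)^2 .$$ Put $z_0=\zeta_0$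 and $z_{L+1}=\zeta_L$. Then for every $L\ge 1$ the two extremal components of $|\Psi_L\rangle$ are $$\psi^L_{(\cdots(}=(-1)^{\frac{L(L+1)}2}\prod_{0\le i<j\le L}k(z_j,z_i)\;\tau_{L+1}(z_1,\dots,z_L,\zeta_L)\,\tau_L(z_1,\dots,z_L),$$ $$\psi^L_{)\cdots)}=(-1)^{\frac{L(L+1)}2}(s^2)^L\prod_{1\le i<j\le L+1}k\big(\tfrac1{sz_i},sz_j\big)\;\tau_{L+1}(s\zeta_0,sz_1,\dots,sz_L)\,\tau_L(sz_1,\dots,sz_L).$$
   Context: Notation: $q=e^{2\pi i/3}$, $[x]=x-x^{-1}$, $k(x,\zeta)=[x/(q\zeta)]\,[x\zeta/q]$. Symplectic characters: for a partition $\lambda=(\lambda_1,\dots,\lambda_N)$, $\chi_\lambda(x_1,\dots,x_N)=\dfrac{\det[x_i^{\lambda_j+N-j+1}-x_i^{-\lambda_j-N+j-1}]_{i,j=1}^N}{\det[x_i^{N-j+1}-x_i^{-N+j-1}]_{i,j=1}^N}$, and $\tau_N(x_1,\dots,x_N)=\chi_{\lambda^{(N)}}(x_1^2,\dots,x_N^2)$ with $\lambda^{(N)}_j=\lfloor (N-j)/2\rfloor$. Link patterns. A link pattern of size $L$ is a sequence $\alpha\in\{\text{``('',``)''}\}^L$. Matched parentheses are sites linked to each other; an unmatched ``)'' is a site connected to the left boundary and an unmatched ``('' is a site connected to the right boundary. $\mathrm{LP}_L$ is the vector space with basis $|\alpha\rangle$. The indices $(\cdots($ and $)\cdots)$ denote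 the patterns with all $L$ brackets opening, respectively closing. Linear maps: $\varphi_i:\mathrm{LP}_{L-2}\to\mathrm{LP}_L$ inserts ``()'' at positions $i,i+1$ (shifting sites $j\ge i$ to $j+2$); $\widetilde\varphi_0:\mathrm{LP}_{L-1}\to\mathrm{LP}_L$ prepends ``)''; $\widetilde\varphi_L:\mathrm{LP}_{L-1}\to\mathrm{LP}_L$ appends ``(''. Generators $e_0,\dots,e_L$ act linearly on $\mathrm{LP}_L$. For $1\le i\le L-1$, $e_i$ links sites $i$ and $i+1$ to each other and joins whatever they were previously connected to (two former partner sites become linked; if one of $i,i+1$ was connected to a boundary and the other to a site, that site becomes connected to that boundary; if both were connected to boundaries, or were linked to each other, nothing else changes). $e_0$ replaces the first bracket by ``)'', and $e_L$ replaces the last bracket by ``(''. $q$KZ equation: $\check R_i(z_i/z_{i+1})|\Psi_L\rangle=\pi_i|\Psi_L\rangle$ ($1\le i\le L-1$), $\check K_0(1/z_1,\zeta_0)|\Psi_L\rangle=\pi_0|\Psi_L\rangle$, $\check K_L(sz_L,s\zeta_L)|\Psi_L\rangle=\pi_L|\Psi_L\rangle$, where $\check R_i(z)=\frac{[q/z]-[z]e_i}{[qz]}$, $\check K_i(z,\zeta)=\frac{k(z,\zeta)+[q^{-1}][z^2]e_i}{k(1/z,\zeta)}$ ($i=0,L$), and $\pi_i$ acts on coefficients only: $\pi_i:z_i\leftrightarrow z_{i+1}$, $\pi_0:z_1\mapsto1/z_1$, $\pi_L:z_L\mapsto1/(s^2z_L)$. Transfer matrix $T_L(w;z_1,\dots,z_L;\zeta_0,\zeta_L)$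 on $\mathrm{LP}_L$. Take two rows (lower, upper) of $L$ unit square faces. Each face carries two arcs joining the midpoints of its edges: type I joins left edge to top edge and bottom edge to right edge; type II joins left edge to bottom edge and top edge to right edge. Weights: lower face at position $i$: type I $\frac{[qz_i/w]}{[qw/z_i]}$, type II $\frac{[z_i/w]}{[qw/z_i]}$; upper face at position $i$: type II $\frac{[q/(z_iw)]}{[qz_iw]}$, type I $-\frac{[z_iw]}{[qz_iw]}$. On the left, the left edges of the two faces at position 1 are either joined to each other, with weight $\frac{k(q/w,\zeta_0)}{k(w/q,\zeta_0)}$, or both connected to the left boundary, with weight $\frac{[q^{-1}][q^2/w^2]}{k(w/q,\zeta_0)}$. On the right, the right edges of the two faces at position $L$ are either joined to each other, with weight $\frac{k(w,\zeta_L)}{k(1/w,\zeta_L)}$, or both connected to the right boundary, with weight $\frac{[q^{-1}][w^2]}{k(1/w,\zeta_L)}$. $T_L|\alpha\rangle$ is the sum over all configurations of (product of weights)$\,|\beta\rangle$, where $\beta$ is obtained by attaching $\alpha$ to the bottom edges of the lower row and reading off how the top edges of the upper row are connected to each other and to the boundaries; closed loops and paths with both ends on boundaries are discarded (weight 1). The ground state eigenvector is the ($w$-independent, generically unique up to scalar) solution of $T_L|\Psi_L\rangle=|\Psi_L\rangle$. *)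

theory Defs
  imports Complex_Main "Jordan_Normal_Form.Determinant"
begin

section \<open>Weights\<close>

definition q0 :: complex where
  "q0 = exp (2 * of_real pi * \<i> / 3)"

definition br :: "complex \<Rightarrow> complex" where
  "br x = x - 1 / x"

definition kf :: "complex \<Rightarrow> complex \<Rightarrow> complex" where
  "kf x \<zeta> = br (x / (q0 * \<zeta>)) * br (x * \<zeta> / q0)"


section \<open>Laurent polynomials and symplectic characters\<close>

text \<open>A Laurent polynomial in \<open>N\<close> variables is represented by the function it induces on lists of
  \<open>N\<close> nonzero complex numbers; the exponents of each variable lie between \<open>-d\<close> and \<open>d\<close>.\<close>

definition laurent_poly :: "nat \<Rightarrow> int \<Rightarrow> (complex list \<Rightarrow> complex) \<Rightarrow> bool" where
  "laurent_poly N d f \<longleftrightarrow> (\<exists>c :: int list \<Rightarrow> complex. \<forall>xs. length xs = N \<and> 0 \<notin> set xs \<longrightarrow>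
     f xs = (\<Sum>m | length m = N \<and> set m \<subseteq> {-d..d}. c m * (\<Prod>i<N. (xs ! i) powi (m ! i))))"

text \<open>List and matrix indices start at 0, so that the exponent \<open>\<lambda>\<^sub>j + N - j + 1\<close> reads
  \<open>lam ! j + N - j\<close>.\<close>

definition sp_alternant :: "nat list \<Rightarrow> complex list \<Rightarrow> complex" where
  "sp_alternant lam xs = (let N = length lam in
     det (mat N N (\<lambda>(i, j).
       (xs ! i) powi int (lam ! j + N - j) - (xs ! i) powi (- int (lam ! j + N - j)))))"

text \<open>The quotient of the two alternants is a Laurent polynomial. It has to be taken as such,
  because pointwise division would give 0 at the zeros of the denominator. On lists of \<open>length lam\<close>
  nonzero numbers the following conditions determine the function uniquely.\<close>

definition sp_char :: "nat list \<Rightarrow> complex list \<Rightarrow> complex" where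
  "sp_char lam = (SOME f. (\<exists>d. laurent_poly (length lam) d f) \<and>
     (\<forall>xs. length xs = length lam \<and> 0 \<notin> set xs \<and> sp_alternant (replicate (length lam) 0) xs \<noteq> 0 \<longrightarrow>
        f xs = sp_alternant lam xs / sp_alternant (replicate (length lam) 0) xs))"

definition tau :: "nat \<Rightarrow> complex list \<Rightarrow> complex" where
  "tau N xs = sp_char (map (\<lambda>j. (N - j) div 2) [1..<N+1]) (map (\<lambda>x. x\<^sup>2) xs)"


section \<open>Link patterns\<close>

datatype bracket = Opening | Closing

definition LP :: "nat \<Rightarrow> bracket list set" where
  "LP L = {\<alpha>. length \<alpha> = L}"

text \<open>Vectors are given by their components; only the components at the patterns in \<open>LP L\<close> matter
  for a vector of size \<open>L\<close>.\<close>

type_synonym lp_vec = "bracket list \<Rightarrow> complex"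

definition lin_ext :: "nat \<Rightarrow> (bracket list \<Rightarrow> bracket list) \<Rightarrow> lp_vec \<Rightarrow> lp_vec" where
  "lin_ext L f v = (\<lambda>\<beta>. \<Sum>\<alpha> | \<alpha> \<in> LP L \<and> f \<alpha> = \<beta>. v \<alpha>)"

inductive balanced :: "bracket list \<Rightarrow> bool" where
  "balanced []"
| "balanced u \<Longrightarrow> balanced v \<Longrightarrow> balanced (Opening # u @ Closing # v)"

text \<open>Sites are numbered from 1, so site \<open>i\<close> carries the bracket \<open>\<alpha> ! (i - 1)\<close>.\<close>

definition matched :: "bracket list \<Rightarrow> nat \<Rightarrow> nat \<Rightarrow> bool" where
  "matched \<alpha> i j \<longleftrightarrow> 1 \<le> i \<and> i < j \<and> j \<le> length \<alpha> \<and>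
     \<alpha> ! (i - 1) = Opening \<and> \<alpha> ! (j - 1) = Closing \<and> balanced (take (j - i - 1) (drop i \<alpha>))"

datatype link = Site nat | LeftBoundary | RightBoundary

definition link_of :: "bracket list \<Rightarrow> nat \<Rightarrow> link" where
  "link_of \<alpha> i =
     (if \<exists>j. matched \<alpha> i j \<or> matched \<alpha> j i then Site (THE j. matched \<alpha> i j \<or> matched \<alpha> j i)
      else if \<alpha> ! (i - 1) = Closing then LeftBoundary else RightBoundary)"

definition pattern_of :: "nat \<Rightarrow> (nat \<Rightarrow> link) \<Rightarrow> bracket list" where
  "pattern_of L c = map (\<lambda>i. case c i of
       Site j \<Rightarrow> (if i < j then Opening else Closing)
     | LeftBoundary \<Rightarrow> Closing
     | RightBoundary \<Rightarrow> Opening) [1..<L+1]"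

definition insert_arc :: "nat \<Rightarrow> bracket list \<Rightarrow> bracket list" where
  "insert_arc i \<alpha> = take (i - 1) \<alpha> @ [Opening, Closing] @ drop (i - 1) \<alpha>"

definition phi :: "nat \<Rightarrow> nat \<Rightarrow> lp_vec \<Rightarrow> lp_vec" where
  "phi L i = lin_ext (L - 2) (insert_arc i)"

definition phi_left :: "nat \<Rightarrow> lp_vec \<Rightarrow> lp_vec" where
  "phi_left L = lin_ext (L - 1) (\<lambda>\<alpha>. Closing # \<alpha>)"

definition phi_right :: "nat \<Rightarrow> lp_vec \<Rightarrow> lp_vec" where
  "phi_right L = lin_ext (L - 1) (\<lambda>\<alpha>. \<alpha> @ [Opening])"


section \<open>Temperley-Lieb generators and the exchange operators\<close>

definition join_sites :: "nat \<Rightarrow> (nat \<Rightarrow> link) \<Rightarrow> nat \<Rightarrow> link" where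
  "join_sites i c = (\<lambda>j.
     if j = i then Site (i + 1)
     else if j = i + 1 then Site i
     else if c j = Site i then c (i + 1)
     else if c j = Site (i + 1) then c i
     else c j)"

definition tl_gen :: "nat \<Rightarrow> nat \<Rightarrow> lp_vec \<Rightarrow> lp_vec" where
  "tl_gen L i = lin_ext L (\<lambda>\<alpha>.
     if i = 0 then \<alpha>[0 := Closing]
     else if i = L then \<alpha>[L - 1 := Opening]
     else pattern_of L (join_sites i (link_of \<alpha>)))"

definition R_op :: "nat \<Rightarrow> nat \<Rightarrow> complex \<Rightarrow> lp_vec \<Rightarrow> lp_vec" where
  "R_op L i z v = (\<lambda>\<beta>. (br (q0 / z) * v \<beta> - br z * tl_gen L i v \<beta>) / br (q0 * z))"

definition K_op :: "nat \<Rightarrow> nat \<Rightarrow> complex \<Rightarrow> complex \<Rightarrow> lp_vec \<Rightarrow> lp_vec" where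
  "K_op L i z \<zeta> v =
     (\<lambda>\<beta>. (kf z \<zeta> * v \<beta> + br (1 / q0) * br (z\<^sup>2) * tl_gen L i v \<beta>) / kf (1 / z) \<zeta>)"


section \<open>Transfer matrix\<close>

text \<open>Row 0 is the lower and row 1 the upper row. \<open>Vert r i\<close> is the midpoint of the bottom edge of the
  face at position \<open>i\<close> in row \<open>r\<close>, so \<open>Vert 2 i\<close> lies on the top of the upper row. \<open>Horiz r i\<close> is the
  midpoint of the right edge of that face, so \<open>Horiz r 0\<close> and \<open>Horiz r L\<close> lie at the two ends of
  row \<open>r\<close>.\<close>

datatype midpoint = Vert nat nat | Horiz nat nat
datatype face = TypeI | TypeII
datatype side = Joined | ToBoundary

record config =
  lower :: "face list"
  upper :: "face list"
  left_side :: side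
  right_side :: side

definition configs :: "nat \<Rightarrow> config set" where
  "configs L = {C. length (lower C) = L \<and> length (upper C) = L}"

fun face_arcs :: "face \<Rightarrow> nat \<Rightarrow> nat \<Rightarrow> (midpoint \<times> midpoint) set" where
  "face_arcs TypeI r i = {(Horiz r (i - 1), Vert (r + 1) i), (Vert r i, Horiz r i)}"
| "face_arcs TypeII r i = {(Horiz r (i - 1), Vert r i), (Vert (r + 1) i, Horiz r i)}"

definition arcs :: "nat \<Rightarrow> config \<Rightarrow> bracket list \<Rightarrow> (midpoint \<times> midpoint) set" where
  "arcs L C \<alpha> =
     (\<Union>i\<in>{1..L}. face_arcs (lower C ! (i - 1)) 0 i \<union> face_arcs (upper C ! (i - 1)) 1 i)
     \<union> (if left_side C = Joined then {(Horiz 0 0, Horiz 1 0)} else {})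
     \<union> (if right_side C = Joined then {(Horiz 0 L, Horiz 1 L)} else {})
     \<union> {(Vert 0 i, Vert 0 j) | i j. matched \<alpha> i j}"

definition left_ends :: "nat \<Rightarrow> config \<Rightarrow> bracket list \<Rightarrow> midpoint set" where
  "left_ends L C \<alpha> = {Vert 0 i | i. i \<in> {1..L} \<and> link_of \<alpha> i = LeftBoundary}
     \<union> (if left_side C = ToBoundary then {Horiz 0 0, Horiz 1 0} else {})"

definition connected_to :: "nat \<Rightarrow> config \<Rightarrow> bracket list \<Rightarrow> midpoint \<Rightarrow> midpoint \<Rightarrow> bool" where
  "connected_to L C \<alpha> x y \<longleftrightarrow> (x, y) \<in> (arcs L C \<alpha> \<union> (arcs L C \<alpha>)\<inverse>)\<^sup>*"

text \<open>A path starting at a top edge ends at another top edge, at the left boundary or at the right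
  boundary.\<close>

definition top_link :: "nat \<Rightarrow> config \<Rightarrow> bracket list \<Rightarrow> nat \<Rightarrow> link" where
  "top_link L C \<alpha> i =
     (if \<exists>j\<in>{1..L}. j \<noteq> i \<and> connected_to L C \<alpha> (Vert 2 i) (Vert 2 j)
      then Site (THE j. j \<in> {1..L} \<and> j \<noteq> i \<and> connected_to L C \<alpha> (Vert 2 i) (Vert 2 j))
      else if \<exists>y\<in>left_ends L C \<alpha>. connected_to L C \<alpha> (Vert 2 i) y then LeftBoundary
      else RightBoundary)"

definition lower_weight :: "complex \<Rightarrow> complex \<Rightarrow> face \<Rightarrow> complex" where
  "lower_weight w z t =
     (case t of TypeI \<Rightarrow> br (q0 * z / w) / br (q0 * w / z) | TypeII \<Rightarrow> br (z / w) / br (q0 * w / z))"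

definition upper_weight :: "complex \<Rightarrow> complex \<Rightarrow> face \<Rightarrow> complex" where
  "upper_weight w z t =
     (case t of TypeI \<Rightarrow> - br (z * w) / br (q0 * z * w)
              | TypeII \<Rightarrow> br (q0 / (z * w)) / br (q0 * z * w))"

definition left_weight :: "complex \<Rightarrow> complex \<Rightarrow> side \<Rightarrow> complex" where
  "left_weight w \<zeta> b =
     (case b of Joined \<Rightarrow> kf (q0 / w) \<zeta> / kf (w / q0) \<zeta>
              | ToBoundary \<Rightarrow> br (1 / q0) * br (q0\<^sup>2 / w\<^sup>2) / kf (w / q0) \<zeta>)"

definition right_weight :: "complex \<Rightarrow> complex \<Rightarrow> side \<Rightarrow> complex" where
  "right_weight w \<zeta> b =
     (case b of Joined \<Rightarrow> kf w \<zeta> / kf (1 / w) \<zeta>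
              | ToBoundary \<Rightarrow> br (1 / q0) * br (w\<^sup>2) / kf (1 / w) \<zeta>)"

definition config_weight ::
  "nat \<Rightarrow> complex \<Rightarrow> complex list \<Rightarrow> complex \<Rightarrow> complex \<Rightarrow> config \<Rightarrow> complex" where
  "config_weight L w zs \<zeta>0 \<zeta>L C =
     (\<Prod>i<L. lower_weight w (zs ! i) (lower C ! i) * upper_weight w (zs ! i) (upper C ! i))
     * left_weight w \<zeta>0 (left_side C) * right_weight w \<zeta>L (right_side C)"

definition transfer ::
  "nat \<Rightarrow> complex \<Rightarrow> complex list \<Rightarrow> complex \<Rightarrow> complex \<Rightarrow> lp_vec \<Rightarrow> lp_vec" where
  "transfer L w zs \<zeta>0 \<zeta>L v = (\<lambda>\<beta>. \<Sum>C\<in>configs L.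
     config_weight L w zs \<zeta>0 \<zeta>L C * lin_ext L (\<lambda>\<alpha>. pattern_of L (top_link L C \<alpha>)) v \<beta>)"

text \<open>The weights of the transfer matrix have no pole at this point.\<close>

definition transfer_regular :: "complex \<Rightarrow> complex list \<Rightarrow> complex \<Rightarrow> complex \<Rightarrow> bool" where
  "transfer_regular w zs \<zeta>0 \<zeta>L \<longleftrightarrow> w \<noteq> 0 \<and>
     (\<forall>z\<in>set zs. br (q0 * w / z) \<noteq> 0 \<and> br (q0 * z * w) \<noteq> 0) \<and>
     kf (w / q0) \<zeta>0 \<noteq> 0 \<and> kf (1 / w) \<zeta>L \<noteq> 0"


section \<open>Properties of the family of vectors\<close>

text \<open>A family assigns to \<open>L\<close>, \<open>zs = [z\<^sub>1, \<dots>, z\<^sub>L]\<close>, \<open>\<zeta>0\<close> and \<open>\<zeta>L\<close> a vector of size \<open>L\<close>. No condition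
  is put on its dependence on \<open>\<zeta>0\<close> and \<open>\<zeta>L\<close>. Identities of rational functions are required at all
  nonzero arguments at which their denominators do not vanish.\<close>

type_synonym family = "nat \<Rightarrow> complex list \<Rightarrow> complex \<Rightarrow> complex \<Rightarrow> lp_vec"

definition args :: "nat \<Rightarrow> complex list \<Rightarrow> complex \<Rightarrow> complex \<Rightarrow> bool" where
  "args L zs \<zeta>0 \<zeta>L \<longleftrightarrow> length zs = L \<and> 0 \<notin> set zs \<and> \<zeta>0 \<noteq> 0 \<and> \<zeta>L \<noteq> 0"

definition ground_state :: "family \<Rightarrow> bool" where
  "ground_state \<Psi> \<longleftrightarrow> (\<forall>L zs \<zeta>0 \<zeta>L w. args L zs \<zeta>0 \<zeta>L \<and> transfer_regular w zs \<zeta>0 \<zeta>L \<longrightarrow>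
     (\<forall>\<beta>\<in>LP L. transfer L w zs \<zeta>0 \<zeta>L (\<Psi> L zs \<zeta>0 \<zeta>L) \<beta> = \<Psi> L zs \<zeta>0 \<zeta>L \<beta>))"

definition qKZ_bulk :: "family \<Rightarrow> bool" where
  "qKZ_bulk \<Psi> \<longleftrightarrow> (\<forall>L zs \<zeta>0 \<zeta>L i. args L zs \<zeta>0 \<zeta>L \<and> 1 \<le> i \<and> i + 1 \<le> L \<longrightarrow>
     (let z = zs ! (i - 1); z' = zs ! i in br (q0 * (z / z')) \<noteq> 0 \<longrightarrow>
       (\<forall>\<beta>\<in>LP L. R_op L i (z / z') (\<Psi> L zs \<zeta>0 \<zeta>L) \<beta> = \<Psi> L (zs[i - 1 := z', i := z]) \<zeta>0 \<zeta>L \<beta>)))"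

definition qKZ_left :: "family \<Rightarrow> bool" where
  "qKZ_left \<Psi> \<longleftrightarrow> (\<forall>L zs \<zeta>0 \<zeta>L. args L zs \<zeta>0 \<zeta>L \<and> 1 \<le> L \<longrightarrow>
     (let z = zs ! 0 in kf z \<zeta>0 \<noteq> 0 \<longrightarrow>
       (\<forall>\<beta>\<in>LP L. K_op L 0 (1 / z) \<zeta>0 (\<Psi> L zs \<zeta>0 \<zeta>L) \<beta> = \<Psi> L (zs[0 := 1 / z]) \<zeta>0 \<zeta>L \<beta>)))"

definition qKZ_right :: "complex \<Rightarrow> family \<Rightarrow> bool" where
  "qKZ_right s \<Psi> \<longleftrightarrow> (\<forall>L zs \<zeta>0 \<zeta>L. args L zs \<zeta>0 \<zeta>L \<and> 1 \<le> L \<longrightarrow>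
     (let z = zs ! (L - 1) in kf (1 / (s * z)) (s * \<zeta>L) \<noteq> 0 \<longrightarrow>
       (\<forall>\<beta>\<in>LP L. K_op L L (s * z) (s * \<zeta>L) (\<Psi> L zs \<zeta>0 \<zeta>L) \<beta>
               = \<Psi> L (zs[L - 1 := 1 / (s\<^sup>2 * z)]) \<zeta>0 \<zeta>L \<beta>)))"

definition qKZ :: "complex \<Rightarrow> family \<Rightarrow> bool" where
  "qKZ s \<Psi> \<longleftrightarrow> qKZ_bulk \<Psi> \<and> qKZ_left \<Psi> \<and> qKZ_right s \<Psi>"

definition laurent_components :: "family \<Rightarrow> bool" where
  "laurent_components \<Psi> \<longleftrightarrow> (\<forall>L \<zeta>0 \<zeta>L. \<zeta>0 \<noteq> 0 \<and> \<zeta>L \<noteq> 0 \<longrightarrow> (\<forall>\<alpha>\<in>LP L.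
     \<exists>g. laurent_poly L (2 * int L - 1) g \<and>
       (\<forall>zs. args L zs \<zeta>0 \<zeta>L \<longrightarrow> \<Psi> L zs \<zeta>0 \<zeta>L \<alpha> = g (map (\<lambda>z. z\<^sup>2) zs))))"

definition p_factor :: "nat \<Rightarrow> nat \<Rightarrow> complex list \<Rightarrow> complex \<Rightarrow> complex \<Rightarrow> complex" where
  "p_factor L i zs \<zeta>0 \<zeta>L = (let z = (\<lambda>j. zs ! (j - 1)) in
     (kf (z i) \<zeta>0)\<^sup>2 * (kf (z i) \<zeta>L)\<^sup>2 * (\<Prod>j\<in>{1..L} - {i, i + 1}. kf (z i) (z j) ^ 4))"

definition r_left :: "nat \<Rightarrow> complex list \<Rightarrow> complex \<Rightarrow> complex \<Rightarrow> complex" where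
  "r_left L zs \<zeta>0 \<zeta>L = - kf \<zeta>0 \<zeta>L * (\<Prod>i\<in>{2..L}. (kf \<zeta>0 (zs ! (i - 1)))\<^sup>2)"

definition r_right :: "complex \<Rightarrow> nat \<Rightarrow> complex list \<Rightarrow> complex \<Rightarrow> complex \<Rightarrow> complex" where
  "r_right s L zs \<zeta>0 \<zeta>L = - s\<^sup>2 * kf (1 / (s * \<zeta>L)) (s * \<zeta>0)
     * (\<Prod>i\<in>{1..L - 1}. (kf (1 / (s * \<zeta>L)) (s * zs ! (i - 1)))\<^sup>2)"

definition bulk_recursion :: "family \<Rightarrow> bool" where
  "bulk_recursion \<Psi> \<longleftrightarrow> (\<forall>L zs \<zeta>0 \<zeta>L i.
     args L zs \<zeta>0 \<zeta>L \<and> 1 \<le> i \<and> i + 1 \<le> L \<and> zs ! i = q0 * zs ! (i - 1) \<longrightarrow>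
     (\<forall>\<beta>\<in>LP L. \<Psi> L zs \<zeta>0 \<zeta>L \<beta> =
        p_factor L i zs \<zeta>0 \<zeta>L
        * phi L i (\<Psi> (L - 2) (take (i - 1) zs @ drop (i + 1) zs) \<zeta>0 \<zeta>L) \<beta>))"

definition left_recursion :: "family \<Rightarrow> bool" where
  "left_recursion \<Psi> \<longleftrightarrow> (\<forall>L zs \<zeta>0 \<zeta>L.
     args L zs \<zeta>0 \<zeta>L \<and> 1 \<le> L \<and> zs ! 0 = q0 * \<zeta>0 \<longrightarrow>
     (\<forall>\<beta>\<in>LP L. \<Psi> L zs \<zeta>0 \<zeta>L \<beta> =
        r_left L zs \<zeta>0 \<zeta>L * phi_left L (\<Psi> (L - 1) (tl zs) (q0 * \<zeta>0) \<zeta>L) \<beta>))"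

definition right_recursion :: "complex \<Rightarrow> family \<Rightarrow> bool" where
  "right_recursion s \<Psi> \<longleftrightarrow> (\<forall>L zs \<zeta>0 \<zeta>L.
     args L zs \<zeta>0 \<zeta>L \<and> 1 \<le> L \<and> zs ! (L - 1) = \<zeta>L / q0 \<longrightarrow>
     (\<forall>\<beta>\<in>LP L. \<Psi> L zs \<zeta>0 \<zeta>L \<beta> =
        r_right s L zs \<zeta>0 \<zeta>L * phi_right L (\<Psi> (L - 1) (butlast zs) \<zeta>0 (\<zeta>L / q0)) \<beta>))"

end

(* Write y = z^2 + 1/z^2. The exchange relations say that the component at (...( equals the product of
   the k(z_j, z_i), 0 <= i < j <= L, times a function of z_1, ..., z_L that is invariant under
   permutations and inversions, and the degree bound leaves degree at most L - 1 in each y. Applying the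
   equation at the right boundary and then the fusion z_L = q z_{L-1} expresses the component at
   z_L = 1/(q z_{L-1}) through the component of size L - 2. By the hyperoctahedral symmetry this gives
   2(L - 1) values of y_L, so that for L >= 2 the component of size L is determined by that of size L - 2.
   The boundary parameters stay fixed in this step, which matters because nothing is assumed about the
   dependence on them.

   The proposed formula obeys the same recursion: with y'' the value of y at q^2 x, column operations on
   the alternant, whose exponents are the positive integers prime to 3, give
   tau_N(u, x, q x) = prod (y_u - y'') tau_{N-2}(u).

   Size 0 is given. In size 1 the component is k(z_1, zeta_0) up to a scalar. The boundary recursions
   from size 0 and from size 2 fix the scalar, since their factors have no common zero. The component
   at )...) reduces to the one at (...( by the reflection z_i -> 1/(s z_{L+1-i}). *)
theory Submission
  imports Defs
begin


section \<open>Iterated synthetic division and Newton interpolation\<close>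

text \<open>At \<open>z_L = q z_{L-1}\<close> the exchange relation forces the component to vanish:
  one of its two weights is \<open>br 1 = 0\<close>, the other is not zero. There the right boundary
  equation keeps, besides the reflected value, only the neighbouring pattern with one
  \<open>)\<close> at the end, which is the pattern that fusion evaluates. Uniqueness is a count of
  zeros in z^2 with all variables but the last held at generic values; continuity in one variable at
  a time then removes genericity in the z_i. No such limit is available in the boundary parameters,
  so degenerate pairs (zeta_0, zeta_L) need a direct treatment: when both factors of the right
  recursion vanish, the left recursion fixes the scalar of the component at )...), and the right
  boundary equation in size 1 shows that both components carry the same scalar. The characters are
  handled as determinants of divided differences, which make sense at coinciding arguments, where
  the quotient of alternants does not.\<close>

fun syn_divs :: "'a::comm_ring_1 list \<Rightarrow> 'a poly \<Rightarrow> 'a poly" where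
  "syn_divs [] p = p"
| "syn_divs (c # cs) p = syn_divs cs (synthetic_div p c)"

definition newton_prod :: "'a::comm_ring_1 list \<Rightarrow> 'a \<Rightarrow> 'a" where
  "newton_prod cs x = (\<Prod>c\<leftarrow>cs. x - c)"

lemma newton_prod_simps [simp]:
  "newton_prod [] x = 1"
  "newton_prod (c # cs) x = (x - c) * newton_prod cs x"
  "newton_prod (cs @ ds) x = newton_prod cs x * newton_prod ds x"
  by (simp_all add: newton_prod_def)

lemma newton_prod_eq_0: "x \<in> set cs \<Longrightarrow> newton_prod cs x = 0"
  by (induction cs) auto

lemma poly_synthetic_div: "poly p x = poly p c + (x - c) * poly (synthetic_div p c) x"
  for p :: "'a::comm_ring_1 poly"
proof -
  have "poly p x = poly ([:-c, 1:] * synthetic_div p c + [:poly p c:]) x"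
    by (simp only: synthetic_div_correct')
  then show ?thesis by (simp add: algebra_simps)
qed

text \<open>Newton's interpolation formula with remainder:
  \<open>poly (syn_divs (take k cs) p) (cs ! k)\<close> is the divided difference of p at the first
  k + 1 nodes, obtained without dividing by differences of nodes.\<close>

lemma newton_expansion:
  "poly p x = (\<Sum>k<length cs. newton_prod (take k cs) x * poly (syn_divs (take k cs) p) (cs ! k))
     + newton_prod cs x * poly (syn_divs cs p) x"
proof (induction cs arbitrary: p)
  case (Cons c cs)
  have "poly p x = poly p c + (x - c) * poly (synthetic_div p c) x"
    by (rule poly_synthetic_div)
  also note Cons.IH[of "synthetic_div p c"]
  finally show ?case
    by (simp add: sum.lessThan_Suc_shift sum_distrib_left algebra_simps del: sum.lessThan_Suc)
qed simp

definition dd_mat :: "(nat \<Rightarrow> 'a::comm_ring_1 poly) \<Rightarrow> 'a list \<Rightarrow> 'a mat" where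
  "dd_mat p ys = mat (length ys) (length ys)
     (\<lambda>(k, j). poly (syn_divs (take k ys) (p j)) (ys ! k))"

text \<open>The bialternant det(p_j(y_i)) / det(y_i^j) in a form free of division. It is defined
  also at coinciding nodes, where the quotient would be 0/0.\<close>

definition bialt :: "(nat \<Rightarrow> 'a::comm_ring_1 poly) \<Rightarrow> 'a list \<Rightarrow> 'a" where
  "bialt p ys = det (dd_mat p ys)"

definition eval_mat :: "(nat \<Rightarrow> 'a::comm_ring_1 poly) \<Rightarrow> 'a list \<Rightarrow> 'a mat" where
  "eval_mat p ys = mat (length ys) (length ys) (\<lambda>(i, j). poly (p j) (ys ! i))"

fun vdm :: "'a::comm_ring_1 list \<Rightarrow> 'a" where
  "vdm [] = 1"
| "vdm (y # ys) = (\<Prod>x\<leftarrow>ys. x - y) * vdm ys"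

lemma vdm_snoc: "vdm (ys @ [y]) = vdm ys * newton_prod ys y"
  by (induction ys) (simp_all add: algebra_simps)

lemma vdm_ne_0: "distinct ys \<Longrightarrow> vdm ys \<noteq> 0" for ys :: "'a::idom list"
  by (induction ys) (auto simp: prod_list_zero_iff)

lemma vdm_take: "n \<le> length ys \<Longrightarrow> vdm (take n ys) = (\<Prod>i<n. newton_prod (take i ys) (ys ! i))"
  by (induction n) (simp_all add: take_Suc_conv_app_nth vdm_snoc)

text \<open>Newton's formula factors the evaluation matrix into a lower triangular matrix of Newton
  products and \<open>dd_mat\<close>; the remainder vanishes because every evaluation point is
  itself a node.\<close>

lemma det_eval_mat: "det (eval_mat p ys) = vdm ys * bialt p ys"
  for ys :: "'a::idom list"
proof -
  define n where "n = length ys"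
  define V where "V = mat n n (\<lambda>(i, k). newton_prod (take k ys) (ys ! i))"
  have "eval_mat p ys = V * dd_mat p ys"
  proof (rule eq_matI)
    fix i j assume "i < dim_row (V * dd_mat p ys)" "j < dim_col (V * dd_mat p ys)"
    then have ij: "i < n" "j < n" by (auto simp: V_def dd_mat_def n_def)
    have "newton_prod ys (ys ! i) = 0"
      using ij by (intro newton_prod_eq_0) (simp add: n_def)
    then show "eval_mat p ys $$ (i, j) = (V * dd_mat p ys) $$ (i, j)"
      using ij newton_expansion[of "p j" "ys ! i" ys]
      by (simp add: eval_mat_def V_def dd_mat_def n_def scalar_prod_def lessThan_atLeast0)
  qed (auto simp: eval_mat_def V_def dd_mat_def n_def)
  moreover have "det V = vdm ys"
  proof -
    have "det V = prod_list (diag_mat V)"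
    proof (rule det_lower_triangular)
      fix i j assume "i < j" "j < n"
      then show "V $$ (i, j) = 0"
        by (auto simp: V_def n_def in_set_conv_nth intro!: newton_prod_eq_0 exI[of _ i])
    qed (simp add: V_def)
    also have "\<dots> = (\<Prod>i<n. newton_prod (take i ys) (ys ! i))"
      by (simp add: diag_mat_def V_def prod.list_conv_set_nth atLeast0LessThan)
    also have "\<dots> = vdm ys" using vdm_take[of n ys] by (simp add: n_def)
    finally show ?thesis .
  qed
  ultimately show ?thesis
    using det_mult[of V n "dd_mat p ys"] by (simp add: V_def dd_mat_def n_def bialt_def)
qed

section \<open>Divided differences: behaviour under degree and symmetry in the nodes\<close>

lemma coeff_synthetic_div:
  "coeff (synthetic_div p c) i = coeff p (Suc i) + c * coeff (synthetic_div p c) (Suc i)"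
  for p :: "'a::comm_ring_1 poly"
proof -
  have "coeff (p + smult c (synthetic_div p c)) (Suc i) = coeff (pCons (poly p c) (synthetic_div p c)) (Suc i)"
    by (simp only: synthetic_div_correct)
  then show ?thesis by simp
qed

lemma degree_syn_divs: "degree (syn_divs cs p) = degree p - length cs"
  by (induction cs arbitrary: p) (simp_all add: degree_synthetic_div)

lemma coeff_syn_divs:
  "degree p \<le> n + length cs \<Longrightarrow> coeff (syn_divs cs p) n = coeff p (n + length cs)"
proof (induction cs arbitrary: p)
  case (Cons c cs)
  have "coeff (synthetic_div p c) (Suc (n + length cs)) = 0"
    using Cons.prems by (intro coeff_eq_0) (simp add: degree_synthetic_div)
  then show ?case using Cons by (simp add: degree_synthetic_div coeff_synthetic_div[of p c "n + length cs"])
qed simp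

lemma syn_divs_const: "degree p < length cs \<Longrightarrow> syn_divs cs p = 0"
proof (induction cs arbitrary: p)
  case (Cons c cs)
  then show ?case
  proof (cases "degree p = 0")
    case True
    then have "synthetic_div p c = 0" by (simp add: synthetic_div_eq_0_iff)
    moreover have "syn_divs cs 0 = 0" by (induction cs) auto
    ultimately show ?thesis by simp
  qed (simp add: degree_synthetic_div)
qed simp

text \<open>A divided difference of order k kills degrees below k and sends a monic polynomial of
  degree k to 1, so the matrix is unitriangular. This evaluates the denominators of the
  characters.\<close>

lemma bialt_monic:
  assumes "\<And>j. j < length ys \<Longrightarrow> degree (p j) = j" "\<And>j. j < length ys \<Longrightarrow> coeff (p j) j = 1"
  shows "bialt p ys = 1"
proof -
  have "det (dd_mat p ys) = prod_list (diag_mat (dd_mat p ys))"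
  proof (rule det_upper_triangular)
    show "upper_triangular (dd_mat p ys)"
      unfolding upper_triangular_def by (auto simp: dd_mat_def syn_divs_const assms)
  qed (auto simp: dd_mat_def)
  also have "\<dots> = (\<Prod>k<length ys. poly (syn_divs (take k ys) (p k)) (ys ! k))"
    by (simp add: diag_mat_def dd_mat_def prod.list_conv_set_nth atLeast0LessThan)
  also have "\<dots> = (\<Prod>k<length ys. 1)"
  proof (rule prod.cong)
    fix k assume "k \<in> {..<length ys}"
    then have k: "length (take k ys) = k" "k < length ys" by simp_all
    have "degree (syn_divs (take k ys) (p k)) = 0" using k by (simp add: degree_syn_divs assms)
    then obtain a where a: "syn_divs (take k ys) (p k) = [:a:]" by (auto elim: degree_eq_zeroE)
    have "coeff (syn_divs (take k ys) (p k)) 0 = 1" using k by (subst coeff_syn_divs) (auto simp: assms)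
    then show "poly (syn_divs (take k ys) (p k)) (ys ! k) = 1" using a by simp
  qed simp
  finally show ?thesis by (simp add: bialt_def)
qed

lemma syn_divs_append: "syn_divs (cs @ ds) p = syn_divs ds (syn_divs cs p)"
  by (induction cs arbitrary: p) auto

text \<open>After multiplication by (x - a)(x - b) both iterated quotients satisfy the same
  equation, so they agree at all but two points and hence as polynomials.\<close>

lemma synthetic_div_swap:
  fixes p :: "'a::{idom, ring_char_0} poly"
  shows "synthetic_div (synthetic_div p a) b = synthetic_div (synthetic_div p b) a"
proof (cases "a = b")
  case False
  define qa qb where "qa = synthetic_div p a" and "qb = synthetic_div p b"
  define ra rb where "ra = synthetic_div qa b" and "rb = synthetic_div qb a"
  have pa: "poly p x = poly p a + (x - a) * (poly qa b + (x - b) * poly ra x)"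
    and pb: "poly p x = poly p b + (x - b) * (poly qb a + (x - a) * poly rb x)" for x
    using poly_synthetic_div[of p x a] poly_synthetic_div[of qa x b]
      poly_synthetic_div[of p x b] poly_synthetic_div[of qb x a]
    by (simp_all add: qa_def qb_def ra_def rb_def)
  have dd: "poly p b = poly p a + (b - a) * poly qa b" using pa[of b] by simp
  have "(a - b) * (poly qa b - poly qb a) = 0"
    using dd pb[of a] by (simp add: algebra_simps)
  then have qq: "poly qb a = poly qa b" using False by simp
  have "poly ra x = poly rb x" if "x \<noteq> a" "x \<noteq> b" for x
  proof -
    have "(x - a) * (x - b) * (poly ra x - poly rb x) = 0"
      using pa[of x] pb[of x] unfolding dd qq by (simp add: algebra_simps)
    then show ?thesis using that by simp
  qed
  then have "infinite {x. poly (ra - rb) x = 0}"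
    using infinite_UNIV_char_0 rev_finite_subset[of "{x. poly (ra - rb) x = 0} \<union> {a, b}" UNIV]
    by fastforce
  then show ?thesis using poly_roots_finite[of "ra - rb"] by (auto simp: ra_def rb_def qa_def qb_def)
qed simp

text \<open>Cancelling \<open>vdm\<close> would give symmetry for distinct nodes only. Instead,
  exchanging adjacent nodes changes a single row: p[a,y] = p[a,x] + (y - x) p[a,x,y], so a multiple
  of the next row is added to it.\<close>

lemma bialt_swap:
  fixes a :: "'a::{idom, ring_char_0} list"
  shows "bialt p (a @ x # y # b) = bialt p (a @ y # x # b)"
proof -
  define n where "n = length a + length b + 2"
  define A B where "A = dd_mat p (a @ x # y # b)" and "B = dd_mat p (a @ y # x # b)"
  define m where "m = length a"
  have "B = addrow (y - x) m (Suc m) A"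
  proof (rule eq_matI)
    fix i j assume "i < dim_row (addrow (y - x) m (Suc m) A)" "j < dim_col (addrow (y - x) m (Suc m) A)"
    then have ij: "i < n" "j < n" "m < n" "Suc m < n" by (auto simp: A_def dd_mat_def n_def m_def)
    define q where "q = syn_divs a (p j)"
    have swap: "(y - x) * poly (synthetic_div q y) x = (y - x) * poly (synthetic_div q x) y"
      using poly_synthetic_div[of q y x] poly_synthetic_div[of q x y] by (simp add: algebra_simps)
    have swap': "poly (synthetic_div q y) x = poly (synthetic_div q x) y"
      using swap by (cases "x = y") auto
    consider "i < m" | "i = m" | "i = Suc m" | "i \<ge> m + 2" by linarith
    then show "B $$ (i, j) = addrow (y - x) m (Suc m) A $$ (i, j)"
    proof cases
      case 4
      then obtain l where l: "i = m + 2 + l" using le_Suc_ex by blast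
      show ?thesis using ij unfolding l
        by (simp add: A_def B_def dd_mat_def n_def m_def nth_append syn_divs_append synthetic_div_swap)
    next
      case 2
      then show ?thesis using ij poly_synthetic_div[of q y x]
        by (simp add: A_def B_def dd_mat_def n_def m_def nth_append syn_divs_append q_def[symmetric])
    next
      case 3
      then show ?thesis using ij swap'
        by (simp add: A_def B_def dd_mat_def n_def m_def nth_append syn_divs_append q_def[symmetric])
    next
      case 1
      then show ?thesis using ij
        by (simp add: A_def B_def dd_mat_def n_def m_def nth_append)
    qed
  qed (auto simp: A_def B_def dd_mat_def)
  then show ?thesis
    unfolding bialt_def A_def[symmetric] B_def[symmetric]
    by (subst det_addrow[of _ n, symmetric, where k = m and l = "Suc m" and a = "y - x"])
       (auto simp: A_def dd_mat_def n_def m_def)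
qed

lemma bialt_move_front: 
  fixes a :: "'a::{idom, ring_char_0} list"
  shows "bialt p (a @ x # b) = bialt p (x # a @ b)"
proof (induction a arbitrary: b rule: rev_induct)
  case (snoc y a)
  have "bialt p (a @ y # x # b) = bialt p (x # a @ y # b)"
    by (rule trans[OF bialt_swap snoc.IH])
  then show ?case by simp
qed simp

text \<open>The last node enters only the last row, and there after \<open>length ys\<close>
  divisions, each of which lowers the degree by one; expand along that row.\<close>

lemma bialt_last:
  fixes ys :: "'a::idom list"
  assumes "\<And>j. j \<le> length ys \<Longrightarrow> degree (p j) \<le> d + length ys"
  shows "\<exists>r. degree r \<le> d \<and> (\<forall>y. bialt p (ys @ [y]) = poly r y)"
proof -
  define n where "n = length ys"
  define M where "M y = dd_mat p (ys @ [y])" for y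
  have cof: "cofactor (M y) n j = cofactor (M 0) n j" if "j < Suc n" for y j
  proof -
    have "mat_delete (M y) n j = mat_delete (M 0) n j"
      by (rule eq_matI) (use that in \<open>auto simp: M_def mat_delete_def dd_mat_def n_def nth_append\<close>)
    then show ?thesis by (simp add: cofactor_def)
  qed
  define r where "r = (\<Sum>j<Suc n. smult (cofactor (M 0) n j) (syn_divs ys (p j)))"
  have "bialt p (ys @ [y]) = poly r y" for y
  proof -
    have "det (M y) = (\<Sum>j<Suc n. M y $$ (n, j) * cofactor (M y) n j)"
      by (rule laplace_expansion_row) (auto simp: M_def dd_mat_def n_def)
    also have "\<dots> = (\<Sum>j<Suc n. cofactor (M 0) n j * poly (syn_divs ys (p j)) y)"
    proof (rule sum.cong)
      fix j assume "j \<in> {..<Suc n}"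
      then have "M y $$ (n, j) = poly (syn_divs ys (p j)) y" "j < Suc n"
        by (auto simp: M_def dd_mat_def n_def)
      then show "M y $$ (n, j) * cofactor (M y) n j = cofactor (M 0) n j * poly (syn_divs ys (p j)) y"
        using cof[of j y] by simp
    qed simp
    finally show ?thesis by (simp add: bialt_def M_def r_def poly_sum)
  qed
  moreover have "degree r \<le> d"
    unfolding r_def
  proof (rule degree_sum_le)
    fix j assume "j \<in> {..<Suc n}"
    then have "degree (p j) \<le> d + n" using assms by (simp add: n_def)
    then show "degree (smult (cofactor (M 0) n j) (syn_divs ys (p j))) \<le> d"
      using degree_smult_le[of "cofactor (M 0) n j" "syn_divs ys (p j)"]
      by (simp add: degree_syn_divs n_def)
  qed simp
  ultimately show ?thesis by blast
qed

section \<open>Closure properties of Laurent polynomials\<close>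

text \<open>The bound on the exponents is forgotten, so that sums, products and determinants need no
  bookkeeping of degrees.\<close>

definition laurent :: "nat \<Rightarrow> (complex list \<Rightarrow> complex) \<Rightarrow> bool" where
  "laurent N f \<longleftrightarrow> (\<exists>d. laurent_poly N d f)"

definition laurent_monom :: "int list \<Rightarrow> complex list \<Rightarrow> complex" where
  "laurent_monom m xs = (\<Prod>i<length m. (xs ! i) powi (m ! i))"

lemma laurent_polyE:
  assumes "laurent_poly N d f"
  obtains c where "\<And>xs. length xs = N \<Longrightarrow> 0 \<notin> set xs \<Longrightarrow>
    f xs = (\<Sum>m | length m = N \<and> set m \<subseteq> {-d..d}. c m * laurent_monom m xs)"
proof -
  obtain c where c: "\<And>xs. length xs = N \<Longrightarrow> 0 \<notin> set xs \<Longrightarrow>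
    f xs = (\<Sum>m | length m = N \<and> set m \<subseteq> {-d..d}. c m * (\<Prod>i<N. (xs ! i) powi (m ! i)))"
    using assms unfolding laurent_poly_def by blast
  show thesis
    by (rule that[of c], subst c) (auto simp: laurent_monom_def intro!: sum.cong)
qed

lemma finite_exponents: "finite {m :: int list. length m = N \<and> set m \<subseteq> {-d..d}}"
  using finite_lists_length_eq[of "{-d..d}" N] by (simp add: conj_commute)

lemma laurentI:
  assumes fin: "finite I" and len: "\<And>i. i \<in> I \<Longrightarrow> length (m i) = N"
    and f: "\<And>xs. length xs = N \<Longrightarrow> 0 \<notin> set xs \<Longrightarrow> f xs = (\<Sum>i\<in>I. c i * laurent_monom (m i) xs)"
  shows "laurent N f"
proof -
  define d where "d = Max (insert 0 (\<Union>i\<in>I. abs ` set (m i)))"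
  \<comment> \<open>Different indices may carry the same exponent vector, so their coefficients are
    collected.\<close>
  define c' where "c' = (\<lambda>k. \<Sum>i | i \<in> I \<and> m i = k. c i)"
  have fin': "finite (insert 0 (\<Union>i\<in>I. abs ` set (m i)))" using fin by auto
  have sub: "m ` I \<subseteq> {k. length k = N \<and> set k \<subseteq> {-d..d}}"
  proof safe
    fix i a assume "i \<in> I" "a \<in> set (m i)"
    then have "\<bar>a\<bar> \<le> d" unfolding d_def by (intro Max_ge[OF fin']) auto
    then show "a \<in> {-d..d}" by auto
  qed (auto simp: len)
  have "f xs = (\<Sum>k | length k = N \<and> set k \<subseteq> {-d..d}. c' k * (\<Prod>i<N. (xs ! i) powi (k ! i)))"
    if xs: "length xs = N" "0 \<notin> set xs" for xs
  proof -
    have "f xs = (\<Sum>k\<in>m ` I. \<Sum>i | i \<in> I \<and> m i = k. c i * laurent_monom (m i) xs)"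
      unfolding f[OF xs] by (rule sum.image_gen[OF fin])
    also have "\<dots> = (\<Sum>k\<in>m ` I. c' k * laurent_monom k xs)"
      unfolding c'_def sum_distrib_right by (intro sum.cong) auto
    also have "\<dots> = (\<Sum>k | length k = N \<and> set k \<subseteq> {-d..d}. c' k * laurent_monom k xs)"
    proof (rule sum.mono_neutral_left[OF finite_exponents sub], safe)
      fix k assume "k \<notin> m ` I"
      then have "{i \<in> I. m i = k} = {}" by auto
      then show "c' k * laurent_monom k xs = 0" by (simp add: c'_def del: Collect_empty_eq)
    qed
    finally show ?thesis by (auto simp: laurent_monom_def intro!: sum.cong)
  qed
  then show ?thesis unfolding laurent_def laurent_poly_def by blast
qed

lemma laurentE:
  assumes "laurent N f"
  obtains M c where "finite M" "\<And>m. m \<in> M \<Longrightarrow> length m = N"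
    "\<And>xs. length xs = N \<Longrightarrow> 0 \<notin> set xs \<Longrightarrow> f xs = (\<Sum>m\<in>M. c m * laurent_monom m xs)"
proof -
  obtain d where "laurent_poly N d f" using assms laurent_def by blast
  then obtain c where c: "\<And>xs. length xs = N \<Longrightarrow> 0 \<notin> set xs \<Longrightarrow>
    f xs = (\<Sum>m | length m = N \<and> set m \<subseteq> {-d..d}. c m * laurent_monom m xs)"
    by (rule laurent_polyE) blast
  show thesis
    by (rule that[OF finite_exponents _ c]) auto
qed

lemma laurent_cong:
  assumes "laurent N f" "\<And>xs. length xs = N \<Longrightarrow> 0 \<notin> set xs \<Longrightarrow> f xs = g xs"
  shows "laurent N g"
  using assms unfolding laurent_def laurent_poly_def by auto

lemma laurent_const: "laurent N (\<lambda>_. a)"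
  by (rule laurentI[of "{()}" "\<lambda>_. replicate N 0" _ _ "\<lambda>_. a"]) (auto simp: laurent_monom_def)

lemma laurent_powi: "i < N \<Longrightarrow> laurent N (\<lambda>xs. (xs ! i) powi k)"
  by (rule laurentI[of "{()}" "\<lambda>_. (replicate N 0)[i := k]" _ _ "\<lambda>_. 1"])
     (auto simp: laurent_monom_def nth_list_update if_distrib[of "power_int _"] prod.If_cases)

lemma laurent_add:
  assumes "laurent N f" "laurent N g"
  shows "laurent N (\<lambda>xs. f xs + g xs)"
proof -
  obtain M c where M: "finite M" "\<And>m. m \<in> M \<Longrightarrow> length m = N"
    "\<And>xs. length xs = N \<Longrightarrow> 0 \<notin> set xs \<Longrightarrow> f xs = (\<Sum>m\<in>M. c m * laurent_monom m xs)"
    using laurentE[OF assms(1)] by metis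
  obtain M' c' where M': "finite M'" "\<And>m. m \<in> M' \<Longrightarrow> length m = N"
    "\<And>xs. length xs = N \<Longrightarrow> 0 \<notin> set xs \<Longrightarrow> g xs = (\<Sum>m\<in>M'. c' m * laurent_monom m xs)"
    using laurentE[OF assms(2)] by metis
  show ?thesis
    by (rule laurentI[of "M <+> M'" "case_sum id id" _ _ "case_sum c c'"])
       (use M M' in \<open>auto simp: sum.Plus\<close>)
qed

lemma laurent_monom_mult:
  assumes "length m = N" "length m' = N" "length xs = N" "0 \<notin> set xs"
  shows "laurent_monom m xs * laurent_monom m' xs = laurent_monom (map2 (+) m m') xs"
proof -
  have "xs ! i \<noteq> 0" if "i < N" for i using assms that by (metis nth_mem)
  then show ?thesis
    using assms by (auto simp: laurent_monom_def power_int_add prod.distrib[symmetric] intro!: prod.cong)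
qed

lemma laurent_mult:
  assumes "laurent N f" "laurent N g"
  shows "laurent N (\<lambda>xs. f xs * g xs)"
proof -
  obtain M c where M: "finite M" "\<And>m. m \<in> M \<Longrightarrow> length m = N"
    "\<And>xs. length xs = N \<Longrightarrow> 0 \<notin> set xs \<Longrightarrow> f xs = (\<Sum>m\<in>M. c m * laurent_monom m xs)"
    using laurentE[OF assms(1)] by metis
  obtain M' c' where M': "finite M'" "\<And>m. m \<in> M' \<Longrightarrow> length m = N"
    "\<And>xs. length xs = N \<Longrightarrow> 0 \<notin> set xs \<Longrightarrow> g xs = (\<Sum>m\<in>M'. c' m * laurent_monom m xs)"
    using laurentE[OF assms(2)] by metis
  show ?thesis
  proof (rule laurentI[of "M \<times> M'" "\<lambda>(m, m'). map2 (+) m m'" _ _ "\<lambda>(m, m'). c m * c' m'"])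
    fix xs :: "complex list" assume xs: "length xs = N" "0 \<notin> set xs"
    have "f xs * g xs = (\<Sum>(m, m')\<in>M \<times> M'. (c m * laurent_monom m xs) * (c' m' * laurent_monom m' xs))"
      by (simp add: M(3)[OF xs] M'(3)[OF xs] sum_product sum.cartesian_product)
    also have "\<dots> = (\<Sum>k\<in>M \<times> M'. (case k of (m, m') \<Rightarrow> c m * c' m') *
                laurent_monom (case k of (m, m') \<Rightarrow> map2 (+) m m') xs)"
    proof (rule sum.cong)
      fix k assume "k \<in> M \<times> M'"
      then obtain m m' where k: "k = (m, m')" "m \<in> M" "m' \<in> M'" by auto
      show "(case k of (m, m') \<Rightarrow> (c m * laurent_monom m xs) * (c' m' * laurent_monom m' xs)) =
        (case k of (m, m') \<Rightarrow> c m * c' m') * laurent_monom (case k of (m, m') \<Rightarrow> map2 (+) m m') xs"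
        using laurent_monom_mult[OF M(2)[OF k(2)] M'(2)[OF k(3)] xs] k(1) by (simp add: mult_ac)
    qed simp
    finally show "f xs * g xs = \<dots>" .
  qed (use M M' in auto)
qed

lemma laurent_sum: "(\<And>i. i \<in> I \<Longrightarrow> laurent N (f i)) \<Longrightarrow> laurent N (\<lambda>xs. \<Sum>i\<in>I. f i xs)"
  by (induction I rule: infinite_finite_induct) (auto intro: laurent_const laurent_add)

lemma laurent_prod: "(\<And>i. i \<in> I \<Longrightarrow> laurent N (f i)) \<Longrightarrow> laurent N (\<lambda>xs. \<Prod>i\<in>I. f i xs)"
  by (induction I rule: infinite_finite_induct) (auto intro: laurent_const laurent_mult)

lemma laurent_power: "laurent N f \<Longrightarrow> laurent N (\<lambda>xs. f xs ^ n)"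
  by (induction n) (auto intro: laurent_const laurent_mult)

lemma laurent_det:
  assumes "\<And>i j. i < n \<Longrightarrow> j < n \<Longrightarrow> laurent N (\<lambda>xs. a i j xs)"
  shows "laurent N (\<lambda>xs. det (mat n n (\<lambda>(i, j). a i j xs)))"
proof -
  have "laurent N (\<lambda>xs. \<Sum>p | p permutes {0..<n}. signof p * (\<Prod>i = 0..<n. a i (p i) xs))"
    using permutes_in_image
    by (intro laurent_sum laurent_mult laurent_const laurent_prod assms) fastforce+
  moreover have "(\<Sum>p | p permutes {0..<n}. signof p * (\<Prod>i = 0..<n. a i (p i) xs))
     = det (mat n n (\<lambda>(i, j). a i j xs))" for xs
    by (subst det_def') (auto simp: permutes_in_image intro!: sum.cong prod.cong)
  ultimately show ?thesis by (rule laurent_cong)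
qed

text \<open>The coefficients of the quotient are computed from the top down, hence the downward
  induction from a degree bound that is uniform in \<open>xs\<close>.\<close>

lemma laurent_coeff_synthetic_div:
  assumes P: "\<And>i. laurent N (\<lambda>xs. coeff (P xs) i)" "\<And>xs. degree (P xs) \<le> d" and c: "laurent N c"
  shows "laurent N (\<lambda>xs. coeff (synthetic_div (P xs) (c xs)) i)"
proof (cases "i \<le> d")
  case True
  then show ?thesis
  proof (induction i rule: inc_induct)
    case base
    have "coeff (synthetic_div (P xs) (c xs)) d = 0" for xs
    proof (cases "d = 0")
      case True
      then have "synthetic_div (P xs) (c xs) = 0"
        using P(2)[of xs] by (simp add: synthetic_div_eq_0_iff)
      then show ?thesis by simp
    next
      case False
      then show ?thesis using P(2)[of xs] by (intro coeff_eq_0) (simp add: degree_synthetic_div)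
    qed
    then show ?case by (simp add: laurent_const)
  next
    case (step n)
    show ?case by (subst coeff_synthetic_div) (intro laurent_add laurent_mult P c step)
  qed
next
  case False
  then have "coeff (synthetic_div (P xs) (c xs)) i = 0" for xs
    using P(2)[of xs] by (intro coeff_eq_0) (simp add: degree_synthetic_div)
  then show ?thesis by (simp add: laurent_const)
qed

lemma laurent_poly_eval:
  assumes P: "\<And>i. laurent N (\<lambda>xs. coeff (P xs) i)" "\<And>xs. degree (P xs) \<le> d" and c: "laurent N c"
  shows "laurent N (\<lambda>xs. poly (P xs) (c xs))"
proof -
  have "poly (P xs) (c xs) = (\<Sum>i\<le>d. coeff (P xs) i * c xs ^ i)" for xs
    using P(2)[of xs] unfolding poly_altdef
    by (intro sum.mono_neutral_left) (auto simp: coeff_eq_0)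
  then show ?thesis by (simp add: laurent_sum laurent_mult laurent_power P c)
qed

text \<open>The family \<open>P\<close> uses the nodes \<open>y (xs ! k)\<close> on all lists,
  whereas \<open>take k (map y xs)\<close> yields these nodes only on lists that are long enough.
  The degree bound holds on all lists because the coefficient lemmas ask for that.\<close>

lemma laurent_syn_divs:
  assumes y: "\<And>k. k < N \<Longrightarrow> laurent N (\<lambda>xs. y (xs ! k))" and k: "k \<le> N"
  shows "\<exists>P. (\<forall>i. laurent N (\<lambda>xs. coeff (P xs) i)) \<and> (\<forall>xs. degree (P xs) \<le> degree p)
     \<and> (\<forall>xs. length xs = N \<longrightarrow> P xs = syn_divs (take k (map y xs)) p)"
  using k
proof (induction k)
  case 0
  show ?case by (rule exI[of _ "\<lambda>_. p"]) (auto intro: laurent_const)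
next
  case (Suc k)
  then obtain P where P: "\<And>i. laurent N (\<lambda>xs. coeff (P xs) i)" "\<And>xs. degree (P xs) \<le> degree p"
     "\<And>xs. length xs = N \<Longrightarrow> P xs = syn_divs (take k (map y xs)) p" by auto
  define Q where "Q xs = synthetic_div (P xs) (y (xs ! k))" for xs
  have "laurent N (\<lambda>xs. coeff (Q xs) i)" for i
    unfolding Q_def by (rule laurent_coeff_synthetic_div[OF P(1,2) y]) (use Suc.prems in simp)
  moreover have "degree (Q xs) \<le> degree p" for xs
    using P(2)[of xs] by (simp add: Q_def degree_synthetic_div)
  moreover have "Q xs = syn_divs (take (Suc k) (map y xs)) p" if "length xs = N" for xs
    using that Suc.prems P(3)[OF that] by (simp add: Q_def take_Suc_conv_app_nth syn_divs_append)
  ultimately show ?case by blast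
qed

text \<open>This makes the bialternant admissible for the choice in \<open>sp_char\<close>.\<close>

lemma laurent_bialt:
  assumes y: "\<And>k. k < N \<Longrightarrow> laurent N (\<lambda>xs. y (xs ! k))"
  shows "laurent N (\<lambda>xs. bialt p (map y xs))"
proof -
  have "laurent N (\<lambda>xs. det (mat N N (\<lambda>(k, j). poly (syn_divs (take k (map y xs)) (p j)) (y (xs ! k)))))"
  proof (rule laurent_det)
    fix k j assume kj: "k < N" "j < N"
    obtain P where P: "\<And>i. laurent N (\<lambda>xs. coeff (P xs) i)" "\<And>xs. degree (P xs) \<le> degree (p j)"
     "\<And>xs. length xs = N \<Longrightarrow> P xs = syn_divs (take k (map y xs)) (p j)"
      using laurent_syn_divs[of N y k "p j"] y kj by auto
    have "laurent N (\<lambda>xs. poly (P xs) (y (xs ! k)))"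
      by (rule laurent_poly_eval[OF P(1,2) y[OF kj(1)]])
    then show "laurent N (\<lambda>xs. poly (syn_divs (take k (map y xs)) (p j)) (y (xs ! k)))"
      by (rule laurent_cong) (simp add: P(3))
  qed
  then show ?thesis
    by (rule laurent_cong) (auto simp: bialt_def dd_mat_def intro!: arg_cong[of _ _ det] cong_mat)
qed


section \<open>Extension from generic to arbitrary points\<close>

text \<open>Continuity in each variable separately is enough, since genericity will be removed one
  coordinate at a time.\<close>

definition sep_cont :: "nat \<Rightarrow> (complex list \<Rightarrow> complex) \<Rightarrow> bool" where
  "sep_cont N F \<longleftrightarrow> (\<forall>xs i. length xs = N \<and> 0 \<notin> set xs \<and> i < N \<longrightarrow>
     continuous_on (-{0}) (\<lambda>t. F (xs[i := t])))"

lemma sep_contD: "sep_cont N F \<Longrightarrow> length xs = N \<Longrightarrow> 0 \<notin> set xs \<Longrightarrow> i < N \<Longrightarrow>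
    continuous_on (-{0}) (\<lambda>t. F (xs[i := t]))"
  by (simp add: sep_cont_def)

lemma sep_cont_arith:
  assumes "sep_cont N F" "sep_cont N G"
  shows "sep_cont N (\<lambda>xs. F xs - G xs)" "sep_cont N (\<lambda>xs. F xs * G xs)"
  using assms unfolding sep_cont_def by (auto intro!: continuous_intros)

lemma sep_cont_const: "sep_cont N (\<lambda>_. a)"
  by (auto simp: sep_cont_def)

lemma continuous_zero_cofinite:
  fixes \<phi> :: "complex \<Rightarrow> complex"
  assumes "continuous_on (-{0}) \<phi>" "finite B" "\<And>t. t \<noteq> 0 \<Longrightarrow> t \<notin> B \<Longrightarrow> \<phi> t = 0" "t \<noteq> 0"
  shows "\<phi> t = 0"
proof -
  have "isCont \<phi> t"
    using assms(1,4) by (simp add: continuous_on_eq_continuous_at open_Compl)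
  then have 1: "(\<phi> \<longlongrightarrow> \<phi> t) (at t)" by (simp add: isCont_def)
  have "open (- (insert 0 B - {t}))" using assms(2) by (intro open_Compl finite_imp_closed) auto
  then have "eventually (\<lambda>x. x \<in> - (insert 0 B - {t})) (at t)"
    by (intro eventually_at_in_open') auto
  then have "eventually (\<lambda>x. \<phi> x = 0) (at t)"
    using eventually_neq_at_within[of t t UNIV]
    by eventually_elim (use assms(3) in auto)
  then have "(\<phi> \<longlongrightarrow> 0) (at t)" by (rule tendsto_eventually)
  then show ?thesis using 1 tendsto_unique[OF at_neq_bot] by blast
qed

text \<open>The bad set of a coordinate depends on earlier coordinates only. The conditions are
  dropped from the last coordinate backwards: when those after k are already free, coordinate k can
  be moved alone without disturbing the conditions before it.\<close>

lemma sep_cont_eq_0: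
  assumes F: "sep_cont N F" and fin: "\<And>u. finite (Bad u)"
    and gen: "\<And>xs. length xs = N \<Longrightarrow> 0 \<notin> set xs \<Longrightarrow> (\<And>i. i < N \<Longrightarrow> xs ! i \<notin> Bad (take i xs)) \<Longrightarrow> F xs = 0"
    and xs: "length xs = N" "0 \<notin> set xs"
  shows "F xs = 0"
proof -
  have "k \<le> N \<Longrightarrow> \<forall>xs. length xs = N \<and> 0 \<notin> set xs \<and> (\<forall>i<k. xs ! i \<notin> Bad (take i xs)) \<longrightarrow> F xs = 0" for k
  proof (induction k rule: inc_induct)
    case base
    then show ?case using gen by auto
  next
    case (step k)
    show ?case
    proof (intro allI impI, elim conjE)
      fix xs :: "complex list"
      assume xs: "length xs = N" "0 \<notin> set xs" "\<forall>i<k. xs ! i \<notin> Bad (take i xs)"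
      have "F (xs[k := xs ! k]) = 0"
      proof (rule continuous_zero_cofinite[where \<phi> = "\<lambda>t. F (xs[k := t])"])
        show "continuous_on (- {0}) (\<lambda>t. F (xs[k := t]))"
          using F xs step.hyps by (intro sep_contD) auto
        show "finite (Bad (take k xs))" by (rule fin)
        show "xs ! k \<noteq> 0" using xs step.hyps by (metis nth_mem)
        fix t :: complex assume "t \<noteq> 0" "t \<notin> Bad (take k xs)"
        then have 1: "0 \<notin> set (xs[k := t])"
          and 2: "\<And>i. i < Suc k \<Longrightarrow> xs[k := t] ! i \<notin> Bad (take i (xs[k := t]))"
          using xs step.hyps set_update_subset_insert[of xs k t]
          by (auto simp: less_Suc_eq)
        have 3: "length (xs[k := t]) = N" using xs(1) by simp
        show "F (xs[k := t]) = 0"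
          by (rule step.IH[rule_format]) (intro conjI allI impI 1 2 3)
      qed
      then show "F xs = 0" by simp
    qed
  qed
  from this[of 0] show ?thesis using xs by auto
qed

lemma sep_cont_laurent:
  assumes "laurent N f"
  shows "sep_cont N f"
  unfolding sep_cont_def
proof safe
  fix xs :: "complex list" and i
  assume xs: "0 \<notin> set xs" "i < length xs" "N = length xs"
  obtain M c where M: "finite M" "\<And>m. m \<in> M \<Longrightarrow> length m = N"
    "\<And>xs. length xs = N \<Longrightarrow> 0 \<notin> set xs \<Longrightarrow> f xs = (\<Sum>m\<in>M. c m * laurent_monom m xs)"
    using laurentE[OF assms] by metis
  have "continuous_on (-{0}) (\<lambda>t. \<Sum>m\<in>M. c m * laurent_monom m (xs[i := t]))"
    unfolding laurent_monom_def
  proof (intro continuous_on_sum continuous_on_mult continuous_on_prod continuous_on_const)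
    fix m j assume "m \<in> M" "j \<in> {..<length m}"
    then have "j < length xs" using M(2) xs by auto
    then show "continuous_on (-{0}) (\<lambda>t. xs[i := t] ! j powi (m ! j))"
      using xs by (cases "i = j") (auto intro!: continuous_intros)
  qed
  then show "continuous_on (-{0}) (\<lambda>t. f (xs[i := t]))"
  proof (rule continuous_on_cong[THEN iffD1, OF refl, rotated])
    fix t :: complex assume "t \<in> -{0}"
    then show "(\<Sum>m\<in>M. c m * laurent_monom m (xs[i := t])) = f (xs[i := t])"
      using xs set_update_subset_insert[of xs i t] by (intro M(3)[symmetric]) auto
  qed
qed

section \<open>Symplectic characters\<close>

text \<open>The Chebyshev polynomials of the second kind, rescaled to U_n(y/2).\<close>

fun cheb :: "nat \<Rightarrow> complex poly" where
  "cheb 0 = 1"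
| "cheb (Suc 0) = [:0, 1:]"
| "cheb (Suc (Suc n)) = [:0, 1:] * cheb (Suc n) - cheb n"

lemma cheb_monic: "degree (cheb n) = n \<and> coeff (cheb n) n = 1"
proof (induction n rule: cheb.induct)
  case (3 n)
  have c: "coeff (cheb (Suc (Suc n))) (Suc (Suc n)) = 1"
    using 3 by (simp add: coeff_eq_0)
  have "degree (cheb (Suc (Suc n))) \<le> Suc (Suc n)"
    unfolding cheb.simps using 3 by (intro degree_diff_le) (auto intro: order.trans[OF degree_mult_le])
  moreover have "Suc (Suc n) \<le> degree (cheb (Suc (Suc n)))"
    by (rule le_degree) (use c in simp)
  ultimately have "degree (cheb (Suc (Suc n))) = Suc (Suc n)" by (rule antisym)
  then show ?case using c by (simp only:)
qed auto

lemma cheb_eval: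
  assumes "x \<noteq> 0"
  shows "(x - 1 / x) * poly (cheb n) (x + 1 / x) = x ^ Suc n - (1 / x) ^ Suc n"
proof (induction n rule: cheb.induct)
  case (3 n)
  have "(x - 1 / x) * poly (cheb (Suc (Suc n))) (x + 1 / x)
    = (x + 1 / x) * ((x - 1 / x) * poly (cheb (Suc n)) (x + 1 / x)) - (x - 1 / x) * poly (cheb n) (x + 1 / x)"
    by (simp add: right_diff_distrib mult.left_commute)
  also have "\<dots> = x ^ Suc (Suc (Suc n)) - (1 / x) ^ Suc (Suc (Suc n))"
    unfolding 3 using assms by (simp add: field_simps)
  finally show ?case .
qed (use assms in \<open>auto simp: field_simps power2_eq_square\<close>)

lemma det_scale_rows:
  fixes a :: "nat \<Rightarrow> nat \<Rightarrow> 'a::comm_ring_1"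
  shows "det (mat n n (\<lambda>(i, j). d i * a i j)) = (\<Prod>i<n. d i) * det (mat n n (\<lambda>(i, j). a i j))"
proof -
  define D where "D = mat n n (\<lambda>(i, j). if i = j then d i else 0)"
  have "mat n n (\<lambda>(i, j). d i * a i j) = D * mat n n (\<lambda>(i, j). a i j)"
    by (rule eq_matI) (auto simp: D_def scalar_prod_def if_distrib[of "\<lambda>x. x * _"] cong: if_cong)
  moreover have "det D = prod_list (diag_mat D)"
    by (rule det_upper_triangular) (auto simp: D_def upper_triangular_def)
  moreover have "prod_list (diag_mat D) = (\<Prod>i<n. d i)"
    by (simp add: diag_mat_def D_def prod.list_conv_set_nth atLeast0LessThan)
  ultimately show ?thesis using det_mult[of D n "mat n n (\<lambda>(i, j). a i j)"] by (simp add: D_def)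
qed

definition rev_perm :: "nat \<Rightarrow> nat \<Rightarrow> nat" where
  "rev_perm N j = (if j < N then N - 1 - j else j)"

lemma rev_perm_permutes: "rev_perm N permutes {0..<N}"
  by (rule bij_imp_permutes, rule bij_betw_byWitness[of _ "rev_perm N"]) (auto simp: rev_perm_def)

text \<open>The columns are reversed, so that the degree of the polynomial in column \<open>j\<close> increases with \<open>j\<close>.\<close>

lemma sp_alternant_bialt:
  assumes "length xs = length lam" "0 \<notin> set xs"
  shows "sp_alternant lam xs = signof (rev_perm (length lam)) * (\<Prod>i<length lam. xs ! i - 1 / xs ! i)
    * vdm (map (\<lambda>x. x + 1 / x) xs)
    * bialt (\<lambda>j. cheb (lam ! (length lam - 1 - j) + j)) (map (\<lambda>x. x + 1 / x) xs)"
proof -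
  define N where "N = length lam"
  define r where "r = rev_perm N"
  define ys where "ys = map (\<lambda>x. x + 1 / x) xs"
  define p where "p = (\<lambda>j. cheb (lam ! (N - 1 - j) + j))"
  define A where "A = mat N N (\<lambda>(i, j).
       (xs ! i) powi int (lam ! j + N - j) - (xs ! i) powi (- int (lam ! j + N - j)))"
  have A: "A \<in> carrier_mat N N" by (simp add: A_def)
  define B where "B = mat N N (\<lambda>(i, j). (xs ! i - 1 / xs ! i) * eval_mat p ys $$ (i, j))"
  have "mat N N (\<lambda>(j, i). transpose_mat A $$ (r j, i)) = transpose_mat B"
  proof (rule eq_matI)
    fix j i assume "j < dim_row (transpose_mat B)" "i < dim_col (transpose_mat B)"
    then have ij: "j < N" "i < N" by (auto simp: B_def)
    have xi: "xs ! i \<noteq> 0" using ij assms by (metis N_def nth_mem)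
    have rj: "r j < N" "r j = N - 1 - j" using ij by (auto simp: r_def rev_perm_def)
    have e: "lam ! (r j) + N - r j = Suc (lam ! (N - 1 - j) + j)"
      using ij by (simp add: rj)
    have "transpose_mat A $$ (r j, i) = (xs ! i) ^ Suc (lam ! (N - 1 - j) + j) - (1 / xs ! i) ^ Suc (lam ! (N - 1 - j) + j)"
      using ij rj(1) e
      by (simp add: A_def power_int_minus power_one_over[symmetric] divide_inverse power_int_of_nat power_inverse del: of_nat_Suc)
    also have "\<dots> = B $$ (i, j)"
      using ij assms unfolding cheb_eval[OF xi, symmetric]
      by (simp add: B_def eval_mat_def ys_def p_def N_def)
    finally show "mat N N (\<lambda>(j, i). transpose_mat A $$ (r j, i)) $$ (j, i) = transpose_mat B $$ (j, i)"
      using ij by (simp add: B_def)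
  qed (auto simp: B_def)
  then have "det B = signof r * det A"
    using det_permute_rows[of "transpose_mat A" N r] rev_perm_permutes A
    by (simp add: r_def det_transpose[of _ N] B_def)
  then have "det A = signof r * det B"
    by (simp add: sign_def)
  also have "det B = (\<Prod>i<N. xs ! i - 1 / xs ! i) * det (eval_mat p ys)"
  proof -
    have "mat N N (\<lambda>(i, j). eval_mat p ys $$ (i, j)) = eval_mat p ys"
      by (rule eq_matI) (use assms in \<open>auto simp: eval_mat_def ys_def N_def\<close>)
    then show ?thesis unfolding B_def det_scale_rows by simp
  qed
  finally show ?thesis
    by (simp add: sp_alternant_def det_eval_mat A_def Let_def N_def r_def ys_def p_def mult.assoc)
qed

text \<open>The sign, the factors x - 1/x and the Vandermonde product are common to both alternants,
  and for the zero partition the remaining bialternant is 1.\<close>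

lemma sp_alternant_quotient:
  assumes "length xs = length lam" "0 \<notin> set xs"
  shows "sp_alternant lam xs = sp_alternant (replicate (length lam) 0) xs
    * bialt (\<lambda>j. cheb (lam ! (length lam - 1 - j) + j)) (map (\<lambda>x. x + 1 / x) xs)"
proof -
  have "bialt (\<lambda>j. cheb (replicate (length lam) 0 ! (length lam - 1 - j) + j)) (map (\<lambda>x. x + 1 / x) xs) = 1"
    by (rule bialt_monic) (use cheb_monic assms in auto)
  then show ?thesis
    using sp_alternant_bialt[OF assms] sp_alternant_bialt[of xs "replicate (length lam) 0"] assms by simp
qed

text \<open>The denominator is, up to sign, the product of the x_i - 1/x_i times the Vandermonde
  product in x_i + 1/x_i; the excluded values are the zeros of these factors.\<close>

lemma sp_alternant_ne_0:
  assumes len: "length xs = N" and nz: "0 \<notin> set xs"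
    and gen: "\<And>i. i < N \<Longrightarrow> xs ! i \<notin> {1, -1} \<union> set (take i xs) \<union> (\<lambda>x. 1 / x) ` set (take i xs)"
  shows "sp_alternant (replicate N 0) xs \<noteq> 0"
proof -
  define ys where "ys = map (\<lambda>x. x + 1 / x) xs"
  have "bialt (\<lambda>j. cheb (replicate N 0 ! (N - 1 - j) + j)) ys = 1"
    by (rule bialt_monic) (use cheb_monic len in \<open>auto simp: ys_def\<close>)
  moreover have "(\<Prod>i<N. xs ! i - 1 / xs ! i) \<noteq> 0"
  proof -
    have "xs ! i - 1 / xs ! i \<noteq> 0" if "i < N" for i
    proof
      assume "xs ! i - 1 / xs ! i = 0"
      moreover have "xs ! i \<noteq> 0" using that len nz by (metis nth_mem)
      ultimately have "(xs ! i)^2 = 1" by (simp add: field_simps power2_eq_square)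
      then show False using gen[OF that] by (simp add: power2_eq_1_iff)
    qed
    then show ?thesis by simp
  qed
  moreover have "vdm ys \<noteq> 0"
  proof (rule vdm_ne_0)
    have "ys ! i \<noteq> ys ! j" if "j < i" "i < N" for i j
    proof
      assume eq: "ys ! i = ys ! j"
      have xs: "xs ! i \<noteq> 0" "xs ! j \<noteq> 0" using that len nz by (metis nth_mem order.strict_trans)+
      have "(xs ! i - xs ! j) * (xs ! i * xs ! j - 1) = xs ! i * xs ! j * (ys ! i - ys ! j)"
        using xs that len by (simp add: ys_def field_simps)
      then have "xs ! i - xs ! j = 0 \<or> xs ! i * xs ! j - 1 = 0" by (simp only: eq) auto
      then have "xs ! i = xs ! j \<or> xs ! i = 1 / xs ! j" using xs by (auto simp: eq_divide_eq)
      moreover have "xs ! j \<in> set (take i xs)"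
        using that len by (auto simp: in_set_conv_nth)
      ultimately show False using gen[OF that(2)] by auto
    qed
    then show "distinct ys" unfolding distinct_conv_nth using len
      by (metis length_map linorder_neqE_nat ys_def)
  qed
  moreover have "signof (rev_perm N) \<noteq> (0 :: complex)" by (simp add: sign_def)
  ultimately show ?thesis
    using sp_alternant_bialt[of xs "replicate N 0"] len nz by (simp add: ys_def)
qed

text \<open>The bialternant meets the specification, so the chosen function meets it too. The two
  agree off the zeros of the denominator and hence, by continuity, at all nonzero arguments.\<close>

lemma sp_char_eq:
  assumes xs: "length xs = length lam" "0 \<notin> set xs"
  shows "sp_char lam xs = bialt (\<lambda>j. cheb (lam ! (length lam - 1 - j) + j)) (map (\<lambda>x. x + 1 / x) xs)"
proof -
  define N where "N = length lam"
  define g where "g = (\<lambda>xs. bialt (\<lambda>j. cheb (lam ! (N - 1 - j) + j)) (map (\<lambda>x. x + 1 / x) xs))"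
  define spec where "spec f \<longleftrightarrow> (\<exists>d. laurent_poly (length lam) d f) \<and>
     (\<forall>xs. length xs = length lam \<and> 0 \<notin> set xs \<and> sp_alternant (replicate (length lam) 0) xs \<noteq> 0 \<longrightarrow>
        f xs = sp_alternant lam xs / sp_alternant (replicate (length lam) 0) xs)" for f
  have lg: "laurent N g"
    unfolding g_def
  proof (rule laurent_bialt)
    fix k assume "k < N"
    then have "laurent N (\<lambda>xs. (xs ! k) powi 1 + (xs ! k) powi (-1))"
      by (intro laurent_add laurent_powi)
    then show "laurent N (\<lambda>xs. xs ! k + 1 / xs ! k)" by (simp add: power_int_minus divide_inverse)
  qed
  have "spec g"
    using lg sp_alternant_quotient[of _ lam] unfolding spec_def laurent_def by (auto simp: g_def N_def)
  then have "spec (sp_char lam)"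
    unfolding sp_char_def spec_def[symmetric] by (rule someI[of spec g])
  then have f: "laurent N (sp_char lam)" 
    "\<And>xs. length xs = N \<Longrightarrow> 0 \<notin> set xs \<Longrightarrow> sp_alternant (replicate N 0) xs \<noteq> 0 \<Longrightarrow> sp_char lam xs = g xs"
    using sp_alternant_quotient[of _ lam] unfolding spec_def laurent_def by (auto simp: g_def N_def)
  have "sp_char lam xs - g xs = 0"
  proof (rule sep_cont_eq_0[where F = "\<lambda>xs. sp_char lam xs - g xs" and N = N and 
          Bad = "\<lambda>u. {1, -1} \<union> set u \<union> (\<lambda>x. 1 / x) ` set u"])
    show "sep_cont N (\<lambda>xs. sp_char lam xs - g xs)"
      by (intro sep_cont_arith sep_cont_laurent f lg)
    show "sp_char lam xs - g xs = 0" if "length xs = N" "0 \<notin> set xs"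
      "\<And>i. i < N \<Longrightarrow> xs ! i \<notin> {1, -1} \<union> set (take i xs) \<union> (\<lambda>x. 1 / x) ` set (take i xs)" for xs
      using f(2) that sp_alternant_ne_0[OF that] by simp
  qed (use xs in \<open>auto simp: N_def\<close>)
  then show ?thesis by (simp add: g_def N_def)
qed


section \<open>The characters \<open>\<tau>\<^sub>N\<close>\<close>

definition sq_sum :: "complex \<Rightarrow> complex" where
  "sq_sum x = x\<^sup>2 + 1 / x\<^sup>2"

text \<open>In reversed column order the part in column j is j div 2 whatever N is, so one sequence
  of polynomials serves all sizes. The exponents j div 2 + j + 1 run through 1, 2, 4, 5, 7, 8,
  ...\<close>

definition tau_poly :: "nat \<Rightarrow> complex poly" where
  "tau_poly j = cheb (j div 2 + j)"

definition tau_sum :: "complex list \<Rightarrow> complex" where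
  "tau_sum ys = bialt tau_poly ys"

lemma tau_eq:
  assumes "length xs = N" "0 \<notin> set xs"
  shows "tau N xs = tau_sum (map sq_sum xs)"
proof -
  define lam where "lam = map (\<lambda>j. (N - j) div 2) [1..<N+1]"
  have lam: "length lam = N" by (simp add: lam_def)
  have "lam ! (N - 1 - j) = j div 2" if "j < N" for j
    using that by (simp add: lam_def nth_map del: upt_Suc)
  then have "bialt (\<lambda>j. cheb (lam ! (N - 1 - j) + j)) ys = bialt tau_poly ys" if "length ys = N" for ys
    unfolding bialt_def dd_mat_def tau_poly_def using that
    by (intro arg_cong[of _ _ det] cong_mat) auto
  moreover have "tau N xs = sp_char lam (map (\<lambda>x. x\<^sup>2) xs)"
    by (simp only: tau_def lam_def)
  moreover have "0 \<notin> set (map (\<lambda>x. x\<^sup>2) xs)" using assms by auto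
  ultimately show ?thesis
    using sp_char_eq[of "map (\<lambda>x. x\<^sup>2) xs" lam] assms lam
    by (simp add: tau_sum_def comp_def sq_sum_def[abs_def])
qed

lemma tau_sum_move: "tau_sum (a @ x # b) = tau_sum (x # a @ b)"
  by (simp add: tau_sum_def bialt_move_front)

lemma tau_sum_short: "length ys \<le> 2 \<Longrightarrow> tau_sum ys = 1"
  unfolding tau_sum_def
proof (rule bialt_monic)
  fix j assume "length ys \<le> 2" "j < length ys"
  then have "j div 2 = 0" by simp
  then show "degree (tau_poly j) = j" "coeff (tau_poly j) j = 1"
    using cheb_monic[of j] by (auto simp: tau_poly_def)
qed

lemma tau_sum_last:
  "\<exists>r. degree r \<le> length ys div 2 \<and> (\<forall>y. tau_sum (ys @ [y]) = poly r y)"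
  unfolding tau_sum_def
proof (rule bialt_last)
  fix j assume "j \<le> length ys"
  then have "j div 2 \<le> length ys div 2" by (rule div_le_mono)
  then show "degree (tau_poly j) \<le> length ys div 2 + length ys"
    using \<open>j \<le> length ys\<close> cheb_monic by (simp add: tau_poly_def)
qed

text \<open>With y = x + 1/x the factor y^3 - 3y is x^3 + x^(-3), and multiplying x^e - x^(-e) by it
  yields the exponents e + 3 and e - 3. For e = 1 and e = 2 the lower one is -2 or -1, which turns
  the sign and couples the first two polynomials.\<close>

lemma tau_poly_rec:
  "poly (tau_poly 2) y = (y ^ 3 - 3 * y) * poly (tau_poly 0) y + poly (tau_poly 1) y"
  "poly (tau_poly 3) y = (y ^ 3 - 3 * y) * poly (tau_poly 1) y + poly (tau_poly 0) y"
  "poly (tau_poly (j + 4)) y = (y ^ 3 - 3 * y) * poly (tau_poly (j + 2)) y - poly (tau_poly j) y"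
proof -
  have e: "(j + 4) div 2 + (j + 4) = Suc (Suc (Suc (Suc (Suc (Suc (j div 2 + j))))))"
    "(j + 2) div 2 + (j + 2) = Suc (Suc (Suc (j div 2 + j)))"
    "(2::nat) div 2 + 2 = Suc (Suc (Suc 0))" "(3::nat) div 2 + 3 = Suc (Suc (Suc (Suc 0)))"
    "(1::nat) div 2 + 1 = Suc 0" "(0::nat) div 2 + 0 = 0" by simp_all
  show "poly (tau_poly 2) y = (y ^ 3 - 3 * y) * poly (tau_poly 0) y + poly (tau_poly 1) y"
    "poly (tau_poly 3) y = (y ^ 3 - 3 * y) * poly (tau_poly 1) y + poly (tau_poly 0) y"
    "poly (tau_poly (j + 4)) y = (y ^ 3 - 3 * y) * poly (tau_poly (j + 2)) y - poly (tau_poly j) y"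
    unfolding tau_poly_def e by (simp_all add: algebra_simps power3_eq_cube)
qed

text \<open>The exponents that occur in \<open>\<tau>\<^sub>N\<close> are the positive integers not divisible by 3. Subtracting
  multiples of earlier columns therefore leaves a factor that vanishes on the rows of \<open>c\<close> and \<open>c'\<close>.\<close>

lemma tau_sum_rec:
  assumes c: "c\<^sup>2 + c * c' + c'\<^sup>2 = 3" and dist: "distinct (c # c' # ys)"
  shows "tau_sum (c # c' # ys) = (\<Prod>y\<leftarrow>ys. y + c + c') * tau_sum ys"
proof -
  define N where "N = length ys"
  define n where "n = N + 2"
  define w where "w = c ^ 3 - 3 * c"
  define zs where "zs = c # c' # ys"
  \<comment> \<open>Unitriangular column operations read off from \<open>tau_poly_rec\<close>: from
    j = 2 on, column j becomes y^3 - 3y - w times column j - 2. The extra entries -1 belong to the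
    two recurrences whose lower exponent is negative.\<close>
  define C where "C = mat n n (\<lambda>(k, j). (if k = j then 1 else 0) + (if k + 2 = j then - w else 0)
     + (if j = 2 \<and> k = 1 \<or> j = 3 \<and> k = 0 then -1 else 0) + (if k + 4 = j then 1 else 0))"
  define A where "A = eval_mat tau_poly zs"
  define A1 where "A1 = eval_mat tau_poly [c, c']"
  define A3 where "A3 = mat N 2 (\<lambda>(i, j). poly (tau_poly j) (ys ! i))"
  define A4 where "A4 = mat N N (\<lambda>(i, j). ((ys ! i) ^ 3 - 3 * ys ! i - w) * poly (tau_poly j) (ys ! i))"
  \<comment> \<open>The hypothesis on c and c' makes both of them roots of the cubic; the third root
    is -(c + c') because the quadratic term is missing.\<close>
  have w: "y ^ 3 - 3 * y - w = (y - c) * (y - c') * (y + c + c')" for y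
  proof -
    have "c * c' * (c + c') = c * (c\<^sup>2 + c * c' + c'\<^sup>2) - c ^ 3"
      by (simp add: algebra_simps power2_eq_square power3_eq_cube)
    then have "c * c' * (c + c') = - w" by (simp add: c w_def)
    moreover have "(y - c) * (y - c') * (y + c + c') = y ^ 3 - (c\<^sup>2 + c * c' + c'\<^sup>2) * y + c * c' * (c + c')"
      by (simp add: algebra_simps power2_eq_square power3_eq_cube)
    ultimately show ?thesis by (simp add: c)
  qed
  have AC: "(\<Sum>k<n. poly (tau_poly k) y * C $$ (k, j))
     = (if j < 2 then poly (tau_poly j) y else (y ^ 3 - 3 * y - w) * poly (tau_poly (j - 2)) y)"
    if "j < n" for j y
  proof -
    have *: "(\<Sum>k<n. poly (tau_poly k) y * (if k = a then b else 0)) = poly (tau_poly a) y * b" if "a < n" for a b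
      using that by (simp add: if_distrib[of "\<lambda>x. _ * x"] cong: if_cong)
    consider "j = 0" | "j = 1" | "j = 2" | "j = 3" | i where "j = i + 4"
    proof -
      have "j = 0 \<or> j = 1 \<or> j = 2 \<or> j = 3 \<or> j = (j - 4) + 4" by linarith
      then show thesis using that by blast
    qed
    then show ?thesis
    proof cases
      case 1
      have "(\<Sum>k<n. poly (tau_poly k) y * C $$ (k, j)) = (\<Sum>k<n. poly (tau_poly k) y * (if k = 0 then 1 else 0))"
        using 1 that by (intro sum.cong) (auto simp: C_def)
      then show ?thesis using 1 that * by simp
    next
      case 2
      have "(\<Sum>k<n. poly (tau_poly k) y * C $$ (k, j)) = (\<Sum>k<n. poly (tau_poly k) y * (if k = 1 then 1 else 0))"
        using 2 that by (intro sum.cong) (auto simp: C_def)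
      then show ?thesis using 2 that * by simp
    next
      case 3
      have "(\<Sum>k<n. poly (tau_poly k) y * C $$ (k, j)) = (\<Sum>k<n. poly (tau_poly k) y * (if k = 2 then 1 else 0) +
          poly (tau_poly k) y * (if k = 0 then -w else 0) + poly (tau_poly k) y * (if k = 1 then -1 else 0))"
        using 3 that by (intro sum.cong) (auto simp: C_def)
      also have "\<dots> = poly (tau_poly 2) y * 1 + poly (tau_poly 0) y * (-w) + poly (tau_poly 1) y * (-1)"
        using 3 that unfolding sum.distrib by (simp only: *)
      finally show ?thesis using 3 unfolding tau_poly_rec by (simp add: algebra_simps)
    next
      case 4
      have "(\<Sum>k<n. poly (tau_poly k) y * C $$ (k, j)) = (\<Sum>k<n. poly (tau_poly k) y * (if k = 3 then 1 else 0) +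
          poly (tau_poly k) y * (if k = 1 then -w else 0) + poly (tau_poly k) y * (if k = 0 then -1 else 0))"
        using 4 that by (intro sum.cong) (auto simp: C_def)
      also have "\<dots> = poly (tau_poly 3) y * 1 + poly (tau_poly 1) y * (-w) + poly (tau_poly 0) y * (-1)"
        using 4 that unfolding sum.distrib by (simp only: *)
      finally show ?thesis using 4 unfolding tau_poly_rec by (simp add: algebra_simps)
    next
      case 5
      have "(\<Sum>k<n. poly (tau_poly k) y * C $$ (k, j)) = (\<Sum>k<n. poly (tau_poly k) y * (if k = i + 4 then 1 else 0) +
          poly (tau_poly k) y * (if k = i + 2 then -w else 0) + poly (tau_poly k) y * (if k = i then 1 else 0))"
        using 5 that by (intro sum.cong) (auto simp: C_def)
      also have "\<dots> = poly (tau_poly (i + 4)) y * 1 + poly (tau_poly (i + 2)) y * (-w) + poly (tau_poly i) y * 1"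
        using 5 that unfolding sum.distrib by (simp only: *)
      finally show ?thesis using 5 unfolding tau_poly_rec by (simp add: algebra_simps)
    qed
  qed
  \<comment> \<open>The rows of c and c' vanish from column 2 on. The block left in the corner
    belongs to the polynomials 1 and y and has determinant c' - c.\<close>
  have "A * C = four_block_mat A1 (0\<^sub>m 2 N) A3 A4"
  proof (rule eq_matI)
    fix i j assume "i < dim_row (four_block_mat A1 (0\<^sub>m 2 N) A3 A4)" "j < dim_col (four_block_mat A1 (0\<^sub>m 2 N) A3 A4)"
    then have ij: "i < n" "j < n" by (auto simp: A1_def A4_def n_def eval_mat_def)
    have "(A * C) $$ (i, j) = (\<Sum>k<n. poly (tau_poly k) (zs ! i) * C $$ (k, j))"
      using ij by (simp add: A_def C_def eval_mat_def zs_def n_def N_def scalar_prod_def atLeast0LessThan)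
    also have "\<dots> = four_block_mat A1 (0\<^sub>m 2 N) A3 A4 $$ (i, j)"
      unfolding AC[OF ij(2)] using ij w[of c] w[of c']
      by (auto simp: A1_def A3_def A4_def eval_mat_def n_def zs_def nth_Cons' less_2_cases_iff numeral_2_eq_2)
    finally show "(A * C) $$ (i, j) = four_block_mat A1 (0\<^sub>m 2 N) A3 A4 $$ (i, j)" .
  qed (auto simp: A_def C_def A1_def A4_def eval_mat_def zs_def n_def N_def)
  then have "det (A * C) = det A1 * det A4"
    by (simp only:) (rule det_four_block_mat_upper_right_zero[of _ 2 _ N], auto simp: A1_def A3_def A4_def eval_mat_def)
  moreover have "det C = 1"
  proof -
    have "det C = prod_list (diag_mat C)"
      by (rule det_upper_triangular) (auto simp: C_def upper_triangular_def)
    also have "\<dots> = 1" by (auto simp: diag_mat_def C_def prod.list_conv_set_nth intro!: prod.neutral)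
    finally show ?thesis .
  qed
  moreover have "det (A * C) = det A * det C"
    by (rule det_mult[of _ n]) (auto simp: A_def C_def eval_mat_def zs_def n_def N_def)
  moreover have "det A1 = c' - c"
    using tau_sum_short[of "[c, c']"] by (simp add: A1_def det_eval_mat tau_sum_def)
  moreover have "det A4 = (\<Prod>y\<leftarrow>ys. y ^ 3 - 3 * y - w) * (vdm ys * tau_sum ys)"
  proof -
    have "det A4 = (\<Prod>i<N. (ys ! i) ^ 3 - 3 * ys ! i - w) * det (eval_mat tau_poly ys)"
      unfolding A4_def det_scale_rows by (simp add: eval_mat_def N_def)
    then show ?thesis by (simp add: prod.list_conv_set_nth N_def atLeast0LessThan det_eval_mat tau_sum_def)
  qed
  moreover have "det A = vdm zs * tau_sum zs"
    by (simp add: A_def det_eval_mat tau_sum_def)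
  ultimately have "vdm zs * tau_sum zs = (c' - c) * ((\<Prod>y\<leftarrow>ys. y ^ 3 - 3 * y - w) * (vdm ys * tau_sum ys))"
    by simp
  also have "(\<Prod>y\<leftarrow>ys. y ^ 3 - 3 * y - w) = (\<Prod>y\<leftarrow>ys. y - c) * (\<Prod>y\<leftarrow>ys. y - c') * (\<Prod>y\<leftarrow>ys. y + c + c')"
    by (induction ys) (simp_all add: w)
  \<comment> \<open>The factors y - c and y - c' complete (c' - c) \<open>vdm ys\<close> to
    \<open>vdm zs\<close>, which can be cancelled for distinct nodes.\<close>
  finally have "vdm zs * tau_sum zs = vdm zs * ((\<Prod>y\<leftarrow>ys. y + c + c') * tau_sum ys)"
    by (simp add: zs_def mult_ac)
  then show ?thesis using vdm_ne_0[OF dist] by (simp add: zs_def)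
qed

section \<open>The weights at a cube root of unity\<close>

lemma q0_cube: "q0 ^ 3 = 1"
proof -
  have "q0 ^ 3 = exp (of_nat 3 * (2 * of_real pi * \<i> / 3))"
    unfolding q0_def by (rule exp_of_nat_mult[symmetric])
  also have "of_nat 3 * (2 * of_real pi * \<i> / 3) = 2 * complex_of_real pi * \<i>" by simp
  finally show ?thesis by (simp only: exp_two_pi_i)
qed

lemma q0_neq: "q0 \<noteq> 0" "q0 \<noteq> 1"
proof -
  have q: "q0 = cis (2 * pi / 3)" unfolding q0_def cis_conv_exp by (rule arg_cong[of _ _ exp]) simp
  have "Im q0 = sin (2 * pi / 3)" unfolding q by (rule cis.sel(2))
  also have "\<dots> > 0" by (rule sin_gt_zero) simp_all
  finally show "q0 \<noteq> 1" by auto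
  show "q0 \<noteq> 0" by (simp add: q0_def)
qed

lemma q0_sq: "q0\<^sup>2 = - 1 - q0"
proof -
  have "(q0 - 1) * (q0\<^sup>2 + q0 + 1) = q0 ^ 3 - 1"
    by (simp add: algebra_simps power2_eq_square power3_eq_cube)
  then have "q0\<^sup>2 + q0 + 1 = 0" using q0_cube q0_neq by simp
  then show ?thesis by (simp add: algebra_simps eq_neg_iff_add_eq_0)
qed

lemma q0_inverse: "1 / q0 = q0\<^sup>2" "1 / q0\<^sup>2 = q0"
  using q0_cube q0_neq by (simp_all add: field_simps power2_eq_square power3_eq_cube)

lemma q0_pow6: "q0 ^ 6 = 1"
  using q0_cube power_mult[of q0 3 2] by simp

lemma q0_sq_neq_1: "q0\<^sup>2 \<noteq> 1"
  using q0_cube q0_neq by (auto simp: power3_eq_cube power2_eq_square)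

lemma br_eq_0_iff: "x \<noteq> 0 \<Longrightarrow> br x = 0 \<longleftrightarrow> x\<^sup>2 = 1"
  by (auto simp: br_def field_simps power2_eq_square)

lemma br_inverse: "br (1 / x) = - br x"
  by (simp add: br_def)

text \<open>Because 1 + q + q^2 = 0, the weight becomes additive. The symmetries in
  \<open>kf_sym_args\<close> and the match with the factors y + c + c' of \<open>tau_sum_rec\<close>
  are read off from this form.\<close>

lemma kf_eq:
  assumes "x \<noteq> 0" "y \<noteq> 0"
  shows "kf x y = - sq_sum x - sq_sum (q0 * x) - sq_sum y"
proof -
  have "kf x y = x\<^sup>2 * (1 / q0\<^sup>2) + q0\<^sup>2 / x\<^sup>2 - y\<^sup>2 - 1 / y\<^sup>2"
    using assms q0_neq by (simp add: kf_def br_def field_simps power2_eq_square)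
  moreover have "sq_sum (q0 * x) = x\<^sup>2 * q0\<^sup>2 + (1 / q0\<^sup>2) / x\<^sup>2"
    by (simp add: sq_sum_def power_mult_distrib)
  ultimately show ?thesis unfolding q0_inverse
    by (simp add: sq_sum_def q0_sq algebra_simps diff_divide_distrib)
qed

lemma sq_sum_1_div: "sq_sum (1 / x) = sq_sum x"
  by (simp add: sq_sum_def power_one_over)

lemma kf_sym_args:
  assumes "x \<noteq> 0" "y \<noteq> 0"
  shows "kf x (1 / y) = kf x y" "kf (1 / (q0 * x)) y = kf x y"
  using assms q0_neq sq_sum_1_div[of "q0 * x"] sq_sum_1_div[of x] by (simp_all add: kf_eq sq_sum_1_div)

text \<open>Sixth powers forget signs and powers of q. The condition is thus stable under
  multiplication by q and under inversion, and it excludes the zeros of k and of the ratios in the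
  exchange relations.\<close>

definition generic_pair :: "complex \<Rightarrow> complex \<Rightarrow> bool" where
  "generic_pair x y \<longleftrightarrow> x ^ 6 \<noteq> y ^ 6 \<and> x ^ 6 * y ^ 6 \<noteq> 1"

lemma generic_pair_sym: "generic_pair x y \<longleftrightarrow> generic_pair y x"
  unfolding generic_pair_def by (metis mult.commute)

lemma generic_pair_trans [simp]:
  "generic_pair (q0 * x) y \<longleftrightarrow> generic_pair x y"
  "generic_pair (x / q0) y \<longleftrightarrow> generic_pair x y"
  by (auto simp: generic_pair_def power_mult_distrib power_divide q0_pow6)

lemma generic_pair_1_div [simp]:
  assumes "x \<noteq> 0" 
  shows "generic_pair (1 / x) y \<longleftrightarrow> generic_pair x y" "generic_pair y (1 / x) \<longleftrightarrow> generic_pair y x"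
proof -
  have "1 / x ^ 6 = y ^ 6 \<longleftrightarrow> x ^ 6 * y ^ 6 = 1" "1 / x ^ 6 * y ^ 6 = 1 \<longleftrightarrow> x ^ 6 = y ^ 6"
    using assms by (auto simp: field_simps)
  then show "generic_pair (1 / x) y \<longleftrightarrow> generic_pair x y"
    unfolding generic_pair_def power_one_over by blast
  then show "generic_pair y (1 / x) \<longleftrightarrow> generic_pair y x"
    by (simp only: generic_pair_sym[of y])
qed

lemma br_eq_0_pow6:
  assumes "br x = 0" "x \<noteq> 0"
  shows "x ^ 6 = 1"
proof -
  have "(x\<^sup>2) ^ 3 = 1" using assms by (simp add: br_eq_0_iff)
  then show ?thesis by (simp only: power_mult[symmetric]) simp
qed

lemma kf_ne_0:
  assumes "generic_pair x y" "x \<noteq> 0" "y \<noteq> 0"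
  shows "kf x y \<noteq> 0"
proof
  assume "kf x y = 0"
  then have "(x / (q0 * y)) ^ 6 = 1 \<or> (x * y / q0) ^ 6 = 1"
    using br_eq_0_pow6[of "x / (q0 * y)"] br_eq_0_pow6[of "x * y / q0"] assms q0_neq by (auto simp: kf_def)
  then show False using assms by (auto simp: generic_pair_def power_divide power_mult_distrib q0_pow6)
qed

lemma br_ratio_ne_0:
  assumes "generic_pair x y" "x \<noteq> 0" "y \<noteq> 0"
  shows "br (q0 * x / y) \<noteq> 0"
proof
  assume "br (q0 * x / y) = 0"
  then have "(q0 * x / y) ^ 6 = 1" using br_eq_0_pow6[of "q0 * x / y"] assms q0_neq by simp
  then show False using assms by (simp add: generic_pair_def power_divide power_mult_distrib q0_pow6)
qed

lemma sq_sum_inj: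
  assumes "generic_pair x y" "x \<noteq> 0" "y \<noteq> 0"
  shows "sq_sum x \<noteq> sq_sum y"
proof
  assume eq: "sq_sum x = sq_sum y"
  have "(x\<^sup>2 - y\<^sup>2) * (x\<^sup>2 * y\<^sup>2 - 1) = x\<^sup>2 * y\<^sup>2 * (sq_sum x - sq_sum y)"
    using assms by (simp add: sq_sum_def field_simps)
  then have "x\<^sup>2 - y\<^sup>2 = 0 \<or> x\<^sup>2 * y\<^sup>2 - 1 = 0" by (simp only: eq) auto
  then have "x\<^sup>2 = y\<^sup>2 \<or> x\<^sup>2 * y\<^sup>2 = 1" by simp
  then have "(x\<^sup>2) ^ 3 = (y\<^sup>2) ^ 3 \<or> (x\<^sup>2 * y\<^sup>2) ^ 3 = 1"
    by (elim disjE) (simp_all only: power_one simp_thms)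
  moreover have pow6: "z ^ 6 = (z\<^sup>2) ^ 3" for z :: complex by (simp only: power_mult[symmetric]) simp
  ultimately show False using assms(1)
    unfolding generic_pair_def pow6 power_mult_distrib[symmetric] by blast
qed

fun kprod :: "complex list \<Rightarrow> complex" where
  "kprod [] = 1"
| "kprod (x # xs) = (\<Prod>y\<leftarrow>xs. kf y x) * kprod xs"

lemma kprod_snoc: "kprod (xs @ [z]) = kprod xs * (\<Prod>x\<leftarrow>xs. kf z x)"
  by (induction xs) (simp_all add: mult_ac)

lemma kprod_pairs: "kprod xs = (\<Prod>(i, j)\<in>{(i, j). i < j \<and> j < length xs}. kf (xs ! j) (xs ! i))"
proof (induction xs rule: rev_induct)
  case (snoc z xs)
  define n where "n = length xs"
  have eq: "{(i, j). i < j \<and> j < length (xs @ [z])} = {(i, j). i < j \<and> j < n} \<union> (\<lambda>i. (i, n)) ` {..<n}"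
    by (auto simp: n_def less_Suc_eq)
  have fin: "finite {(i, j). i < j \<and> j < n}"
    by (rule finite_subset[of _ "{..<n} \<times> {..<n}"]) auto
  have "(\<Prod>(i, j)\<in>{(i, j). i < j \<and> j < length (xs @ [z])}. kf ((xs @ [z]) ! j) ((xs @ [z]) ! i))
     = (\<Prod>(i, j)\<in>{(i, j). i < j \<and> j < n}. kf ((xs @ [z]) ! j) ((xs @ [z]) ! i))
     * (\<Prod>(i, j)\<in>(\<lambda>i. (i, n)) ` {..<n}. kf ((xs @ [z]) ! j) ((xs @ [z]) ! i))"
    unfolding eq using fin by (intro prod.union_disjoint) auto
  also have "(\<Prod>(i, j)\<in>{(i, j). i < j \<and> j < n}. kf ((xs @ [z]) ! j) ((xs @ [z]) ! i)) = kprod xs"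
    unfolding snoc.IH n_def by (intro prod.cong) (auto simp: nth_append)
  also have "(\<Prod>(i, j)\<in>(\<lambda>i. (i, n)) ` {..<n}. kf ((xs @ [z]) ! j) ((xs @ [z]) ! i)) = (\<Prod>x\<leftarrow>xs. kf z x)"
    by (subst prod.reindex) (auto simp: inj_on_def prod.list_conv_set_nth n_def atLeast0LessThan nth_append intro!: prod.cong)
  finally show ?case by (simp add: kprod_snoc)
qed simp


section \<open>The exchange relations of the extremal components\<close>

text \<open>The scalar equations left from the operators R and K on patterns that the generator
  cannot produce. They are written without denominators so as to hold at every nonzero
  argument.\<close>

definition exchange :: "complex \<Rightarrow> (complex list \<Rightarrow> complex) \<Rightarrow> bool" where
  "exchange \<zeta>0 F \<longleftrightarrow>
     (\<forall>a x y b. 0 \<notin> set (a @ x # y # b) \<longrightarrow>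
        br (q0 * y / x) * F (a @ x # y # b) = br (q0 * x / y) * F (a @ y # x # b)) \<and>
     (\<forall>x b. 0 \<notin> set (x # b) \<longrightarrow> kf (1 / x) \<zeta>0 * F (x # b) = kf x \<zeta>0 * F (1 / x # b))"

lemma exchange_swap:
  "exchange \<zeta>0 F \<Longrightarrow> 0 \<notin> set (a @ x # y # b) \<Longrightarrow>
     br (q0 * y / x) * F (a @ x # y # b) = br (q0 * x / y) * F (a @ y # x # b)"
  unfolding exchange_def by blast

lemma exchange_invert:
  "exchange \<zeta>0 F \<Longrightarrow> 0 \<notin> set (x # b) \<Longrightarrow> kf (1 / x) \<zeta>0 * F (x # b) = kf x \<zeta>0 * F (1 / x # b)"
  unfolding exchange_def by blast

lemma exchange_diff: "exchange \<zeta>0 F \<Longrightarrow> exchange \<zeta>0 G \<Longrightarrow> exchange \<zeta>0 (\<lambda>zs. F zs - G zs)"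
  by (auto simp: exchange_def right_diff_distrib)

lemma exchange_mult:
  assumes F: "exchange \<zeta>0 F"
    and G: "\<And>a x y b. G (a @ x # y # b) = G (a @ y # x # b)" "\<And>x b. G (1 / x # b) = G (x # b)"
  shows "exchange \<zeta>0 (\<lambda>zs. F zs * G zs)"
  unfolding exchange_def
proof (intro conjI allI impI)
  fix a b :: "complex list" and x y :: complex assume "0 \<notin> set (a @ x # y # b)"
  then show "br (q0 * y / x) * (F (a @ x # y # b) * G (a @ x # y # b)) =
       br (q0 * x / y) * (F (a @ y # x # b) * G (a @ y # x # b))"
    using exchange_swap[OF F, of a x y b] G(1)[of a x y b] by (metis mult.assoc)
next
  fix x :: complex and b :: "complex list" assume "0 \<notin> set (x # b)"
  then show "kf (1 / x) \<zeta>0 * (F (x # b) * G (x # b)) = kf x \<zeta>0 * (F (1 / x # b) * G (1 / x # b))"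
    using exchange_invert[OF F, of x b] G(2)[of x b] by (metis mult.assoc)
qed

lemma br_kf_swap: "br (q0 * y / x) * kf y x = br (q0 * x / y) * kf x y"
proof -
  have "br (y / (q0 * x)) = - br (q0 * x / y)" "br (x / (q0 * y)) = - br (q0 * y / x)"
    using br_inverse[of "q0 * x / y"] br_inverse[of "q0 * y / x"] by simp_all
  then show ?thesis by (simp add: kf_def mult.commute)
qed

text \<open>Under a swap only the factor of the swapped pair reacts, as in
  \<open>br_kf_swap\<close>. Inverting the first variable changes only k(x, zeta_0), since k is
  invariant under inversion of its second argument.\<close>

lemma exchange_kprod:
  assumes "\<zeta>0 \<noteq> 0"
  shows "exchange \<zeta>0 (\<lambda>zs. kprod (\<zeta>0 # zs))"
  unfolding exchange_def
proof (intro conjI allI impI)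
  fix a b :: "complex list" and x y :: complex
  have "br (q0 * y / x) * kprod (a @ x # y # b) = br (q0 * x / y) * kprod (a @ y # x # b)" for a
  proof (induction a)
    case Nil
    have "br (q0 * y / x) * kprod (x # y # b) = (br (q0 * y / x) * kf y x) * (\<Prod>z\<leftarrow>b. kf z x) * (\<Prod>z\<leftarrow>b. kf z y) * kprod b"
      by simp
    also have "\<dots> = br (q0 * x / y) * kprod (y # x # b)"
      unfolding br_kf_swap by simp
    finally show ?case by simp
  next
    case (Cons c a)
    then show ?case by (simp add: mult_ac)
  qed
  from this[of "\<zeta>0 # a"]
  show "br (q0 * y / x) * kprod (\<zeta>0 # a @ x # y # b) = br (q0 * x / y) * kprod (\<zeta>0 # a @ y # x # b)"
    by simp
next
  fix x :: complex and b :: "complex list" assume "0 \<notin> set (x # b)"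
  then have m: "map (\<lambda>y. kf y (1 / x)) b = map (\<lambda>y. kf y x) b" 
    by (intro map_cong refl kf_sym_args) auto
  show "kf (1 / x) \<zeta>0 * kprod (\<zeta>0 # x # b) = kf x \<zeta>0 * kprod (\<zeta>0 # (1 / x) # b)"
    unfolding kprod.simps list.map prod_list.Cons m by (simp add: mult_ac)
qed

text \<open>The condition on \<open>x ^ 12\<close> rules out x^4 = 1, where zeros attached to x
  collide, and x^4 = q^2, where k(x, x) vanishes.\<close>

definition generic :: "complex \<Rightarrow> complex \<Rightarrow> complex list \<Rightarrow> bool" where
  "generic \<zeta>0 \<zeta>L u \<longleftrightarrow> sorted_wrt generic_pair u \<and>
     (\<forall>x\<in>set u. x \<noteq> 0 \<and> x ^ 12 \<noteq> 1 \<and> generic_pair x \<zeta>0 \<and> generic_pair x \<zeta>L)"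

lemma generic_move: "generic \<zeta>0 \<zeta>L (a @ x # b) \<longleftrightarrow> generic \<zeta>0 \<zeta>L (x # a @ b)"
  unfolding generic_def using generic_pair_sym by (auto simp: sorted_wrt_append)

lemma generic_inv: 
  assumes "generic \<zeta>0 \<zeta>L (a @ x # b)"
  shows "generic \<zeta>0 \<zeta>L (a @ 1 / x # b)"
  using assms unfolding generic_def by (auto simp: sorted_wrt_append power_divide)

lemma generic_append: "generic \<zeta>0 \<zeta>L (a @ b) \<Longrightarrow> generic \<zeta>0 \<zeta>L a \<and> generic \<zeta>0 \<zeta>L b"
  unfolding generic_def by (auto simp: sorted_wrt_append)

lemma kprod_ne_0:
  assumes "generic \<zeta>0 \<zeta>L u" "\<zeta>0 \<noteq> 0"
  shows "kprod (\<zeta>0 # u) \<noteq> 0"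
proof -
  have "kprod us \<noteq> 0" if "sorted_wrt generic_pair us" "0 \<notin> set us" for us
    using that
  proof (induction us)
    case (Cons x us)
    have "kf y x \<noteq> 0" if "y \<in> set us" for y
      using Cons.prems that generic_pair_sym by (intro kf_ne_0) auto
    then show ?case using Cons by (auto simp: prod_list_zero_iff)
  qed simp
  moreover have "sorted_wrt generic_pair (\<zeta>0 # u)" "0 \<notin> set (\<zeta>0 # u)"
    using assms generic_pair_sym unfolding generic_def by auto
  ultimately show ?thesis by blast
qed

text \<open>Dividing by \<^term>\<open>kprod (\<zeta>0 # u)\<close> turns the exchange relations into invariance of the quotient
  under the hyperoctahedral group acting on the generic variables \<open>u\<close>.\<close>

context
  fixes \<zeta>0 \<zeta>L :: complex and F :: "complex list \<Rightarrow> complex" and v :: "complex list"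
  assumes nz: "\<zeta>0 \<noteq> 0" "0 \<notin> set v" and ex: "exchange \<zeta>0 F"
begin

definition quot :: "complex list \<Rightarrow> complex" where
  "quot u = F (u @ v) / kprod (\<zeta>0 # u)"

lemma quot_swap:
  assumes "generic \<zeta>0 \<zeta>L (a @ x # y # b)"
  shows "quot (a @ x # y # b) = quot (a @ y # x # b)"
proof -
  have u: "0 \<notin> set (a @ x # y # b)" and xy: "generic_pair x y" "x \<noteq> 0" "y \<noteq> 0"
    using assms by (auto simp: generic_def sorted_wrt_append)
  define r1 r2 where "r1 = br (q0 * y / x)" and "r2 = br (q0 * x / y)"
  have r: "r1 \<noteq> 0" "r2 \<noteq> 0" 
    using br_ratio_ne_0[of x y] br_ratio_ne_0[of y x] xy generic_pair_sym by (auto simp: r1_def r2_def)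
  have "r1 * F (a @ x # y # b @ v) = r2 * F (a @ y # x # b @ v)"
    using exchange_swap[OF ex, of a x y "b @ v"] u nz by (simp add: r1_def r2_def)
  moreover have "r1 * kprod (\<zeta>0 # a @ x # y # b) = r2 * kprod (\<zeta>0 # a @ y # x # b)"
    using exchange_swap[OF exchange_kprod[OF nz(1)] u] by (simp only: r1_def r2_def)
  moreover have "F (a @ x # y # b @ v) / kprod (\<zeta>0 # a @ x # y # b)
     = (r1 * F (a @ x # y # b @ v)) / (r1 * kprod (\<zeta>0 # a @ x # y # b))" using r by simp
  ultimately show ?thesis using r by (simp add: quot_def del: kprod.simps)
qed

lemma quot_move:
  "generic \<zeta>0 \<zeta>L (a @ x # b) \<Longrightarrow> quot (a @ x # b) = quot (x # a @ b)"
proof (induction a arbitrary: b rule: rev_induct)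
  case (snoc y a)
  have g: "generic \<zeta>0 \<zeta>L (a @ y # x # b)" using snoc.prems by simp
  then have "generic \<zeta>0 \<zeta>L (x # a @ y # b)" 
    using generic_move[of \<zeta>0 \<zeta>L "a @ [y]" x b] by simp
  then have "generic \<zeta>0 \<zeta>L (a @ x # y # b)" by (simp only: generic_move)
  then have "quot (a @ x # y # b) = quot (x # a @ y # b)" by (rule snoc.IH)
  then show ?case using quot_swap[OF g] by simp
qed simp

lemma quot_invert:
  assumes "generic \<zeta>0 \<zeta>L (a @ x # b)"
  shows "quot (a @ 1 / x # b) = quot (a @ x # b)"
proof -
  have g: "generic \<zeta>0 \<zeta>L (x # a @ b)" using assms by (simp only: generic_move)
  then have u: "0 \<notin> set (x # a @ b)" and x: "generic_pair x \<zeta>0" "x \<noteq> 0"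
    by (auto simp: generic_def)
  define r1 r2 where "r1 = kf (1 / x) \<zeta>0" and "r2 = kf x \<zeta>0"
  have r: "r1 \<noteq> 0" "r2 \<noteq> 0" 
    using x nz kf_ne_0[of x \<zeta>0] kf_ne_0[of "1 / x" \<zeta>0] by (auto simp: r1_def r2_def)
  have "r1 * F (x # a @ b @ v) = r2 * F (1 / x # a @ b @ v)"
    using exchange_invert[OF ex, of x "a @ b @ v"] u nz by (simp add: r1_def r2_def)
  moreover have "r1 * kprod (\<zeta>0 # x # a @ b) = r2 * kprod (\<zeta>0 # 1 / x # a @ b)"
    using exchange_invert[OF exchange_kprod[OF nz(1)] u] by (simp only: r1_def r2_def)
  moreover have "F (x # a @ b @ v) / kprod (\<zeta>0 # x # a @ b)
     = (r1 * F (x # a @ b @ v)) / (r1 * kprod (\<zeta>0 # x # a @ b))" using r by simp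
  ultimately have "quot (x # a @ b) = quot (1 / x # a @ b)" using r by (simp add: quot_def del: kprod.simps)
  then show ?thesis using quot_move[OF assms] quot_move[OF generic_inv[OF assms]] by simp
qed

lemma exchange_invert_last:
  assumes "generic \<zeta>0 \<zeta>L (u @ [x])"
  shows "F (u @ 1 / x # v) * kprod (\<zeta>0 # u @ [x]) = F (u @ x # v) * kprod (\<zeta>0 # u @ [1 / x])"
  using quot_invert[OF assms] kprod_ne_0[OF assms nz(1)] kprod_ne_0[OF generic_inv[OF assms] nz(1)]
  by (simp add: quot_def frac_eq_eq del: kprod.simps)

text \<open>The tail \<open>v\<close> need not be generic: it holds the argument at which a zero is
  known. A zero found with x or 1/x next to the tail is transported to x at any position.\<close>

lemma exchange_zero_last:
  assumes g: "generic \<zeta>0 \<zeta>L (a @ x # b)" and "F (a @ b @ y # v) = 0" "y = x \<or> y = 1 / x"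
  shows "F (a @ x # b @ v) = 0"
proof -
  have gl: "generic \<zeta>0 \<zeta>L ((a @ b) @ [x])"
    using g unfolding generic_move[of _ _ "a @ b"] generic_move[of _ _ a] by simp
  have "quot (a @ x # b) = quot ((a @ b) @ [x])"
    using quot_move[OF g] quot_move[OF gl] by simp
  also have "\<dots> = quot ((a @ b) @ [y])" using assms(3) quot_invert[OF gl] by auto
  also have "\<dots> = 0" using assms(2) by (simp add: quot_def)
  finally show ?thesis using kprod_ne_0[OF g nz(1)] by (simp add: quot_def)
qed

end

section \<open>Even Laurent polynomials in one variable\<close>

text \<open>Off z = 0 these are the Laurent polynomials in z^2 with exponents from -n to n, with the
  denominator cleared.\<close>

definition lpol :: "nat \<Rightarrow> (complex \<Rightarrow> complex) \<Rightarrow> bool" where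
  "lpol n \<phi> \<longleftrightarrow> (\<exists>p. degree p \<le> 2 * n \<and> (\<forall>z. z \<noteq> 0 \<longrightarrow> \<phi> z * z ^ (2 * n) = poly p (z\<^sup>2)))"

lemma lpolE:
  assumes "lpol n \<phi>"
  obtains p where "degree p \<le> 2 * n" "\<And>z. z \<noteq> 0 \<Longrightarrow> \<phi> z * z ^ (2 * n) = poly p (z\<^sup>2)"
  using assms unfolding lpol_def by blast

lemma lpol_cong: "lpol n \<phi> \<Longrightarrow> (\<And>z. z \<noteq> 0 \<Longrightarrow> \<phi> z = \<psi> z) \<Longrightarrow> lpol n \<psi>"
  unfolding lpol_def by auto

lemma lpol_mult:
  assumes "lpol m \<phi>" "lpol n \<psi>"
  shows "lpol (m + n) (\<lambda>z. \<phi> z * \<psi> z)"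
proof -
  obtain p where p: "degree p \<le> 2 * m" "\<And>z. z \<noteq> 0 \<Longrightarrow> \<phi> z * z ^ (2 * m) = poly p (z\<^sup>2)"
    using lpolE[OF assms(1)] by metis
  obtain r where r: "degree r \<le> 2 * n" "\<And>z. z \<noteq> 0 \<Longrightarrow> \<psi> z * z ^ (2 * n) = poly r (z\<^sup>2)"
    using lpolE[OF assms(2)] by metis
  have "degree (p * r) \<le> 2 * (m + n)" 
    by (rule order.trans[OF degree_mult_le]) (use add_mono[OF p(1) r(1)] in simp)
  moreover have "\<phi> z * \<psi> z * z ^ (2 * (m + n)) = poly (p * r) (z\<^sup>2)" if "z \<noteq> 0" for z
  proof -
    have "\<phi> z * \<psi> z * z ^ (2 * (m + n)) = (\<phi> z * z ^ (2 * m)) * (\<psi> z * z ^ (2 * n))"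
      by (simp add: power_add distrib_left mult_ac)
    then show ?thesis by (simp only: p(2)[OF that] r(2)[OF that] poly_mult)
  qed
  ultimately show ?thesis unfolding lpol_def by blast
qed

lemma lpol_const: "lpol 0 (\<lambda>_. c)"
  unfolding lpol_def by (rule exI[of _ "[:c:]"]) auto

lemma lpol_mono:
  assumes "lpol m \<phi>" "m \<le> n"
  shows "lpol n \<phi>"
proof -
  have "lpol (n - m) (\<lambda>_. 1)"
    unfolding lpol_def
    by (rule exI[of _ "monom 1 (n - m)"]) (auto simp: degree_monom_eq poly_monom power_mult)
  from lpol_mult[OF this assms(1)] show ?thesis using assms(2) by simp
qed

lemma lpol_diff:
  assumes "lpol n \<phi>" "lpol n \<psi>"
  shows "lpol n (\<lambda>z. \<phi> z - \<psi> z)"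
proof -
  obtain p where p: "degree p \<le> 2 * n" "\<And>z. z \<noteq> 0 \<Longrightarrow> \<phi> z * z ^ (2 * n) = poly p (z\<^sup>2)"
    using lpolE[OF assms(1)] by metis
  obtain r where r: "degree r \<le> 2 * n" "\<And>z. z \<noteq> 0 \<Longrightarrow> \<psi> z * z ^ (2 * n) = poly r (z\<^sup>2)"
    using lpolE[OF assms(2)] by metis
  show ?thesis unfolding lpol_def
    by (rule exI[of _ "p - r"]) (use p r in \<open>auto intro: degree_diff_le simp: left_diff_distrib\<close>)
qed

lemma lpol_sq_sum: "lpol 1 (\<lambda>z. a * sq_sum z + b)"
  unfolding lpol_def
  by (rule exI[of _ "[:a, b, a:]"]) (auto simp: sq_sum_def field_simps power2_eq_square)

lemma lpol_poly_sq_sum: "degree r \<le> n \<Longrightarrow> lpol n (\<lambda>z. poly r (sq_sum z))"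
proof (induction n arbitrary: r)
  case 0
  then obtain c where "r = [:c:]" by (auto elim: degree_eq_zeroE)
  then show ?case by (simp add: lpol_const)
next
  case (Suc n)
  obtain a r' where r: "r = pCons a r'" by (cases r)
  have "degree r' \<le> n" using Suc.prems by (simp add: r split: if_splits)
  then have "lpol n (\<lambda>z. poly r' (sq_sum z))" by (rule Suc.IH)
  from lpol_mult[OF lpol_sq_sum[of 1 0] this]
  have 1: "lpol (Suc n) (\<lambda>z. sq_sum z * poly r' (sq_sum z))" by simp
  have "lpol (Suc n) (\<lambda>_. - a)" using lpol_const by (rule lpol_mono) simp
  from lpol_diff[OF 1 this] show ?case by (simp add: r add.commute)
qed

lemma kf_explicit:
  assumes "z \<noteq> 0" "y \<noteq> 0"
  shows "kf z y * z\<^sup>2 = q0 * ((z\<^sup>2 - (q0 * y)\<^sup>2) * (z\<^sup>2 - (q0 / y)\<^sup>2))"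
proof -
  have "kf z y * z\<^sup>2 = (1 / q0\<^sup>2) * ((z\<^sup>2 - (q0 * y)\<^sup>2) * (z\<^sup>2 - (q0 / y)\<^sup>2))"
    using assms q0_neq by (simp add: kf_def br_def field_simps power2_eq_square)
  then show ?thesis by (simp only: q0_inverse)
qed

lemma lpol_kf:
  assumes "y \<noteq> 0"
  shows "lpol 1 (\<lambda>z. kf z y)"
proof -
  define p where "p = smult q0 ([:- (q0 * y)\<^sup>2, 1:] * [:- (q0 / y)\<^sup>2, 1:])"
  have "degree p \<le> 2 * 1"
    unfolding p_def by (rule order.trans[OF degree_smult_le], rule order.trans[OF degree_mult_le]) simp
  moreover have "kf z y * z ^ (2 * 1) = poly p (z\<^sup>2)" if "z \<noteq> 0" for z
    using kf_explicit[OF that assms] unfolding p_def poly_smult poly_mult by simp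
  ultimately show ?thesis unfolding lpol_def by blast
qed

lemma lpol_prod_kf: "0 \<notin> set ys \<Longrightarrow> lpol (length ys) (\<lambda>z. \<Prod>y\<leftarrow>ys. kf z y)"
proof (induction ys)
  case (Cons y ys)
  then show ?case using lpol_mult[OF lpol_kf[of y] Cons.IH] by simp
qed (simp add: lpol_const)

lemma lpol_continuous:
  assumes "lpol n \<phi>"
  shows "continuous_on (-{0}) \<phi>"
proof -
  obtain p where p: "degree p \<le> 2 * n" "\<And>z. z \<noteq> 0 \<Longrightarrow> \<phi> z * z ^ (2 * n) = poly p (z\<^sup>2)"
    using lpolE[OF assms(1)] by metis
  have "continuous_on (-{0}) (\<lambda>z. poly p (z\<^sup>2) / z ^ (2 * n))"
    by (intro continuous_intros) auto
  then show ?thesis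
  proof (rule continuous_on_cong[THEN iffD1, OF refl, rotated])
    fix z :: complex assume "z \<in> -{0}"
    then show "poly p (z\<^sup>2) / z ^ (2 * n) = \<phi> z" using p(2)[of z] by (simp add: field_simps)
  qed
qed

text \<open>In the variable z^2 the weight k(z, y) has the zeros (q y)^2 and (q / y)^2. The
  condition on \<open>y ^ 12\<close> keeps them apart, so a quadratic factor splits off and the
  bound drops by one.\<close>

lemma lpol_factor_kf:
  assumes \<phi>: "lpol (Suc n) \<phi>" and y: "y \<noteq> 0" "y ^ 12 \<noteq> 1"
    and zero: "\<phi> (q0 * y) = 0" "\<phi> (q0 / y) = 0"
  shows "\<exists>\<psi>. lpol n \<psi> \<and> (\<forall>z. z \<noteq> 0 \<longrightarrow> \<phi> z = kf z y * \<psi> z)"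
proof -
  obtain p where p: "degree p \<le> 2 * Suc n" "\<And>z. z \<noteq> 0 \<Longrightarrow> \<phi> z * z ^ (2 * Suc n) = poly p (z\<^sup>2)"
    using lpolE[OF assms(1)] by metis
  define a b where "a = (q0 * y)\<^sup>2" and "b = (q0 / y)\<^sup>2"
  have "a \<noteq> b"
  proof
    assume "a = b"
    then have "q0\<^sup>2 * y\<^sup>2 = q0\<^sup>2 * (1 / y\<^sup>2)" by (simp add: a_def b_def power_mult_distrib power_divide)
    then have "y\<^sup>2 = 1 / y\<^sup>2" unfolding mult_cancel_left using q0_neq by simp
    then have "y ^ 4 = 1" using y by (simp add: field_simps flip: power_add)
    then have "(y ^ 4) ^ 3 = 1" by simp
    then show False using y by (simp flip: power_mult)
  qed
  have pa: "poly p a = 0" using p(2)[of "q0 * y"] zero y q0_neq by (simp add: a_def)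
  have pb: "poly p b = 0" using p(2)[of "q0 / y"] zero y q0_neq by (simp add: b_def)
  obtain h where h: "p = [:-a, 1:] * h" using pa by (auto simp: poly_eq_0_iff_dvd elim: dvdE)
  have "poly h b = 0" using pb \<open>a \<noteq> b\<close> by (simp add: h)
  then obtain g where g: "h = [:-b, 1:] * g" by (auto simp: poly_eq_0_iff_dvd elim: dvdE)
  have pg: "p = [:-a, 1:] * ([:-b, 1:] * g)" by (simp only: h g)
  have "degree g \<le> 2 * n"
  proof (cases "g = 0")
    case False
    have "degree ([:-c, 1:] * r) = Suc (degree r)" if "r \<noteq> 0" for c and r :: "complex poly"
      using that by (subst degree_mult_eq) auto
    then have "degree p = degree g + 2" unfolding pg using False by (simp del: mult_pCons_left)
    then show ?thesis using p(1) by simp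
  qed simp
  define \<psi> where "\<psi> z = poly (smult (1 / q0) g) (z\<^sup>2) / z ^ (2 * n)" for z
  have "lpol n \<psi>" unfolding lpol_def
    by (rule exI[of _ "smult (1 / q0) g"])
       (use \<open>degree g \<le> 2 * n\<close> degree_smult_le[of "1 / q0" g] in \<open>auto simp: \<psi>_def\<close>)
  moreover have "\<phi> z = kf z y * \<psi> z" if "z \<noteq> 0" for z
  proof -
    have "\<phi> z * z ^ (2 * Suc n) = (z\<^sup>2 - a) * ((z\<^sup>2 - b) * poly g (z\<^sup>2))"
      unfolding p(2)[OF that] pg poly_mult by simp
    also have "\<dots> = (kf z y * z\<^sup>2) * (poly g (z\<^sup>2) / q0)"
      unfolding kf_explicit[OF that y(1)] using q0_neq by (simp add: a_def b_def)
    also have "\<dots> = kf z y * \<psi> z * z ^ (2 * Suc n)"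
      using that by (simp add: \<psi>_def power2_eq_square)
    finally show ?thesis using that by simp
  qed
  ultimately show ?thesis by blast
qed

text \<open>Removing one factor leaves the zeros attached to the other entries intact, because
  pairwise genericity keeps k(q x, y) and k(q / x, y) away from 0.\<close>

lemma lpol_factor_prod_kf:
  assumes "lpol (length w + n) \<phi>" "sorted_wrt generic_pair w"
    and "\<And>x. x \<in> set w \<Longrightarrow> x \<noteq> 0 \<and> x ^ 12 \<noteq> 1 \<and> \<phi> (q0 * x) = 0 \<and> \<phi> (q0 / x) = 0"
  shows "\<exists>\<psi>. lpol n \<psi> \<and> (\<forall>z. z \<noteq> 0 \<longrightarrow> \<phi> z = (\<Prod>x\<leftarrow>w. kf z x) * \<psi> z)"
  using assms
proof (induction w arbitrary: \<phi>)
  case (Cons y w)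
  have y: "y \<noteq> 0" "y ^ 12 \<noteq> 1" "\<phi> (q0 * y) = 0" "\<phi> (q0 / y) = 0" using Cons.prems(3)[of y] by auto
  obtain \<phi>' where \<phi>': "lpol (length w + n) \<phi>'" "\<And>z. z \<noteq> 0 \<Longrightarrow> \<phi> z = kf z y * \<phi>' z"
    using lpol_factor_kf[OF _ y] Cons.prems(1) by auto
  have "\<exists>\<psi>. lpol n \<psi> \<and> (\<forall>z. z \<noteq> 0 \<longrightarrow> \<phi>' z = (\<Prod>x\<leftarrow>w. kf z x) * \<psi> z)"
  proof (rule Cons.IH[OF \<phi>'(1)])
    fix x assume x: "x \<in> set w"
    then have xy: "generic_pair x y" "x \<noteq> 0" "\<phi> (q0 * x) = 0" "\<phi> (q0 / x) = 0" "x ^ 12 \<noteq> 1"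
      using Cons.prems generic_pair_sym by auto
    have "kf (q0 * x) y \<noteq> 0" using xy y q0_neq by (intro kf_ne_0) auto
    moreover have "kf (q0 / x) y \<noteq> 0"
      using xy y q0_neq generic_pair_trans(1)[of "1 / x" y] by (intro kf_ne_0) auto
    ultimately show "x \<noteq> 0 \<and> x ^ 12 \<noteq> 1 \<and> \<phi>' (q0 * x) = 0 \<and> \<phi>' (q0 / x) = 0"
      using xy \<phi>'(2)[of "q0 * x"] \<phi>'(2)[of "q0 / x"] q0_neq by auto
  qed (use Cons.prems in auto)
  then show ?case using \<phi>'(2) by (auto simp: mult_ac)
qed auto

lemma lpol_1_three_zeros:
  assumes "lpol 1 \<phi>" "\<phi> a = 0" "\<phi> b = 0" "\<phi> c = 0" "a \<noteq> 0" "b \<noteq> 0" "c \<noteq> 0"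
    and dist: "a\<^sup>2 \<noteq> b\<^sup>2" "a\<^sup>2 \<noteq> c\<^sup>2" "b\<^sup>2 \<noteq> c\<^sup>2" and "z \<noteq> 0"
  shows "\<phi> z = 0"
proof -
  obtain p where p: "degree p \<le> 2 * 1" "\<And>z. z \<noteq> 0 \<Longrightarrow> \<phi> z * z ^ (2 * 1) = poly p (z\<^sup>2)"
    using lpolE[OF assms(1)] by metis
  have "p = 0"
  proof (rule ccontr)
    assume "p \<noteq> 0"
    have "{a\<^sup>2, b\<^sup>2, c\<^sup>2} \<subseteq> {x. poly p x = 0}"
      using p(2)[of a] p(2)[of b] p(2)[of c] assms by auto
    then have "card {a\<^sup>2, b\<^sup>2, c\<^sup>2} \<le> card {x. poly p x = 0}"
      by (intro card_mono poly_roots_finite \<open>p \<noteq> 0\<close>)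
    also have "\<dots> \<le> degree p" by (rule card_poly_roots_bound) fact
    finally show False using p(1) dist by simp
  qed
  then show ?thesis using p(2)[OF \<open>z \<noteq> 0\<close>] \<open>z \<noteq> 0\<close> by simp
qed

lemma laurent_poly_last:
  assumes F: "laurent_poly (Suc (length w)) (int n) F" and w: "0 \<notin> set w"
  shows "lpol n (\<lambda>z. F (w @ [z\<^sup>2]))"
proof -
  define k where "k = length w"
  obtain c where c: "\<And>xs. length xs = Suc k \<Longrightarrow> 0 \<notin> set xs \<Longrightarrow>
    F xs = (\<Sum>m | length m = Suc k \<and> set m \<subseteq> {-int n..int n}. c m * laurent_monom m xs)"
    by (rule laurent_polyE[OF F, folded k_def]) blast
  define M where "M = {m. length m = Suc k \<and> set m \<subseteq> {-int n..int n}}"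
  define p where "p = (\<Sum>m\<in>M. monom (c m * (\<Prod>i<k. (w ! i) powi (m ! i))) (nat (m ! k + int n)))"
  have mk: "m ! k \<in> {-int n..int n}" if "m \<in> M" for m
    using that by (auto simp: M_def dest!: nth_mem[of k m] subsetD)
  have "degree p \<le> 2 * n"
    unfolding p_def
  proof (rule degree_sum_le)
    show "finite M" unfolding M_def by (rule finite_exponents)
    fix m assume "m \<in> M"
    then have "nat (m ! k + int n) \<le> 2 * n" using mk[of m] by auto
    then show "degree (monom (c m * (\<Prod>i<k. (w ! i) powi (m ! i))) (nat (m ! k + int n))) \<le> 2 * n"
      by (rule order.trans[OF degree_monom_le])
  qed
  moreover have "F (w @ [z\<^sup>2]) * z ^ (2 * n) = poly p (z\<^sup>2)" if z: "z \<noteq> 0" for z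
  proof -
    have "F (w @ [z\<^sup>2]) = (\<Sum>m\<in>M. c m * laurent_monom m (w @ [z\<^sup>2]))"
      unfolding M_def by (rule c) (use z w in \<open>auto simp: k_def\<close>)
    then have "F (w @ [z\<^sup>2]) * z ^ (2 * n) = (\<Sum>m\<in>M. c m * laurent_monom m (w @ [z\<^sup>2]) * (z\<^sup>2) ^ n)"
      by (simp add: sum_distrib_right power_mult)
    also have "\<dots> = poly p (z\<^sup>2)"
      unfolding p_def poly_sum
    proof (rule sum.cong)
      fix m assume m: "m \<in> M"
      then have "length m = Suc k" by (simp add: M_def)
      then have "laurent_monom m (w @ [z\<^sup>2]) = (\<Prod>i<k. (w ! i) powi (m ! i)) * (z\<^sup>2) powi (m ! k)"
        by (simp add: laurent_monom_def nth_append k_def)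
      moreover have "(z\<^sup>2) powi (m ! k) * (z\<^sup>2) ^ n = (z\<^sup>2) powi (m ! k + int n)"
        using z by (simp add: power_int_add)
      moreover have "(z\<^sup>2) powi (m ! k + int n) = (z\<^sup>2) ^ nat (m ! k + int n)"
        using mk[OF m] by (simp add: power_int_def)
      ultimately show "c m * laurent_monom m (w @ [z\<^sup>2]) * (z\<^sup>2) ^ n =
         poly (monom (c m * (\<Prod>i<k. (w ! i) powi (m ! i))) (nat (m ! k + int n))) (z\<^sup>2)"
        by (simp add: poly_monom mult.assoc)
    qed simp
    finally show ?thesis .
  qed
  ultimately show ?thesis unfolding lpol_def by blast
qed

section \<open>Determination of the extremal component by its values\<close>

definition ext_sym :: "complex \<Rightarrow> complex list \<Rightarrow> complex" where
  "ext_sym \<zeta>L zs = (-1) ^ (length zs * (length zs + 1) div 2)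
     * (tau_sum (map sq_sum (zs @ [\<zeta>L])) * tau_sum (map sq_sum zs))"

definition ext_comp :: "complex \<Rightarrow> complex \<Rightarrow> complex list \<Rightarrow> complex" where
  "ext_comp \<zeta>0 \<zeta>L zs = kprod (\<zeta>0 # zs) * ext_sym \<zeta>L zs"

lemma tau_sum_swap: "tau_sum (a @ x # y # b) = tau_sum (a @ y # x # b)"
  by (simp add: tau_sum_def bialt_swap)

lemma exchange_ext_comp: "\<zeta>0 \<noteq> 0 \<Longrightarrow> exchange \<zeta>0 (ext_comp \<zeta>0 \<zeta>L)"
  unfolding ext_comp_def[abs_def]
  by (intro exchange_mult exchange_kprod)
     (simp_all add: ext_sym_def sq_sum_1_div tau_sum_swap)

lemma ext_comp_short: "ext_comp \<zeta>0 \<zeta>L [] = 1" "ext_comp \<zeta>0 \<zeta>L [z] = - kf z \<zeta>0"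
  by (simp_all add: ext_comp_def ext_sym_def tau_sum_short)

text \<open>With X = x^2 and y = X + 1/X, the value y^3 - 3y = X^3 + X^(-3) does not change when X
  is multiplied by q^2. So both sums are roots of one cubic with linear coefficient -3 and no
  quadratic term.\<close>

lemma sq_sum_triple:
  assumes "x \<noteq> 0"
  shows "(sq_sum x)\<^sup>2 + sq_sum x * sq_sum (q0 * x) + (sq_sum (q0 * x))\<^sup>2 = 3"
proof -
  have "sq_sum (q0 * x) = x\<^sup>2 * q0\<^sup>2 + (1 / q0\<^sup>2) / x\<^sup>2"
    by (simp add: sq_sum_def power_mult_distrib)
  then have "sq_sum (q0 * x) = x\<^sup>2 * q0\<^sup>2 + q0 * (1 / x\<^sup>2)" by (simp add: q0_inverse)
  moreover define t u where "t = x\<^sup>2" and "u = 1 / x\<^sup>2"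
  moreover have "t * u = 1" using assms by (simp add: t_def u_def)
  ultimately have "(sq_sum x)\<^sup>2 + sq_sum x * sq_sum (q0 * x) + (sq_sum (q0 * x))\<^sup>2
     = (t + u)\<^sup>2 + (t + u) * (t * q0\<^sup>2 + q0 * u) + (t * q0\<^sup>2 + q0 * u)\<^sup>2"
    by (simp add: sq_sum_def)
  also have "\<dots> = t\<^sup>2 * (1 + q0\<^sup>2 + q0 * q0 ^ 3) + u\<^sup>2 * (1 + q0 + q0\<^sup>2) + (t * u) * (2 + q0 + q0\<^sup>2 + 2 * q0 ^ 3)"
    by (simp add: algebra_simps power2_eq_square power3_eq_cube)
  also have "\<dots> = 3" unfolding \<open>t * u = 1\<close> q0_cube q0_sq by simp
  finally show ?thesis .
qed

text \<open>Inversion does not change \<open>sq_sum\<close>, so 1/(q x) can stand for q x, and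
  \<open>kf_eq\<close> turns the factors of \<open>tau_sum_rec\<close> into -k(x, y). The condition
  on \<open>x ^ 12\<close> separates the two new nodes.\<close>

lemma tau_sum_pair:
  assumes x: "x \<noteq> 0" "x ^ 12 \<noteq> 1" and gen: "\<And>y. y \<in> set ys \<Longrightarrow> y \<noteq> 0 \<and> generic_pair x y"
    and dist: "distinct (map sq_sum ys)"
  shows "tau_sum (sq_sum x # sq_sum (1 / (q0 * x)) # map sq_sum ys)
       = (\<Prod>y\<leftarrow>ys. - kf x y) * tau_sum (map sq_sum ys)"
proof -
  have "sq_sum x \<noteq> sq_sum y" "sq_sum (q0 * x) \<noteq> sq_sum y" if "y \<in> set ys" for y
    using sq_sum_inj[of x y] sq_sum_inj[of "q0 * x" y] gen[OF that] x q0_neq by auto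
  moreover have "sq_sum x \<noteq> sq_sum (q0 * x)"
  proof
    assume eq: "sq_sum x = sq_sum (q0 * x)"
    have "(1 - q0\<^sup>2) * (q0\<^sup>2 * x ^ 4 - 1) = q0\<^sup>2 * x\<^sup>2 * (sq_sum x - sq_sum (q0 * x))"
      using x q0_neq by (simp add: sq_sum_def power_mult_distrib field_simps)
    then have "(1 - q0\<^sup>2) * (q0\<^sup>2 * x ^ 4 - 1) = 0" by (simp add: eq)
    then have "q0\<^sup>2 * x ^ 4 = 1" using q0_sq_neq_1 by simp
    then have "(q0\<^sup>2 * x ^ 4) ^ 3 = 1" by simp
    then show False using x by (simp add: power_mult_distrib q0_pow6 flip: power_mult)
  qed
  ultimately have "distinct (sq_sum x # sq_sum (q0 * x) # map sq_sum ys)"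
    using dist by auto
  from tau_sum_rec[OF sq_sum_triple[OF x(1)] this]
  have "tau_sum (sq_sum x # sq_sum (q0 * x) # map sq_sum ys)
     = (\<Prod>y\<leftarrow>ys. sq_sum y + sq_sum x + sq_sum (q0 * x)) * tau_sum (map sq_sum ys)"
    by (simp add: comp_def)
  also have "map (\<lambda>y. sq_sum y + sq_sum x + sq_sum (q0 * x)) ys = map (\<lambda>y. - kf x y) ys"
    using x gen by (intro map_cong refl) (simp add: kf_eq)
  finally show ?thesis by (simp add: sq_sum_1_div)
qed

lemma generic_distinct:
  assumes "generic \<zeta>0 \<zeta>L w" "\<zeta>L \<noteq> 0"
  shows "distinct (map sq_sum (w @ [\<zeta>L]))"
proof -
  have "distinct (map sq_sum u)" if "sorted_wrt generic_pair u" "0 \<notin> set u" for u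
    using that
  proof (induction u)
    case (Cons x u)
    then show ?case using sq_sum_inj[of x] by fastforce
  qed simp
  moreover have "sorted_wrt generic_pair (w @ [\<zeta>L])" "0 \<notin> set (w @ [\<zeta>L])"
    using assms by (auto simp: generic_def sorted_wrt_append)
  ultimately show ?thesis by blast
qed

text \<open>The factors are those that \<open>f_pair\<close> obtains from the right boundary
  equation at z = q x and fusion, once k(x, zeta_L) has been cancelled.\<close>

lemma ext_comp_pair:
  assumes g: "generic \<zeta>0 \<zeta>L (a @ [x])" and nz: "\<zeta>0 \<noteq> 0" "\<zeta>L \<noteq> 0"
  shows "ext_comp \<zeta>0 \<zeta>L (a @ [x, 1 / (q0 * x)])
    = br (1 / q0) * br ((q0 * x)\<^sup>2) * kf x \<zeta>L * (kf x \<zeta>0)\<^sup>2 * (\<Prod>y\<leftarrow>a. kf x y ^ 4) * ext_comp \<zeta>0 \<zeta>L a"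
proof -
  define x' where "x' = 1 / (q0 * x)"
  have x: "x \<noteq> 0" "x ^ 12 \<noteq> 1" "generic_pair x \<zeta>L" and a: "\<And>y. y \<in> set a \<Longrightarrow> y \<noteq> 0 \<and> generic_pair x y"
    using g generic_pair_sym by (auto simp: generic_def sorted_wrt_append)
  define A where "A = (\<Prod>y\<leftarrow>a. kf x y)"
  define T1 T2 where "T1 = tau_sum (map sq_sum (a @ [\<zeta>L]))" and "T2 = tau_sum (map sq_sum a)"
  define L where "L = length a"
  have "distinct (map sq_sum (a @ [\<zeta>L]))" using generic_distinct[of \<zeta>0 \<zeta>L a] generic_append[OF g] nz by blast
  then have d: "distinct (map sq_sum (a @ [\<zeta>L]))" "distinct (map sq_sum a)" by auto
  have move: "tau_sum (map sq_sum (b @ x # x' # c)) = tau_sum (sq_sum x # sq_sum x' # map sq_sum (b @ c))" for b c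
    using tau_sum_move[of "map sq_sum b" "sq_sum x" "sq_sum x' # map sq_sum c"]
      tau_sum_move[of "sq_sum x # map sq_sum b" "sq_sum x'" "map sq_sum c"]
      tau_sum_move[of "[sq_sum x']" "sq_sum x" "map sq_sum (b @ c)"] by simp
  have neg: "(\<Prod>y\<leftarrow>ys. - kf x y) = (-1) ^ length ys * (\<Prod>y\<leftarrow>ys. kf x y)" for ys
    by (induction ys) auto
  have t1: "tau_sum (map sq_sum (a @ [x, x', \<zeta>L])) = (-1) ^ Suc L * A * kf x \<zeta>L * T1"
    using move[of a "[\<zeta>L]"] tau_sum_pair[of x "a @ [\<zeta>L]"] x a nz d
    by (auto simp: neg A_def T1_def L_def x'_def)
  have t2: "tau_sum (map sq_sum (a @ [x, x'])) = (-1) ^ L * A * T2"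
    using move[of a "[]"] tau_sum_pair[of x a] x a d
    by (auto simp: neg A_def T2_def L_def x'_def)
  have kx: "kf x' y = kf x y" if "y \<noteq> 0" for y unfolding x'_def by (rule kf_sym_args) (use x that in auto)
  \<comment> \<open>Since q^2 = 1/q, the weight k(x', x) = k(x, x) of the new pair is the
    coefficient of the boundary generator at q x.\<close>
  have "(q0 * x)\<^sup>2 = x\<^sup>2 / q0"
    using q0_inverse(1) by (simp add: power_mult_distrib divide_inverse mult.commute)
  then have kx'x: "kf x' x = br (1 / q0) * br ((q0 * x)\<^sup>2)"
    unfolding kx[OF x(1)] using x by (simp add: kf_def power2_eq_square)
  have m: "map (kf x') a = map (kf x) a" using a kx by auto
  have "kprod (\<zeta>0 # a @ [x, x']) = kprod (\<zeta>0 # a) * (kf x \<zeta>0 * prod_list (map (kf x) a))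
      * (kf x' \<zeta>0 * prod_list (map (kf x') a) * kf x' x)"
    using kprod_snoc[of "\<zeta>0 # a" x] kprod_snoc[of "(\<zeta>0 # a) @ [x]" x'] by (simp del: kprod.simps)
  then have kp: "kprod (\<zeta>0 # a @ [x, x']) = kprod (\<zeta>0 # a) * (kf x \<zeta>0 * A)
      * (kf x \<zeta>0 * A * (br (1 / q0) * br ((q0 * x)\<^sup>2)))"
    unfolding m kx[OF nz(1)] kx'x by (simp only: A_def)
  \<comment> \<open>The sign flips from L to L + 2; the two characters supply one more minus sign,
    since together they bring 2L + 1 factors -1.\<close>
  have sgn: "(-1 :: complex) ^ ((L + 2) * (L + 2 + 1) div 2) = - ((-1) ^ (L * (L + 1) div 2))"
  proof -
    have "(L + 2) * (L + 2 + 1) = L * (L + 1) + (2 * L + 3) * 2" by (simp add: algebra_simps)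
    then have "(L + 2) * (L + 2 + 1) div 2 = L * (L + 1) div 2 + (2 * L + 3)" by (simp only: div_mult_self1)
    then show ?thesis by (simp add: power_add)
  qed
  have A4: "(\<Prod>y\<leftarrow>a. kf x y ^ 4) = A ^ 4" unfolding A_def
    by (induction a) (simp_all add: power_mult_distrib)
  have len: "length (a @ [x, x']) = L + 2" by (simp add: L_def)
  have "ext_comp \<zeta>0 \<zeta>L (a @ [x, x']) = kprod (\<zeta>0 # a) * (kf x \<zeta>0 * A)
      * (kf x \<zeta>0 * A * (br (1 / q0) * br ((q0 * x)\<^sup>2))) * (- ((-1) ^ (L * (L + 1) div 2))
      * (((-1) ^ Suc L * A * kf x \<zeta>L * T1) * ((-1) ^ L * A * T2)))"
    unfolding ext_comp_def ext_sym_def len kp sgn t2 using t1 by simp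
  also have "\<dots> = ((-1) ^ L * (-1) ^ L) * (br (1 / q0) * br ((q0 * x)\<^sup>2) * kf x \<zeta>L * (kf x \<zeta>0)\<^sup>2 * A ^ 4
      * (kprod (\<zeta>0 # a) * ((-1) ^ (L * (L + 1) div 2) * (T1 * T2))))"
    by (simp add: power2_eq_square power4_eq_xxxx mult_ac del: kprod.simps)
  also have "(-1) ^ L * (-1) ^ L = (1 :: complex)" by (simp flip: power_add mult_2)
  also have "kprod (\<zeta>0 # a) * ((-1) ^ (L * (L + 1) div 2) * (T1 * T2)) = ext_comp \<zeta>0 \<zeta>L a"
    by (simp only: ext_comp_def ext_sym_def L_def T1_def T2_def)
  finally show ?thesis by (simp only: x'_def A4 mult_1)
qed

lemma sep_cont_ext_comp:
  assumes "\<zeta>0 \<noteq> 0" "\<zeta>L \<noteq> 0"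
  shows "sep_cont N (ext_comp \<zeta>0 \<zeta>L)"
proof -
  have tau: "sep_cont n (\<lambda>zs. tau_sum (map sq_sum zs))" for n
    unfolding tau_sum_def
  proof (intro sep_cont_laurent laurent_bialt)
    fix k assume "k < n"
    then have "laurent n (\<lambda>xs. (xs ! k) powi 2 + (xs ! k) powi (-2))"
      by (intro laurent_add laurent_powi)
    then show "laurent n (\<lambda>xs. sq_sum (xs ! k))" by (simp add: sq_sum_def power_int_minus divide_inverse)
  qed
  have tau': "sep_cont N (\<lambda>zs. tau_sum (map sq_sum (zs @ [\<zeta>L])))"
    unfolding sep_cont_def
  proof safe
    fix xs :: "complex list" and i assume xs: "0 \<notin> set xs" "i < length xs" "N = length xs"
    have "continuous_on (-{0}) (\<lambda>t. tau_sum (map sq_sum ((xs @ [\<zeta>L])[i := t])))"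
      by (rule sep_contD[OF tau[of "Suc N"]]) (use xs assms in auto)
    then show "continuous_on (-{0}) (\<lambda>t. tau_sum (map sq_sum (xs[i := t] @ [\<zeta>L])))"
      using xs by (simp add: list_update_append)
  qed
  have k1: "continuous_on (-{0}) (\<lambda>t. kf t x)" "continuous_on (-{0}) (\<lambda>t. kf x t)" if "x \<noteq> 0" for x
    unfolding kf_def br_def using that q0_neq by (auto intro!: continuous_intros)
  have kprod_x: "continuous_on (-{0}) (\<lambda>t. \<Prod>y\<leftarrow>xs[i := t]. kf y x)" if "0 \<notin> set xs" "x \<noteq> 0" for xs x i
    using that
  proof (induction xs arbitrary: i)
    case (Cons y xs)
    then show ?case by (cases i) (auto intro!: continuous_intros k1)
  qed simp
  have kprod_t: "continuous_on (-{0}) (\<lambda>t. \<Prod>y\<leftarrow>xs. kf y t)" if "0 \<notin> set xs" for xs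
    using that by (induction xs) (auto intro!: continuous_intros k1)
  have kprod: "continuous_on (-{0}) (\<lambda>t. kprod (xs[i := t]))" if "0 \<notin> set xs" for xs i
    using that
  proof (induction xs arbitrary: i)
    case (Cons y xs)
    then show ?case by (cases i) (auto intro!: continuous_intros kprod_x kprod_t)
  qed simp
  have "sep_cont N (\<lambda>zs. kprod (\<zeta>0 # zs))"
    unfolding sep_cont_def
  proof safe
    fix xs :: "complex list" and i assume "0 \<notin> set xs"
    then show "continuous_on (-{0}) (\<lambda>t. kprod (\<zeta>0 # xs[i := t]))"
      using kprod[of "\<zeta>0 # xs" "Suc i"] assms by simp
  qed
  then have 1: "sep_cont N (\<lambda>zs. kprod (\<zeta>0 # zs) * ((-1) ^ (N * (N + 1) div 2)
     * (tau_sum (map sq_sum (zs @ [\<zeta>L])) * tau_sum (map sq_sum zs))))"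
    by (rule sep_cont_arith(2)[OF _ sep_cont_arith(2)[OF sep_cont_const sep_cont_arith(2)[OF tau' tau]]])
  show ?thesis unfolding sep_cont_def
  proof (intro allI impI, elim conjE)
    fix xs :: "complex list" and i assume xs: "length xs = N" "0 \<notin> set xs" "i < N"
    show "continuous_on (-{0}) (\<lambda>t. ext_comp \<zeta>0 \<zeta>L (xs[i := t]))"
      using sep_contD[OF 1, of xs i] xs by (simp add: ext_comp_def ext_sym_def)
  qed
qed

text \<open>With m = \<open>length w\<close> the weights contribute m + 1 and the two characters
  contribute (m + 1) div 2 and m div 2, together m. The total 2m + 1 is the assumed bound 2L - 1 for
  L = m + 1.\<close>

lemma lpol_ext_comp:
  assumes "\<zeta>0 \<noteq> 0" "0 \<notin> set w"
  shows "lpol (2 * length w + 1) (\<lambda>z. ext_comp \<zeta>0 \<zeta>L (w @ [z]))"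
proof -
  define m where "m = length w"
  from tau_sum_last[of "map sq_sum (w @ [\<zeta>L])"] obtain r1
    where "degree r1 \<le> length (map sq_sum (w @ [\<zeta>L])) div 2"
      and r1: "\<And>y. tau_sum (map sq_sum (w @ [\<zeta>L]) @ [y]) = poly r1 y" by blast
  then have d1: "degree r1 \<le> Suc m div 2" by (simp add: m_def)
  from tau_sum_last[of "map sq_sum w"] obtain r2
    where "degree r2 \<le> length (map sq_sum w) div 2"
      and r2: "\<And>y. tau_sum (map sq_sum w @ [y]) = poly r2 y" by blast
  then have d2: "degree r2 \<le> m div 2" by (simp add: m_def)
  have t1: "tau_sum (map sq_sum (w @ [z, \<zeta>L])) = poly r1 (sq_sum z)" for z
    using r1[of "sq_sum z"] tau_sum_swap[of "map sq_sum w" "sq_sum z" "sq_sum \<zeta>L" "[]"] by simp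
  have "lpol (Suc m + (0 + (Suc m div 2 + m div 2))) (\<lambda>z. (\<Prod>y\<leftarrow>\<zeta>0 # w. kf z y) * 
      ((kprod (\<zeta>0 # w) * (-1) ^ (Suc m * (Suc m + 1) div 2)) * (poly r1 (sq_sum z) * poly r2 (sq_sum z))))"
    using lpol_prod_kf[of "\<zeta>0 # w"] assms
    by (intro lpol_mult lpol_const lpol_poly_sq_sum d1 d2) (simp add: m_def)
  moreover have "Suc m + (0 + (Suc m div 2 + m div 2)) = 2 * m + 1" by presburger
  ultimately have "lpol (2 * m + 1) (\<lambda>z. (\<Prod>y\<leftarrow>\<zeta>0 # w. kf z y) * 
      ((kprod (\<zeta>0 # w) * (-1) ^ (Suc m * (Suc m + 1) div 2)) * (poly r1 (sq_sum z) * poly r2 (sq_sum z))))"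
    by (simp only:)
  then show ?thesis unfolding m_def[symmetric]
  proof (rule lpol_cong)
    fix z
    show "(\<Prod>y\<leftarrow>\<zeta>0 # w. kf z y) * ((kprod (\<zeta>0 # w) * (-1) ^ (Suc m * (Suc m + 1) div 2)) 
       * (poly r1 (sq_sum z) * poly r2 (sq_sum z))) = ext_comp \<zeta>0 \<zeta>L (w @ [z])"
      using kprod_snoc[of "\<zeta>0 # w" z] t1[of z] r2[of "sq_sum z"]
      by (simp add: ext_comp_def ext_sym_def m_def del: kprod.simps)
  qed
qed

section \<open>Generic points and zeros of the weight\<close>

definition excluded :: "complex \<Rightarrow> complex \<Rightarrow> complex list \<Rightarrow> complex set" where
  "excluded \<zeta>0 \<zeta>L u = {x. x ^ 12 = 1}
     \<union> (\<Union>y\<in>insert \<zeta>0 (insert \<zeta>L (set u)). {x. x ^ 6 = y ^ 6} \<union> {x. x ^ 6 * y ^ 6 = 1})"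

lemma finite_excluded: "finite (excluded \<zeta>0 \<zeta>L u)"
proof -
  have "finite {x :: complex. x ^ 6 * c = 1}" for c
    by (rule finite_subset[OF _ finite_nth_roots[of 6 "1 / c"]]) (auto simp: eq_divide_eq)
  then show ?thesis unfolding excluded_def by (auto intro!: finite_nth_roots)
qed

lemma generic_snoc:
  "generic \<zeta>0 \<zeta>L u \<Longrightarrow> x \<noteq> 0 \<Longrightarrow> x \<notin> excluded \<zeta>0 \<zeta>L u \<Longrightarrow> generic \<zeta>0 \<zeta>L (u @ [x])"
  unfolding generic_def excluded_def generic_pair_def
  by (auto simp: sorted_wrt_append mult.commute)

lemma generic_not_excluded:
  "0 \<notin> set xs \<Longrightarrow> (\<And>i. i < length xs \<Longrightarrow> xs ! i \<notin> excluded \<zeta>0 \<zeta>L (take i xs)) \<Longrightarrow> generic \<zeta>0 \<zeta>L xs"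
proof (induction xs rule: rev_induct)
  case (snoc x xs)
  have "generic \<zeta>0 \<zeta>L xs"
  proof (rule snoc.IH)
    fix i assume "i < length xs"
    then show "xs ! i \<notin> excluded \<zeta>0 \<zeta>L (take i xs)" using snoc.prems(2)[of i] by (simp add: nth_append)
  qed (use snoc.prems in auto)
  moreover have "x \<notin> excluded \<zeta>0 \<zeta>L xs" using snoc.prems(2)[of "length xs"] by simp
  ultimately show ?case using snoc.prems(1) by (intro generic_snoc) auto
qed (simp add: generic_def)

lemma generic_pair_sq: "generic_pair x y \<Longrightarrow> x\<^sup>2 \<noteq> y\<^sup>2"
proof
  assume "generic_pair x y" "x\<^sup>2 = y\<^sup>2"
  then have "(x\<^sup>2) ^ 3 = (y\<^sup>2) ^ 3" by (simp only:)
  then show False using \<open>generic_pair x y\<close> by (simp add: generic_pair_def flip: power_mult)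
qed

lemma br_q0_ne_0: "br (1 / q0) \<noteq> 0" "br (q0\<^sup>2) \<noteq> 0"
proof -
  show "br (1 / q0) \<noteq> 0" using q0_neq q0_sq_neq_1 br_eq_0_iff[of "1 / q0"] by (simp add: power_divide)
  have "(q0\<^sup>2)\<^sup>2 = q0 ^ 3 * q0" by (simp add: power2_eq_square power3_eq_cube)
  then show "br (q0\<^sup>2) \<noteq> 0" using q0_neq br_eq_0_iff[of "q0\<^sup>2"] by (simp add: q0_cube)
qed

lemma kf_self:
  assumes "x \<noteq> 0" "x ^ 4 \<noteq> q0\<^sup>2"
  shows "kf x x \<noteq> 0"
proof -
  have "kf x x = br (1 / q0) * br (x\<^sup>2 / q0)" using assms by (simp add: kf_def power2_eq_square)
  moreover have "br (x\<^sup>2 / q0) \<noteq> 0"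
    using assms q0_neq br_eq_0_iff[of "x\<^sup>2 / q0"] by (simp add: power_divide flip: power_mult)
  ultimately show ?thesis using br_q0_ne_0 by simp
qed

text \<open>Supplies the last zero in the uniqueness argument. The inverse of the zero q zeta is
  again a zero only if zeta^4 = q^2; in that case q / zeta serves, because q^4 is not 1.\<close>

lemma kf_inv_zero:
  assumes "\<zeta> \<noteq> 0"
  obtains z where "z = q0 * \<zeta> \<or> z = q0 / \<zeta>" "kf z \<zeta> = 0" "kf (1 / z) \<zeta> \<noteq> 0"
proof (cases "\<zeta> ^ 4 = q0\<^sup>2")
  case False
  have "kf (1 / (q0 * \<zeta>)) \<zeta> \<noteq> 0" using kf_sym_args(2)[of \<zeta> \<zeta>] kf_self[of \<zeta>] assms False by simp
  moreover have "kf (q0 * \<zeta>) \<zeta> = 0" using assms q0_neq by (simp add: kf_def br_def)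
  ultimately show thesis using that by blast
next
  case True
  have "(1 / \<zeta>) ^ 4 \<noteq> q0\<^sup>2"
  proof
    assume "(1 / \<zeta>) ^ 4 = q0\<^sup>2"
    then have "q0\<^sup>2 * q0\<^sup>2 = 1" using True assms q0_neq by (simp add: power_divide field_simps)
    then have "q0 ^ 3 * q0 = 1" by (simp add: power2_eq_square power3_eq_cube mult_ac)
    then show False using q0_neq by (simp add: q0_cube)
  qed
  then have "kf (1 / \<zeta>) (1 / \<zeta>) \<noteq> 0" using assms by (intro kf_self) auto
  then have "kf (1 / (q0 / \<zeta>)) \<zeta> \<noteq> 0"
    using kf_sym_args(2)[of "1 / \<zeta>" \<zeta>] kf_sym_args(1)[of "1 / \<zeta>" \<zeta>] assms by simp
  moreover have "kf (q0 / \<zeta>) \<zeta> = 0" using assms q0_neq by (simp add: kf_def br_def)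
  ultimately show thesis using that by blast
qed

lemma poly_eqI_nonzero:
  fixes p q :: "complex poly"
  assumes "\<And>t. t \<noteq> 0 \<Longrightarrow> poly p t = poly q t"
  shows "p = q"
proof (rule ccontr)
  assume "p \<noteq> q"
  then have "finite {x. poly (p - q) x = 0}" by (intro poly_roots_finite) simp
  moreover have "UNIV - {0} \<subseteq> {x. poly (p - q) x = 0}" using assms by auto
  ultimately have "finite (UNIV - {0 :: complex})" by (rule finite_subset[rotated])
  then show False using infinite_UNIV_char_0[where 'a = complex] by simp
qed

text \<open>A common frame for the component at (...( and the mirrored one at )...):
  \<open>f\<close> is the component in all sizes, \<open>g\<close> its neighbour with one bracket
  flipped at the reflecting end. The parameter s has been removed and both boundary parameters are
  fixed.\<close>

locale extremal =
  fixes \<zeta>0 \<zeta>L :: complex and f g :: "complex list \<Rightarrow> complex"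
  assumes nz: "\<zeta>0 \<noteq> 0" "\<zeta>L \<noteq> 0"
    and exch: "exchange \<zeta>0 f"
    and reflect: "\<And>a z. 0 \<notin> set a \<Longrightarrow> z \<noteq> 0 \<Longrightarrow> kf (1 / z) \<zeta>L \<noteq> 0 \<Longrightarrow>
      kf z \<zeta>L * f (a @ [z]) + br (1 / q0) * br (z\<^sup>2) * (f (a @ [z]) + g (a @ [z]))
        = kf (1 / z) \<zeta>L * f (a @ [1 / z])"
    and fuse: "\<And>a x. 0 \<notin> set a \<Longrightarrow> x \<noteq> 0 \<Longrightarrow>
      g (a @ [x, q0 * x]) = (kf x \<zeta>0)\<^sup>2 * (kf x \<zeta>L)\<^sup>2 * (\<Prod>y\<leftarrow>a. kf x y ^ 4) * f a"
    and laurent_f: "\<And>N. 1 \<le> N \<Longrightarrow> \<exists>F. laurent_poly N (2 * int N - 1) F \<and>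
      (\<forall>zs. length zs = N \<longrightarrow> 0 \<notin> set zs \<longrightarrow> f zs = F (map (\<lambda>z. z\<^sup>2) zs))"
begin

lemma f_pair:
  assumes g: "generic \<zeta>0 \<zeta>L (a @ [x])" and IH: "f a = ext_comp \<zeta>0 \<zeta>L a"
  shows "f (a @ [x, 1 / (q0 * x)]) = ext_comp \<zeta>0 \<zeta>L (a @ [x, 1 / (q0 * x)])"
proof -
  have a: "0 \<notin> set a" and x: "x \<noteq> 0" "generic_pair x \<zeta>L" using g by (auto simp: generic_def)
  \<comment> \<open>The weight on the other side of the exchange relation is
    \<open>br 1\<close>.\<close>
  have "br (q0\<^sup>2) * f (a @ [x, q0 * x]) = 0"
    using exchange_swap[OF exch, of a x "q0 * x" "[]"] a x q0_neq by (simp add: br_def power2_eq_square)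
  then have z: "f (a @ [x, q0 * x]) = 0" using br_q0_ne_0 by simp
  have k: "kf (1 / (q0 * x)) \<zeta>L = kf x \<zeta>L" using kf_sym_args x nz by simp
  have k0: "kf x \<zeta>L \<noteq> 0" using kf_ne_0 x nz by simp
  \<comment> \<open>At z = q x the terms with \<open>f\<close> on the left vanish, and the reflected
    weight is k(x, zeta_L), which is not 0; so the value at 1/(q x) can be solved for.\<close>
  have e: "br (1 / q0) * br ((q0 * x)\<^sup>2) * g (a @ [x, q0 * x]) = kf x \<zeta>L * f (a @ [x, 1 / (q0 * x)])"
    using reflect[of "a @ [x]" "q0 * x"] a x q0_neq k k0 z by simp
  have "kf x \<zeta>L * f (a @ [x, 1 / (q0 * x)]) = kf x \<zeta>L * ext_comp \<zeta>0 \<zeta>L (a @ [x, 1 / (q0 * x)])"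
    unfolding e[symmetric] fuse[OF a x(1)] ext_comp_pair[OF g nz] IH by (simp add: power2_eq_square mult_ac)
  then show ?thesis using k0 by simp
qed

text \<open>The difference is bounded by 2m + 1, where m = \<open>length w\<close>. Dividing by the
  product \<open>K\<close> of the k(z, x) uses up the zeros q x and q / x. The inversion symmetry
  carries the zeros 1/(q x) and x / q back to these places, so \<open>K\<close> divides once more.
  What remains is a quadratic in z^2 with three zeros; two of them need an entry of
  \<open>w\<close>, hence the condition that it is not empty.\<close>

lemma step_generic:
  assumes w: "generic \<zeta>0 \<zeta>L w" "w \<noteq> []" and z: "z \<noteq> 0"
    and IH: "\<And>a. length a + 1 = length w \<Longrightarrow> 0 \<notin> set a \<Longrightarrow> f a = ext_comp \<zeta>0 \<zeta>L a"
  shows "f (w @ [z]) = ext_comp \<zeta>0 \<zeta>L (w @ [z])"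
proof -
  define D where "D zs = f zs - ext_comp \<zeta>0 \<zeta>L zs" for zs
  define m where "m = length w"
  define \<phi> where "\<phi> z = D (w @ [z])" for z
  have exD: "exchange \<zeta>0 D"
    unfolding D_def[abs_def] using nz by (intro exchange_diff exch exchange_ext_comp)
  have wx: "x \<noteq> 0" "x ^ 12 \<noteq> 1" "generic_pair x \<zeta>0" if "x \<in> set w" for x
    using w that by (auto simp: generic_def)
  then have w0: "0 \<notin> set w" by auto
  \<comment> \<open>At q y the exchange relation alone gives a zero of the difference, at 1/(q y)
    the values from \<open>f_pair\<close> agree by induction. Taking y = x and y = 1/x gives all
    four.\<close>
  have zeros: "\<phi> (q0 * x) = 0 \<and> \<phi> (q0 / x) = 0 \<and> \<phi> (1 / (q0 * x)) = 0 \<and> \<phi> (x / q0) = 0" if x: "x \<in> set w" for x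
  proof -
    obtain a b where ab: "w = a @ x # b" using x by (meson split_list)
    have gy: "generic \<zeta>0 \<zeta>L ((a @ b) @ [y])" if "y = x \<or> y = 1 / x" for y
    proof -
      have "generic \<zeta>0 \<zeta>L ((a @ b) @ [x])"
        using w(1) unfolding ab generic_move[of _ _ "a @ b"] generic_move[of _ _ a] by simp
      then show ?thesis using generic_inv[of \<zeta>0 \<zeta>L "a @ b" x "[]"] that by auto
    qed
    have *: "\<phi> t = 0" if "y = x \<or> y = 1 / x" "D ((a @ b) @ [y, t]) = 0" "t \<noteq> 0" for y t
      using exchange_zero_last[OF nz(1) _ exD, of "[t]" \<zeta>L a x b y] w(1) that ab by (simp add: \<phi>_def)
    have ab0: "0 \<notin> set (a @ b)" using w0 ab by auto
    have D1: "D ((a @ b) @ [y, q0 * y]) = 0" if "y = x \<or> y = 1 / x" for y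
    proof -
      have y: "y \<noteq> 0" using that wx[OF x] by auto
      have "br (q0\<^sup>2) * D ((a @ b) @ [y, q0 * y]) = 0"
        using exchange_swap[OF exD, of "a @ b" y "q0 * y" "[]"] y q0_neq ab0
        by (simp add: br_def power2_eq_square)
      then show ?thesis using br_q0_ne_0 by simp
    qed
    have D2: "D ((a @ b) @ [y, 1 / (q0 * y)]) = 0" if "y = x \<or> y = 1 / x" for y
      using f_pair[OF gy[OF that]] IH[of "a @ b"] ab0 ab by (simp add: D_def)
    show ?thesis
      using *[OF _ D1, of x] *[OF _ D1, of "1 / x"] *[OF _ D2, of x] *[OF _ D2, of "1 / x"] wx[OF x] q0_neq
      by simp
  qed
  have "lpol (2 * m + 1) \<phi>"
    unfolding \<phi>_def D_def
  proof (rule lpol_diff)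
    obtain F where F: "laurent_poly (Suc m) (2 * int (Suc m) - 1) F"
      "\<And>zs. length zs = Suc m \<Longrightarrow> 0 \<notin> set zs \<Longrightarrow> f zs = F (map (\<lambda>z. z\<^sup>2) zs)"
      using laurent_f[of "Suc m"] by auto
    have "lpol (2 * m + 1) (\<lambda>z. F (map (\<lambda>z. z\<^sup>2) w @ [z\<^sup>2]))"
      by (rule laurent_poly_last) (use F(1) w0 in \<open>auto simp: m_def algebra_simps\<close>)
    then show "lpol (2 * m + 1) (\<lambda>z. f (w @ [z]))"
      by (rule lpol_cong) (use F(2) w0 in \<open>auto simp: m_def\<close>)
    show "lpol (2 * m + 1) (\<lambda>z. ext_comp \<zeta>0 \<zeta>L (w @ [z]))"
      using lpol_ext_comp[OF nz(1) w0] by (simp add: m_def)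
  qed
  then have l1: "lpol (length w + (m + 1)) \<phi>" by (simp add: m_def mult_2)
  have sw: "sorted_wrt generic_pair w" using w(1) by (simp add: generic_def)
  define K where "K z = (\<Prod>x\<leftarrow>w. kf z x)" for z
  obtain \<phi>1 where l2: "lpol (m + 1) \<phi>1" and \<phi>1: "\<And>z. z \<noteq> 0 \<Longrightarrow> \<phi> z = K z * \<phi>1 z"
    unfolding K_def using lpol_factor_prod_kf[OF l1 sw] wx zeros by blast
  \<comment> \<open>Invariance of \<open>\<phi>1 z / kf z \<zeta>0\<close> under inversion, without
    denominators. Continuity extends it beyond generic z, in particular to the zeros of k(z,
    zeta_0), where it is needed.\<close>
  have sym: "\<phi>1 (1 / z) * kf z \<zeta>0 = \<phi>1 z * kf (1 / z) \<zeta>0" if z: "z \<noteq> 0" for z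
  proof -
    have "\<phi>1 (1 / z) * kf z \<zeta>0 - \<phi>1 z * kf (1 / z) \<zeta>0 = 0"
    proof (rule continuous_zero_cofinite[of "\<lambda>z. \<phi>1 (1 / z) * kf z \<zeta>0 - \<phi>1 z * kf (1 / z) \<zeta>0"])
      have c: "continuous_on (-{0}) \<phi>1" by (rule lpol_continuous[OF l2])
      have "continuous_on (-{0}) (\<lambda>z. \<phi>1 (1 / z))"
        by (rule continuous_on_compose2[OF c]) (auto intro!: continuous_intros)
      then show "continuous_on (-{0}) (\<lambda>z. \<phi>1 (1 / z) * kf z \<zeta>0 - \<phi>1 z * kf (1 / z) \<zeta>0)"
        unfolding kf_def br_def using nz q0_neq by (auto intro!: continuous_intros c)
      show "finite (excluded \<zeta>0 \<zeta>L w)" by (rule finite_excluded)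
      fix z :: complex assume z: "z \<noteq> 0" "z \<notin> excluded \<zeta>0 \<zeta>L w"
      have gz: "generic \<zeta>0 \<zeta>L (w @ [z])" using w(1) z by (rule generic_snoc)
      have "D (w @ [1 / z]) * kprod (\<zeta>0 # w @ [z]) = D (w @ [z]) * kprod (\<zeta>0 # w @ [1 / z])"
        using exchange_invert_last[OF nz(1) _ exD, of "[]"] gz by simp
      moreover
      have kp: "kprod (\<zeta>0 # w @ [t]) = kprod (\<zeta>0 # w) * (kf t \<zeta>0 * K t)" for t
        using kprod_snoc[of "\<zeta>0 # w" t] by (simp add: K_def)
      have "(kprod (\<zeta>0 # w) * K z * K (1 / z)) * (\<phi>1 (1 / z) * kf z \<zeta>0) = D (w @ [1 / z]) * kprod (\<zeta>0 # w @ [z])"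
        using \<phi>1[of "1 / z"] z(1) unfolding kp \<phi>_def by (simp add: mult_ac del: kprod.simps)
      moreover have "(kprod (\<zeta>0 # w) * K z * K (1 / z)) * (\<phi>1 z * kf (1 / z) \<zeta>0) = D (w @ [z]) * kprod (\<zeta>0 # w @ [1 / z])"
        using \<phi>1[of z] z(1) unfolding kp \<phi>_def by (simp add: mult_ac del: kprod.simps)
      ultimately have "(kprod (\<zeta>0 # w) * K z * K (1 / z)) * (\<phi>1 (1 / z) * kf z \<zeta>0 - \<phi>1 z * kf (1 / z) \<zeta>0) = 0"
        by (simp add: right_diff_distrib del: kprod.simps mult_eq_0_iff)
      moreover have "kprod (\<zeta>0 # w) * K z * K (1 / z) \<noteq> 0"
        using kprod_ne_0[OF gz nz(1)] kprod_ne_0[OF generic_inv[OF gz] nz(1)] unfolding kp by auto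
      ultimately show "\<phi>1 (1 / z) * kf z \<zeta>0 - \<phi>1 z * kf (1 / z) \<zeta>0 = 0"
        unfolding mult_eq_0_iff by blast
    qed (use z in auto)
    then show ?thesis by simp
  qed
  \<comment> \<open>The known zeros are zeros of \<open>\<phi>\<close>; they pass to
    \<open>\<phi>1\<close>, and later to \<open>\<phi>2\<close>, only where \<open>K\<close> does
    not vanish.\<close>
  have K_ne_0: "K (1 / (q0 * y)) \<noteq> 0" if "x \<in> set w" "y = x \<or> y = 1 / x" for x y
  proof -
    have y: "y \<noteq> 0" using that wx by auto
    have "kf (1 / (q0 * y)) v \<noteq> 0" if v: "v \<in> set w" for v
    proof (cases "v = x")
      case True
      have "x ^ 4 \<noteq> q0\<^sup>2"
      proof
        assume "x ^ 4 = q0\<^sup>2"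
        then have "(x ^ 4) ^ 3 = (q0\<^sup>2) ^ 3" by simp
        then have "x ^ 12 = q0 ^ 6" by (simp flip: power_mult)
        then show False using wx[OF v] True by (simp add: q0_pow6)
      qed
      moreover have "(1 / x) ^ 4 \<noteq> q0\<^sup>2"
      proof
        assume "(1 / x) ^ 4 = q0\<^sup>2"
        then have "((1 / x) ^ 4) ^ 3 = (q0\<^sup>2) ^ 3" by (simp only:)
        then have "(1 / x) ^ 12 = q0 ^ 6" by (simp only: power_mult[symmetric]) simp
        then show False using wx[OF v] True by (simp add: q0_pow6 power_divide)
      qed
      ultimately have "kf y y \<noteq> 0" using kf_self[of x] kf_self[of "1 / x"] \<open>y = x \<or> y = 1 / x\<close> wx[OF v] True by auto
      moreover have "kf y v = kf y y"
        using \<open>y = x \<or> y = 1 / x\<close> True kf_sym_args(1)[of y x] y wx[OF v] by auto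
      ultimately show ?thesis using kf_sym_args(2)[of y v] y wx[OF v] by simp
    next
      case False
      obtain i j where ij: "w ! i = v" "w ! j = x" "i < length w" "j < length w" "i \<noteq> j"
        using v \<open>x \<in> set w\<close> False by (metis in_set_conv_nth)
      have "generic_pair x v"
        using sw ij unfolding sorted_wrt_iff_nth_less by (metis generic_pair_sym nat_neq_iff)
      then have "generic_pair y v" using \<open>y = x \<or> y = 1 / x\<close> wx[OF \<open>x \<in> set w\<close>] by auto
      then show ?thesis using kf_sym_args(2)[of y v] kf_ne_0[of y v] y wx[OF v] by simp
    qed
    then show ?thesis by (auto simp: K_def prod_list_zero_iff)
  qed
  have \<phi>1_zero: "\<phi>1 (1 / (q0 * y)) = 0" "\<phi>1 (q0 * y) = 0" if x: "x \<in> set w" and y: "y = x \<or> y = 1 / x" for x y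
  proof -
    have y0: "y \<noteq> 0" "generic_pair y \<zeta>0" using y wx[OF x] by auto
    have "\<phi> (1 / (q0 * y)) = 0" using zeros[OF x] y by auto
    then show 1: "\<phi>1 (1 / (q0 * y)) = 0" using \<phi>1[of "1 / (q0 * y)"] K_ne_0[OF x y] y0 q0_neq by simp
    have "kf (1 / (q0 * y)) \<zeta>0 \<noteq> 0" using kf_sym_args(2)[of y \<zeta>0] kf_ne_0[of y \<zeta>0] y0 nz by simp
    then show "\<phi>1 (q0 * y) = 0" using sym[of "1 / (q0 * y)"] 1 y0 q0_neq by simp
  qed
  have l2': "lpol (length w + 1) \<phi>1" using l2 by (simp add: m_def)
  have "\<exists>\<psi>. lpol 1 \<psi> \<and> (\<forall>z. z \<noteq> 0 \<longrightarrow> \<phi>1 z = K z * \<psi> z)"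
    unfolding K_def
  proof (rule lpol_factor_prod_kf[OF l2' sw])
    fix x assume x: "x \<in> set w"
    show "x \<noteq> 0 \<and> x ^ 12 \<noteq> 1 \<and> \<phi>1 (q0 * x) = 0 \<and> \<phi>1 (q0 / x) = 0"
      using wx[OF x] \<phi>1_zero(2)[OF x, of x] \<phi>1_zero(2)[OF x, of "1 / x"] by simp
  qed
  then obtain \<phi>2 where l3: "lpol 1 \<phi>2" and \<phi>2: "\<And>z. z \<noteq> 0 \<Longrightarrow> \<phi>1 z = K z * \<phi>2 z" by blast
  obtain x where x: "x \<in> set w" using w(2) by (cases w) auto
  \<comment> \<open>The third zero belongs to the left boundary: with k(z0, zeta_0) = 0 and k(1/z0,
    zeta_0) not 0, the symmetry forces \<open>\<phi>1 z0 = 0\<close>.\<close>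
  obtain z0 where z0: "z0 = q0 * \<zeta>0 \<or> z0 = q0 / \<zeta>0" "kf z0 \<zeta>0 = 0" "kf (1 / z0) \<zeta>0 \<noteq> 0"
    using kf_inv_zero[OF nz(1)] by metis
  have z00: "z0 \<noteq> 0" using z0 q0_neq nz by auto
  have gz0: "generic_pair z0 v" if "v \<in> set w" for v
  proof -
    have 1: "generic_pair \<zeta>0 v" using wx[OF that] generic_pair_sym by blast
    then have 2: "generic_pair (1 / \<zeta>0) v" using nz by simp
    show ?thesis
      using z0(1) 1 2 generic_pair_trans(1)[of \<zeta>0 v] generic_pair_trans(1)[of "1 / \<zeta>0" v] by auto
  qed
  have "K z0 \<noteq> 0" using kf_ne_0[OF gz0 z00] wx by (auto simp: K_def prod_list_zero_iff)
  moreover have "\<phi>1 z0 = 0" using sym[OF z00] z0 by simp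
  ultimately have a3: "\<phi>2 z0 = 0" using \<phi>2[OF z00] by simp
  have a1: "\<phi>2 (1 / (q0 * x)) = 0"
    using \<phi>2[of "1 / (q0 * x)"] \<phi>1_zero(1)[OF x, of x] K_ne_0[OF x, of x] wx[OF x] q0_neq by simp
  have a2: "\<phi>2 (x / q0) = 0"
    using \<phi>2[of "x / q0"] \<phi>1_zero(1)[OF x, of "1 / x"] K_ne_0[OF x, of "1 / x"] wx[OF x] q0_neq by simp
  have "\<phi>2 z = 0"
  proof (rule lpol_1_three_zeros[OF l3 a1 a2 a3 _ _ z00 _ _ _ z])
    have "generic_pair x z0" using gz0[OF x] generic_pair_sym by blast
    then have "generic_pair (1 / (q0 * x)) z0" "generic_pair (x / q0) z0"
      using wx[OF x] q0_neq by simp_all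
    then show "(1 / (q0 * x))\<^sup>2 \<noteq> z0\<^sup>2" "(x / q0)\<^sup>2 \<noteq> z0\<^sup>2" using generic_pair_sq by blast+
    show "(1 / (q0 * x))\<^sup>2 \<noteq> (x / q0)\<^sup>2"
    proof
      assume "(1 / (q0 * x))\<^sup>2 = (x / q0)\<^sup>2"
      then have "(x / q0)\<^sup>2 * (q0 * x)\<^sup>2 = (1 / (q0 * x))\<^sup>2 * (q0 * x)\<^sup>2" by (simp only:)
      moreover have "(x / q0)\<^sup>2 * (q0 * x)\<^sup>2 = x ^ 4"
        using q0_neq by (simp add: power2_eq_square power4_eq_xxxx)
      moreover have "(1 / (q0 * x))\<^sup>2 * (q0 * x)\<^sup>2 = 1"
        using wx[OF x] q0_neq by (simp flip: power_mult_distrib)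
      ultimately have "x ^ 4 = 1" by simp
      then have "(x ^ 4) ^ 3 = 1" by simp
      then show False using wx[OF x] by (simp flip: power_mult)
    qed
  qed (use wx[OF x] q0_neq in auto)
  then have "\<phi> z = 0" using \<phi>1[OF z] \<phi>2[OF z] by simp
  then show ?thesis by (simp add: \<phi>_def D_def)
qed

lemma step:
  assumes IH: "\<And>a. length a = m \<Longrightarrow> 0 \<notin> set a \<Longrightarrow> f a = ext_comp \<zeta>0 \<zeta>L a"
    and zs: "length zs = m + 2" "0 \<notin> set zs"
  shows "f zs = ext_comp \<zeta>0 \<zeta>L zs"
proof -
  have "f zs - ext_comp \<zeta>0 \<zeta>L zs = 0"
  proof (rule sep_cont_eq_0[where F = "\<lambda>zs. f zs - ext_comp \<zeta>0 \<zeta>L zs" and N = "m + 2" and Bad = "excluded \<zeta>0 \<zeta>L"])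
    show "sep_cont (m + 2) (\<lambda>zs. f zs - ext_comp \<zeta>0 \<zeta>L zs)"
    proof (rule sep_cont_arith(1)[OF _ sep_cont_ext_comp[OF nz]])
      obtain F where F: "laurent_poly (m + 2) (2 * int (m + 2) - 1) F"
        "\<And>zs. length zs = m + 2 \<Longrightarrow> 0 \<notin> set zs \<Longrightarrow> f zs = F (map (\<lambda>z. z\<^sup>2) zs)"
        using laurent_f[of "m + 2"] by auto
      then have sF: "sep_cont (m + 2) F" by (intro sep_cont_laurent) (auto simp: laurent_def)
      show "sep_cont (m + 2) f"
        unfolding sep_cont_def
      proof (intro allI impI, elim conjE)
        fix xs :: "complex list" and i assume xs: "length xs = m + 2" "0 \<notin> set xs" "i < m + 2"
        have "continuous_on (-{0}) (\<lambda>t. F ((map (\<lambda>z. z\<^sup>2) xs)[i := t]))"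
          by (rule sep_contD[OF sF]) (use xs in auto)
        then have "continuous_on (-{0}) (\<lambda>t. F ((map (\<lambda>z. z\<^sup>2) xs)[i := t\<^sup>2]))"
          by (rule continuous_on_compose2) (auto intro!: continuous_intros)
        then show "continuous_on (-{0}) (\<lambda>t. f (xs[i := t]))"
        proof (rule continuous_on_cong[THEN iffD1, OF refl, rotated])
          fix t :: complex assume "t \<in> -{0}"
          then have "0 \<notin> set (xs[i := t])" using xs set_update_subset_insert[of xs i t] by auto
          then show "F ((map (\<lambda>z. z\<^sup>2) xs)[i := t\<^sup>2]) = f (xs[i := t])"
            using F(2)[of "xs[i := t]"] xs by (simp add: map_update)
        qed
      qed
    qed
    show "f xs - ext_comp \<zeta>0 \<zeta>L xs = 0" if xs: "length xs = m + 2" "0 \<notin> set xs"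
      "\<And>i. i < m + 2 \<Longrightarrow> xs ! i \<notin> excluded \<zeta>0 \<zeta>L (take i xs)" for xs
    proof -
      have g: "generic \<zeta>0 \<zeta>L xs" using xs by (intro generic_not_excluded) auto
      obtain w z where wz: "xs = w @ [z]" using xs(1) by (cases xs rule: rev_cases) auto
      have "f (w @ [z]) = ext_comp \<zeta>0 \<zeta>L (w @ [z])"
        by (rule step_generic) (use g generic_append[of \<zeta>0 \<zeta>L w "[z]"] xs wz IH in auto)
      then show ?thesis by (simp add: wz)
    qed
  qed (use zs finite_excluded in auto)
  then show ?thesis by simp
qed

lemma even_length:
  assumes "f [] = 1"
  shows "length zs = 2 * m \<Longrightarrow> 0 \<notin> set zs \<Longrightarrow> f zs = ext_comp \<zeta>0 \<zeta>L zs"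
proof (induction m arbitrary: zs)
  case 0
  then show ?case using assms by (simp add: ext_comp_short)
next
  case (Suc m)
  show ?case by (rule step[OF Suc.IH]) (use Suc.prems in auto)
qed

lemma odd_length:
  assumes "\<And>z. z \<noteq> 0 \<Longrightarrow> f [z] = - kf z \<zeta>0"
  shows "length zs = 2 * m + 1 \<Longrightarrow> 0 \<notin> set zs \<Longrightarrow> f zs = ext_comp \<zeta>0 \<zeta>L zs"
proof (induction m arbitrary: zs)
  case 0
  then have z: "zs = [zs ! 0]" by (intro nth_equalityI) simp_all
  with "0.prems"(2) have "zs ! 0 \<noteq> 0" by (metis list.set_intros(1))
  then have "f [zs ! 0] = ext_comp \<zeta>0 \<zeta>L [zs ! 0]" unfolding ext_comp_short by (rule assms)
  then show ?case using z by simp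
next
  case (Suc m)
  show ?case by (rule step[OF Suc.IH]) (use Suc.prems in auto)
qed

text \<open>No fused point exists in size 1, so only the exponents -1, 0, 1 and the inversion
  relation can be used. Comparing coefficients in t = z^2 leaves one free scalar.\<close>

lemma length_one: "\<exists>\<sigma>. \<forall>z. z \<noteq> 0 \<longrightarrow> f [z] = - \<sigma> * kf z \<zeta>0"
proof -
  obtain F where F: "laurent_poly 1 1 F" "\<And>zs. length zs = 1 \<Longrightarrow> 0 \<notin> set zs \<Longrightarrow> f zs = F (map (\<lambda>z. z\<^sup>2) zs)"
    using laurent_f[of 1] by auto
  have "lpol 1 (\<lambda>z. F ([] @ [z\<^sup>2]))"
    by (rule laurent_poly_last) (use F(1) in auto)
  from lpolE[OF this] obtain p
    where p: "degree p \<le> 2 * 1" "\<And>z. z \<noteq> 0 \<Longrightarrow> F ([] @ [z\<^sup>2]) * z ^ (2 * 1) = poly p (z\<^sup>2)" by metis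
  define \<gamma> \<beta> \<alpha> where "\<gamma> = coeff p 0" and "\<beta> = coeff p 1" and "\<alpha> = coeff p 2"
  have "p = [:\<gamma>, \<beta>, \<alpha>:]"
  proof (rule poly_eqI)
    fix n :: nat
    consider "n = 0" | "n = 1" | "n = 2" | "n > 2" by linarith
    then show "coeff p n = coeff [:\<gamma>, \<beta>, \<alpha>:] n"
    proof cases
      case 4
      then have "coeff p n = 0" using p(1) by (intro coeff_eq_0) simp
      moreover have "degree [:\<gamma>, \<beta>, \<alpha>:] < n" using 4 by (simp add: degree_pCons_eq_if)
      ultimately show ?thesis by (simp add: coeff_eq_0)
    qed (simp_all add: \<gamma>_def \<beta>_def \<alpha>_def numeral_2_eq_2)
  qed
  then have fz: "f [z] * z\<^sup>2 = \<gamma> + \<beta> * z\<^sup>2 + \<alpha> * (z\<^sup>2)\<^sup>2" if "z \<noteq> 0" for z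
    using p(2)[OF that] F(2)[of "[z]"] that by (simp add: algebra_simps power2_eq_square)
  define y where "y = sq_sum \<zeta>0"
  have kz: "kf z \<zeta>0 * z\<^sup>2 = q0\<^sup>2 - y * z\<^sup>2 + q0 * (z\<^sup>2)\<^sup>2" if "z \<noteq> 0" for z
  proof -
    have "kf z \<zeta>0 * z\<^sup>2 = q0 * (z\<^sup>2)\<^sup>2 - q0 ^ 3 * y * z\<^sup>2 + q0 ^ 3 * q0\<^sup>2"
      unfolding kf_explicit[OF that nz(1)] y_def sq_sum_def using nz
      by (simp add: power_mult_distrib power_divide field_simps power2_eq_square power3_eq_cube)
    then show ?thesis by (simp add: q0_cube)
  qed
  \<comment> \<open>The two sides of the inversion relation multiplied by t^2, expanded in t =
    z^2.\<close>
  define p1 where "p1 = [:\<gamma> * q0, \<beta> * q0 - \<gamma> * y, \<alpha> * q0 - \<beta> * y + \<gamma> * q0\<^sup>2, \<beta> * q0\<^sup>2 - \<alpha> * y, \<alpha> * q0\<^sup>2:]"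
  define p2 where "p2 = [:q0\<^sup>2 * \<alpha>, q0\<^sup>2 * \<beta> - y * \<alpha>, q0\<^sup>2 * \<gamma> - y * \<beta> + q0 * \<alpha>, q0 * \<beta> - y * \<gamma>, q0 * \<gamma>:]"
  have "poly p1 t = poly p2 t" if "t \<noteq> 0" for t
  proof -
    define z where "z = csqrt t"
    have z: "z\<^sup>2 = t" "z \<noteq> 0" using that by (auto simp: z_def)
    have e: "kf (1 / z) \<zeta>0 * f [z] = kf z \<zeta>0 * f [1 / z]"
      using exchange_invert[OF exch, of z "[]"] z by simp
    have i: "(1 / z)\<^sup>2 = 1 / t" using z by (simp add: power_one_over)
    have 1: "kf (1 / z) \<zeta>0 * t = q0\<^sup>2 * t\<^sup>2 - y * t + q0"
      using kz[of "1 / z", unfolded i] z(2) that by (simp add: field_simps power2_eq_square)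
    have 2: "f [1 / z] * t = \<gamma> * t\<^sup>2 + \<beta> * t + \<alpha>"
      using fz[of "1 / z", unfolded i] z(2) that by (simp add: field_simps power2_eq_square)
    have 3: "f [z] * t = \<gamma> + \<beta> * t + \<alpha> * t\<^sup>2" "kf z \<zeta>0 * t = q0\<^sup>2 - y * t + q0 * t\<^sup>2"
      using fz[OF z(2)] kz[OF z(2)] by (simp_all only: z(1))
    have "(f [z] * t) * (kf (1 / z) \<zeta>0 * t) = (kf z \<zeta>0 * t) * (f [1 / z] * t)"
      using e by (simp add: mult_ac)
    then have "(\<gamma> + \<beta> * t + \<alpha> * t\<^sup>2) * (q0\<^sup>2 * t\<^sup>2 - y * t + q0)
       = (q0\<^sup>2 - y * t + q0 * t\<^sup>2) * (\<gamma> * t\<^sup>2 + \<beta> * t + \<alpha>)" by (simp only: 1 2 3)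
    moreover have "poly p1 t = (\<gamma> + \<beta> * t + \<alpha> * t\<^sup>2) * (q0\<^sup>2 * t\<^sup>2 - y * t + q0)"
      "poly p2 t = (q0\<^sup>2 - y * t + q0 * t\<^sup>2) * (\<gamma> * t\<^sup>2 + \<beta> * t + \<alpha>)"
      by (simp_all add: p1_def p2_def algebra_simps power2_eq_square)
    ultimately show ?thesis by (simp only:)
  qed
  then have "p1 = p2" by (rule poly_eqI_nonzero)
  then have c4: "\<alpha> * q0\<^sup>2 = q0 * \<gamma>" and c3: "\<beta> * q0\<^sup>2 - \<alpha> * y = q0 * \<beta> - y * \<gamma>"
    unfolding p1_def p2_def pCons_eq_iff by blast+
  have "q0 * \<gamma> = q0 * (q0 * \<alpha>)" unfolding c4[symmetric] by (simp add: power2_eq_square)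
  then have \<gamma>: "\<gamma> = q0 * \<alpha>" using q0_neq by simp
  have "(q0 - 1) * (q0 * \<beta> + y * \<alpha>) = 0" using c3 unfolding \<gamma> by (simp add: algebra_simps power2_eq_square)
  then have "q0 * \<beta> = - y * \<alpha>" using q0_neq by (simp add: eq_neg_iff_add_eq_0)
  then have "q0\<^sup>2 * (q0 * \<beta>) = - y * \<alpha> * q0\<^sup>2" by simp
  moreover have "q0\<^sup>2 * (q0 * \<beta>) = q0 ^ 3 * \<beta>" by (simp add: power2_eq_square power3_eq_cube)
  ultimately have \<beta>: "\<beta> = - y * \<alpha> * q0\<^sup>2" by (simp add: q0_cube)
  have "f [z] = - (- \<alpha> * q0\<^sup>2) * kf z \<zeta>0" if "z \<noteq> 0" for z
  proof -
    have "f [z] * z\<^sup>2 = \<alpha> * q0\<^sup>2 * (kf z \<zeta>0 * z\<^sup>2)"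
    proof -
      have "\<alpha> * q0\<^sup>2 * (q0\<^sup>2 - y * z\<^sup>2 + q0 * (z\<^sup>2)\<^sup>2) = \<alpha> * q0 ^ 3 * q0 - y * \<alpha> * q0\<^sup>2 * z\<^sup>2 + \<alpha> * q0 ^ 3 * (z\<^sup>2)\<^sup>2"
        by (simp add: algebra_simps power2_eq_square power3_eq_cube)
      then show ?thesis unfolding fz[OF that] kz[OF that] \<gamma> \<beta> by (simp add: q0_cube mult_ac)
    qed
    then show ?thesis using that by simp
  qed
  then show ?thesis by blast
qed

end

section \<open>The extremal components of a solution\<close>

text \<open>Sites i and i + 1 linked to each other always read as \<open>()\<close>, so no pattern
  with equal brackets there is produced.\<close>

lemma tl_gen_bulk_eq_0:
  assumes "1 \<le> i" "i < L" "\<beta> ! (i - 1) = \<beta> ! i"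
  shows "tl_gen L i v \<beta> = 0"
proof -
  have "pattern_of L (join_sites i c) \<noteq> \<beta>" for c
  proof
    assume \<beta>: "pattern_of L (join_sites i c) = \<beta>"
    have "\<beta> ! (i - 1) = Opening" "\<beta> ! i = Closing"
      using assms(1,2) unfolding \<beta>[symmetric] pattern_of_def by (simp_all add: join_sites_def del: upt_Suc)
    then show False using assms(3) by simp
  qed
  then show ?thesis using assms by (simp add: tl_gen_def lin_ext_def)
qed

lemma tl_gen_boundary_eq_0:
  assumes L: "1 \<le> L"
  shows "tl_gen L 0 v (replicate L Opening) = 0" "tl_gen L L v (replicate L Closing) = 0"
proof -
  have "\<alpha>[0 := Closing] \<noteq> replicate L Opening" if "length \<alpha> = L" for \<alpha>
  proof
    assume "\<alpha>[0 := Closing] = replicate L Opening"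
    then have "\<alpha>[0 := Closing] ! 0 = replicate L Opening ! 0" by (simp only:)
    then show False using that L by simp
  qed
  then have e: "{\<alpha> \<in> LP L. \<alpha>[0 := Closing] = replicate L Opening} = {}" by (auto simp: LP_def)
  have "tl_gen L 0 v (replicate L Opening) = sum v {\<alpha> \<in> LP L. \<alpha>[0 := Closing] = replicate L Opening}"
    by (simp add: tl_gen_def lin_ext_def)
  also have "\<dots> = 0" unfolding e by simp
  finally show "tl_gen L 0 v (replicate L Opening) = 0" .
  have "\<alpha>[L - 1 := Opening] \<noteq> replicate L Closing" if "length \<alpha> = L" for \<alpha>
  proof
    assume "\<alpha>[L - 1 := Opening] = replicate L Closing"
    then have "\<alpha>[L - 1 := Opening] ! (L - 1) = replicate L Closing ! (L - 1)" by (simp only:)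
    then show False using that L by simp
  qed
  then have e: "{\<alpha> \<in> LP L. \<alpha>[L - 1 := Opening] = replicate L Closing} = {}" by (auto simp: LP_def)
  have "tl_gen L L v (replicate L Closing) = sum v {\<alpha> \<in> LP L. \<alpha>[L - 1 := Opening] = replicate L Closing}"
    using L by (simp add: tl_gen_def lin_ext_def)
  also have "\<dots> = 0" unfolding e by simp
  finally show "tl_gen L L v (replicate L Closing) = 0" .
qed

lemma replicate_Suc_snoc: "replicate (Suc n) c = replicate n c @ [c]"
  by (simp add: replicate_append_same)

lemma tl_gen_right_opening:
  assumes "1 \<le> L"
  shows "tl_gen L L v (replicate L Opening) = v (replicate L Opening) + v (replicate (L - 1) Opening @ [Closing])"
proof -
  obtain n where L: "L = Suc n" using assms by (cases L) auto
  have e: "{\<alpha> \<in> LP L. \<alpha>[L - 1 := Opening] = replicate L Opening} = {replicate L Opening, replicate n Opening @ [Closing]}"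
  proof (intro equalityI subsetI)
    fix \<alpha> assume \<alpha>: "\<alpha> \<in> {\<alpha> \<in> LP L. \<alpha>[L - 1 := Opening] = replicate L Opening}"
    then have "\<alpha> \<noteq> []" using L by (auto simp: LP_def)
    then obtain u c where u: "\<alpha> = u @ [c]" by (cases \<alpha> rule: rev_cases) auto
    then have "length u = n" using \<alpha> L by (simp add: LP_def)
    then have "u = replicate n Opening"
      using \<alpha> u unfolding L replicate_Suc_snoc by (simp add: list_update_append)
    then show "\<alpha> \<in> {replicate L Opening, replicate n Opening @ [Closing]}"
      unfolding u L replicate_Suc_snoc by (cases c) auto
  next
    fix \<alpha> assume "\<alpha> \<in> {replicate L Opening, replicate n Opening @ [Closing]}"
    then show "\<alpha> \<in> {\<alpha> \<in> LP L. \<alpha>[L - 1 := Opening] = replicate L Opening}"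
      unfolding L replicate_Suc_snoc by (auto simp: LP_def list_update_append)
  qed
  have "tl_gen L L v (replicate L Opening) = sum v {\<alpha> \<in> LP L. \<alpha>[L - 1 := Opening] = replicate L Opening}"
    using L by (simp add: tl_gen_def lin_ext_def)
  also have "\<dots> = v (replicate L Opening) + v (replicate n Opening @ [Closing])"
    unfolding e unfolding L replicate_Suc_snoc by simp
  finally show ?thesis using L by simp
qed

lemma tl_gen_left_closing:
  assumes "1 \<le> L"
  shows "tl_gen L 0 v (replicate L Closing) = v (replicate L Closing) + v (Opening # replicate (L - 1) Closing)"
proof -
  obtain n where L: "L = Suc n" using assms by (cases L) auto
  have e: "{\<alpha> \<in> LP L. \<alpha>[0 := Closing] = replicate L Closing} = {replicate L Closing, Opening # replicate n Closing}"
  proof (intro equalityI subsetI)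
    fix \<alpha> assume \<alpha>: "\<alpha> \<in> {\<alpha> \<in> LP L. \<alpha>[0 := Closing] = replicate L Closing}"
    then have "\<alpha> \<noteq> []" using L by (auto simp: LP_def)
    then obtain u c where u: "\<alpha> = c # u" by (cases \<alpha>) auto
    then show "\<alpha> \<in> {replicate L Closing, Opening # replicate n Closing}"
      using \<alpha> L by (cases c) auto
  qed (auto simp: LP_def L)
  have "tl_gen L 0 v (replicate L Closing) = sum v {\<alpha> \<in> LP L. \<alpha>[0 := Closing] = replicate L Closing}"
    by (simp add: tl_gen_def lin_ext_def)
  also have "\<dots> = v (replicate L Closing) + v (Opening # replicate n Closing)"
    unfolding e using L by simp
  finally show ?thesis using L by simp
qed

lemma lin_ext_inj:
  assumes "\<alpha> \<in> LP n" "\<And>\<alpha>'. \<alpha>' \<in> LP n \<Longrightarrow> F \<alpha>' = F \<alpha> \<Longrightarrow> \<alpha>' = \<alpha>"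
  shows "lin_ext n F v (F \<alpha>) = v \<alpha>"
proof -
  have "{\<alpha>' \<in> LP n. F \<alpha>' = F \<alpha>} = {\<alpha>}" using assms by auto
  then show ?thesis by (simp add: lin_ext_def)
qed

lemma phi_insert:
  assumes "length \<alpha> = L - 2" "i - 1 \<le> L - 2"
  shows "phi L i v (insert_arc i \<alpha>) = v \<alpha>"
  unfolding phi_def
proof (rule lin_ext_inj)
  fix \<alpha>' assume "\<alpha>' \<in> LP (L - 2)" "insert_arc i \<alpha>' = insert_arc i \<alpha>"
  then have "take (i - 1) \<alpha>' = take (i - 1) \<alpha> \<and> drop (i - 1) \<alpha>' = drop (i - 1) \<alpha>"
    using assms by (simp add: insert_arc_def LP_def)
  then show "\<alpha>' = \<alpha>" by (metis append_take_drop_id)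
qed (use assms in \<open>simp add: LP_def\<close>)

lemma phi_left_Cons: "length \<alpha> = L - 1 \<Longrightarrow> phi_left L v (Closing # \<alpha>) = v \<alpha>"
  unfolding phi_left_def by (rule lin_ext_inj) (auto simp: LP_def)

lemma phi_right_snoc: "length \<alpha> = L - 1 \<Longrightarrow> phi_right L v (\<alpha> @ [Opening]) = v \<alpha>"
  unfolding phi_right_def by (rule lin_ext_inj[of _ _ "\<lambda>\<alpha>. \<alpha> @ [Opening]"]) (auto simp: LP_def)

text \<open>The equation is assumed only where its denominator is not 0. If
  \<open>br (q0 * x / y)\<close> vanishes, the equation for the swapped arguments gives the same
  relation; if both weights vanish, both sides are 0.\<close>

lemma bulk_exchange:
  assumes qkz: "qKZ_bulk \<Psi>" and nz: "\<zeta>0 \<noteq> 0" "\<zeta>L \<noteq> 0" "0 \<notin> set (a @ x # y # b)"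
    and L: "L = length (a @ x # y # b)"
  shows "br (q0 * y / x) * \<Psi> L (a @ x # y # b) \<zeta>0 \<zeta>L (replicate L c)
       = br (q0 * x / y) * \<Psi> L (a @ y # x # b) \<zeta>0 \<zeta>L (replicate L c)"
proof -
  have *: "br (q0 * y / x) * \<Psi> L (a @ x # y # b) \<zeta>0 \<zeta>L (replicate L c)
       = br (q0 * x / y) * \<Psi> L (a @ y # x # b) \<zeta>0 \<zeta>L (replicate L c)"
    if nz': "0 \<notin> set (a @ x # y # b)" "L = length (a @ x # y # b)" "br (q0 * x / y) \<noteq> 0" for x y
  proof -
    define zs where "zs = a @ x # y # b"
    define i where "i = Suc (length a)"
    have zs: "zs ! (i - 1) = x" "zs ! i = y" "zs[i - 1 := y, i := x] = a @ y # x # b"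
      by (simp_all add: zs_def i_def nth_append list_update_append)
    have i: "1 \<le> i" "i + 1 \<le> L" using nz'(2) by (auto simp: i_def)
    have "args L zs \<zeta>0 \<zeta>L" using nz nz' by (auto simp: args_def zs_def)
    moreover have "br (q0 * (zs ! (i - 1) / zs ! i)) \<noteq> 0" unfolding zs using nz'(3) by simp
    moreover have "replicate L c \<in> LP L" by (simp add: LP_def)
    ultimately have "R_op L i (zs ! (i - 1) / zs ! i) (\<Psi> L zs \<zeta>0 \<zeta>L) (replicate L c)
      = \<Psi> L (zs[i - 1 := zs ! i, i := zs ! (i - 1)]) \<zeta>0 \<zeta>L (replicate L c)"
      using qkz i unfolding qKZ_bulk_def Let_def by blast
    then have "R_op L i (x / y) (\<Psi> L zs \<zeta>0 \<zeta>L) (replicate L c) = \<Psi> L (a @ y # x # b) \<zeta>0 \<zeta>L (replicate L c)"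
      by (simp only: zs)
    moreover have "tl_gen L i (\<Psi> L zs \<zeta>0 \<zeta>L) (replicate L c) = 0"
      using i by (intro tl_gen_bulk_eq_0) auto
    ultimately show ?thesis using nz'(3) by (simp add: R_op_def zs_def field_simps)
  qed
  consider "br (q0 * x / y) \<noteq> 0" | "br (q0 * y / x) \<noteq> 0" | "br (q0 * x / y) = 0" "br (q0 * y / x) = 0" by blast
  then show ?thesis
  proof cases
    case 1
    then show ?thesis using *[of x y] nz L by blast
  next
    case 2
    then show ?thesis using *[of y x] nz L by simp
  qed simp
qed

lemma left_exchange_opening:
  assumes qkz: "qKZ_left \<Psi>" and nz: "\<zeta>0 \<noteq> 0" "\<zeta>L \<noteq> 0" "0 \<notin> set (x # b)" and L: "L = length (x # b)"
  shows "kf (1 / x) \<zeta>0 * \<Psi> L (x # b) \<zeta>0 \<zeta>L (replicate L Opening)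
       = kf x \<zeta>0 * \<Psi> L (1 / x # b) \<zeta>0 \<zeta>L (replicate L Opening)"
proof -
  have *: "kf (1 / x) \<zeta>0 * \<Psi> L (x # b) \<zeta>0 \<zeta>L (replicate L Opening)
       = kf x \<zeta>0 * \<Psi> L (1 / x # b) \<zeta>0 \<zeta>L (replicate L Opening)"
    if nz': "0 \<notin> set (x # b)" "kf x \<zeta>0 \<noteq> 0" for x
  proof -
    have kx: "kf ((x # b) ! 0) \<zeta>0 \<noteq> 0" using nz'(2) by simp
    have "args L (x # b) \<zeta>0 \<zeta>L" "1 \<le> L" "replicate L Opening \<in> LP L" using nz nz' L by (auto simp: args_def LP_def)
    then have "K_op L 0 (1 / (x # b) ! 0) \<zeta>0 (\<Psi> L (x # b) \<zeta>0 \<zeta>L) (replicate L Opening)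
       = \<Psi> L ((x # b)[0 := 1 / (x # b) ! 0]) \<zeta>0 \<zeta>L (replicate L Opening)"
      using qkz kx unfolding qKZ_left_def Let_def by blast
    then show ?thesis using nz'(2) tl_gen_boundary_eq_0(1)[OF \<open>1 \<le> L\<close>] by (simp add: K_op_def field_simps)
  qed
  consider "kf x \<zeta>0 \<noteq> 0" | "kf (1 / x) \<zeta>0 \<noteq> 0" | "kf x \<zeta>0 = 0" "kf (1 / x) \<zeta>0 = 0" by blast
  then show ?thesis
  proof cases
    case 1
    then show ?thesis using *[of x] nz by blast
  next
    case 2
    then show ?thesis using *[of "1 / x"] nz by simp
  qed simp
qed

lemma left_reflect_closing:
  assumes qkz: "qKZ_left \<Psi>" and nz: "\<zeta>0 \<noteq> 0" "\<zeta>L \<noteq> 0" "0 \<notin> set (x # b)" and L: "L = length (x # b)"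
    and k: "kf x \<zeta>0 \<noteq> 0"
  shows "kf (1 / x) \<zeta>0 * \<Psi> L (x # b) \<zeta>0 \<zeta>L (replicate L Closing) + br (1 / q0) * br ((1 / x)\<^sup>2)
         * (\<Psi> L (x # b) \<zeta>0 \<zeta>L (replicate L Closing) + \<Psi> L (x # b) \<zeta>0 \<zeta>L (Opening # replicate (L - 1) Closing))
       = kf x \<zeta>0 * \<Psi> L (1 / x # b) \<zeta>0 \<zeta>L (replicate L Closing)"
proof -
  have kx: "kf ((x # b) ! 0) \<zeta>0 \<noteq> 0" using k by simp
  have "args L (x # b) \<zeta>0 \<zeta>L" "1 \<le> L" "replicate L Closing \<in> LP L" using nz L by (auto simp: args_def LP_def)
  then have "K_op L 0 (1 / (x # b) ! 0) \<zeta>0 (\<Psi> L (x # b) \<zeta>0 \<zeta>L) (replicate L Closing)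
     = \<Psi> L ((x # b)[0 := 1 / (x # b) ! 0]) \<zeta>0 \<zeta>L (replicate L Closing)"
    using qkz kx unfolding qKZ_left_def Let_def by blast
  then show ?thesis using k by (simp add: K_op_def tl_gen_left_closing[OF \<open>1 \<le> L\<close>] field_simps)
qed

lemma right_op:
  assumes qkz: "qKZ_right s \<Psi>" and nz: "\<zeta>0 \<noteq> 0" "\<zeta>L \<noteq> 0" "0 \<notin> set (a @ [z])" and L: "L = length (a @ [z])"
    and k: "kf (1 / (s * z)) (s * \<zeta>L) \<noteq> 0"
  shows "K_op L L (s * z) (s * \<zeta>L) (\<Psi> L (a @ [z]) \<zeta>0 \<zeta>L) (replicate L c)
     = \<Psi> L (a @ [1 / (s\<^sup>2 * z)]) \<zeta>0 \<zeta>L (replicate L c)"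
proof -
  define zs where "zs = a @ [z]"
  have zs: "zs ! (L - 1) = z" "zs[L - 1 := 1 / (s\<^sup>2 * z)] = a @ [1 / (s\<^sup>2 * z)]"
    using L by (simp_all add: zs_def nth_append list_update_append)
  have 1: "args L zs \<zeta>0 \<zeta>L" "1 \<le> L" "replicate L c \<in> LP L" using nz L by (auto simp: args_def LP_def zs_def)
  have 2: "kf (1 / (s * zs ! (L - 1))) (s * \<zeta>L) \<noteq> 0" unfolding zs by (rule k)
  have "K_op L L (s * zs ! (L - 1)) (s * \<zeta>L) (\<Psi> L zs \<zeta>0 \<zeta>L) (replicate L c)
     = \<Psi> L (zs[L - 1 := 1 / (s\<^sup>2 * zs ! (L - 1))]) \<zeta>0 \<zeta>L (replicate L c)"
    using qkz 1 2 unfolding qKZ_right_def Let_def by blast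
  then show ?thesis by (simp only: zs zs_def[symmetric])
qed

lemma right_exchange_closing:
  assumes qkz: "qKZ_right s \<Psi>" and nz: "\<zeta>0 \<noteq> 0" "\<zeta>L \<noteq> 0" "0 \<notin> set (a @ [z])" and L: "L = length (a @ [z])"
    and s: "s \<noteq> 0"
  shows "kf (1 / (s * z)) (s * \<zeta>L) * \<Psi> L (a @ [1 / (s\<^sup>2 * z)]) \<zeta>0 \<zeta>L (replicate L Closing)
       = kf (s * z) (s * \<zeta>L) * \<Psi> L (a @ [z]) \<zeta>0 \<zeta>L (replicate L Closing)"
proof -
  have *: "kf (1 / (s * z)) (s * \<zeta>L) * \<Psi> L (a @ [1 / (s\<^sup>2 * z)]) \<zeta>0 \<zeta>L (replicate L Closing)
       = kf (s * z) (s * \<zeta>L) * \<Psi> L (a @ [z]) \<zeta>0 \<zeta>L (replicate L Closing)"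
    if nz': "0 \<notin> set (a @ [z])" "L = length (a @ [z])" "kf (1 / (s * z)) (s * \<zeta>L) \<noteq> 0" for z
  proof -
    have "1 \<le> L" using nz' by simp
    show ?thesis
      using right_op[OF qkz nz(1,2) nz', of Closing] nz'(3) tl_gen_boundary_eq_0(2)[OF \<open>1 \<le> L\<close>]
      by (simp add: K_op_def field_simps)
  qed
  \<comment> \<open>The involution z to 1/(s^2 z) exchanges the two weights, so the equation at
    \<open>z'\<close> covers the case of a vanishing denominator at z.\<close>
  define z' where "z' = 1 / (s\<^sup>2 * z)"
  have z: "z \<noteq> 0" using nz by auto
  have z': "s * z' = 1 / (s * z)" "1 / (s * z') = s * z" "1 / (s\<^sup>2 * z') = z" "z' \<noteq> 0"
    using z s by (simp_all add: z'_def power2_eq_square)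
  consider "kf (1 / (s * z)) (s * \<zeta>L) \<noteq> 0" | "kf (s * z) (s * \<zeta>L) \<noteq> 0"
    | "kf (1 / (s * z)) (s * \<zeta>L) = 0" "kf (s * z) (s * \<zeta>L) = 0" by blast
  then show ?thesis
  proof cases
    case 1
    then show ?thesis using *[of z] nz L by blast
  next
    case 2
    have "0 \<notin> set (a @ [z'])" "L = length (a @ [z'])" using nz L z' by auto
    from *[OF this] 2 show ?thesis unfolding z' by (simp add: z'_def)
  qed simp
qed

lemma right_reflect_opening:
  assumes qkz: "qKZ_right s \<Psi>" and nz: "\<zeta>0 \<noteq> 0" "\<zeta>L \<noteq> 0" "0 \<notin> set (a @ [z])" and L: "L = length (a @ [z])"
    and k: "kf (1 / (s * z)) (s * \<zeta>L) \<noteq> 0"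
  shows "kf (s * z) (s * \<zeta>L) * \<Psi> L (a @ [z]) \<zeta>0 \<zeta>L (replicate L Opening) + br (1 / q0) * br ((s * z)\<^sup>2)
         * (\<Psi> L (a @ [z]) \<zeta>0 \<zeta>L (replicate L Opening) + \<Psi> L (a @ [z]) \<zeta>0 \<zeta>L (replicate (L - 1) Opening @ [Closing]))
       = kf (1 / (s * z)) (s * \<zeta>L) * \<Psi> L (a @ [1 / (s\<^sup>2 * z)]) \<zeta>0 \<zeta>L (replicate L Opening)"
proof -
  have "1 \<le> L" using L by simp
  show ?thesis
    using right_op[OF assms, of Opening] k by (simp add: K_op_def tl_gen_right_opening[OF \<open>1 \<le> L\<close>] field_simps)
qed

section \<open>The recursions at the extremal patterns\<close>

lemma fuse_opening:
  assumes rec: "bulk_recursion \<Psi>" and nz: "\<zeta>0 \<noteq> 0" "\<zeta>L \<noteq> 0" "0 \<notin> set a" "x \<noteq> 0"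
  shows "\<Psi> (length a + 2) (a @ [x, q0 * x]) \<zeta>0 \<zeta>L (replicate (length a + 1) Opening @ [Closing])
    = (kf x \<zeta>0)\<^sup>2 * (kf x \<zeta>L)\<^sup>2 * (\<Prod>y\<leftarrow>a. kf x y ^ 4) * \<Psi> (length a) a \<zeta>0 \<zeta>L (replicate (length a) Opening)"
proof -
  define n where "n = length a"
  define zs where "zs = a @ [x, q0 * x]"
  define \<alpha> where "\<alpha> = replicate n Opening"
  define i where "i = n + 1"
  have zs: "zs ! i = q0 * zs ! (i - 1)" "zs ! (i - 1) = x" "take (i - 1) zs @ drop (i + 1) zs = a"
    by (simp_all add: zs_def i_def n_def nth_append)
  have arc: "insert_arc i \<alpha> = replicate (n + 1) Opening @ [Closing]"
    unfolding add_0_right add_Suc_right One_nat_def replicate_Suc_snoc by (simp add: insert_arc_def \<alpha>_def i_def)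
  have "args (n + 2) zs \<zeta>0 \<zeta>L" "1 \<le> i" "i + 1 \<le> n + 2" "insert_arc i \<alpha> \<in> LP (n + 2)"
    using nz q0_neq by (auto simp: args_def zs_def n_def i_def LP_def insert_arc_def \<alpha>_def)
  then have "\<Psi> (n + 2) zs \<zeta>0 \<zeta>L (insert_arc i \<alpha>) = p_factor (n + 2) i zs \<zeta>0 \<zeta>L
      * phi (n + 2) i (\<Psi> (n + 2 - 2) (take (i - 1) zs @ drop (i + 1) zs) \<zeta>0 \<zeta>L) (insert_arc i \<alpha>)"
    using rec zs(1) unfolding bulk_recursion_def by blast
  also have "phi (n + 2) i (\<Psi> (n + 2 - 2) (take (i - 1) zs @ drop (i + 1) zs) \<zeta>0 \<zeta>L) (insert_arc i \<alpha>)
      = \<Psi> n a \<zeta>0 \<zeta>L \<alpha>"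
    unfolding zs by (subst phi_insert) (auto simp: \<alpha>_def i_def)
  also have "p_factor (n + 2) i zs \<zeta>0 \<zeta>L = (kf x \<zeta>0)\<^sup>2 * (kf x \<zeta>L)\<^sup>2 * (\<Prod>y\<leftarrow>a. kf x y ^ 4)"
  proof -
    have "{1..n + 2} - {i, i + 1} = Suc ` {..<n}"
      unfolding image_Suc_lessThan by (auto simp: i_def)
    then have "(\<Prod>j\<in>{1..n + 2} - {i, i + 1}. kf x (zs ! (j - 1)) ^ 4) = (\<Prod>j<n. kf x (a ! j) ^ 4)"
      by (simp add: prod.reindex zs_def n_def nth_append)
    then show ?thesis unfolding p_factor_def Let_def zs(2)
      by (simp add: prod.list_conv_set_nth n_def atLeast0LessThan)
  qed
  finally show ?thesis unfolding arc by (simp add: zs_def n_def \<alpha>_def)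
qed

lemma fuse_closing:
  assumes rec: "bulk_recursion \<Psi>" and nz: "\<zeta>0 \<noteq> 0" "\<zeta>L \<noteq> 0" "0 \<notin> set b" "x \<noteq> 0"
  shows "\<Psi> (length b + 2) (x # q0 * x # b) \<zeta>0 \<zeta>L (Opening # replicate (length b + 1) Closing)
    = (kf x \<zeta>0)\<^sup>2 * (kf x \<zeta>L)\<^sup>2 * (\<Prod>y\<leftarrow>b. kf x y ^ 4) * \<Psi> (length b) b \<zeta>0 \<zeta>L (replicate (length b) Closing)"
proof -
  define n where "n = length b"
  define zs where "zs = x # q0 * x # b"
  define \<alpha> where "\<alpha> = replicate n Closing"
  have zs: "zs ! 1 = q0 * zs ! (1 - 1)" "zs ! (1 - 1) = x" "take (1 - 1) zs @ drop (1 + 1) zs = b"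
    by (simp_all add: zs_def)
  have arc: "insert_arc 1 \<alpha> = Opening # replicate (n + 1) Closing"
    by (simp add: insert_arc_def \<alpha>_def)
  have "args (n + 2) zs \<zeta>0 \<zeta>L" "1 \<le> (1 :: nat)" "1 + 1 \<le> n + 2" "insert_arc 1 \<alpha> \<in> LP (n + 2)"
    using nz q0_neq by (auto simp: args_def zs_def n_def LP_def insert_arc_def \<alpha>_def)
  then have "\<Psi> (n + 2) zs \<zeta>0 \<zeta>L (insert_arc 1 \<alpha>) = p_factor (n + 2) 1 zs \<zeta>0 \<zeta>L
      * phi (n + 2) 1 (\<Psi> (n + 2 - 2) (take (1 - 1) zs @ drop (1 + 1) zs) \<zeta>0 \<zeta>L) (insert_arc 1 \<alpha>)"
    using rec zs(1) unfolding bulk_recursion_def by blast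
  also have "phi (n + 2) 1 (\<Psi> (n + 2 - 2) (take (1 - 1) zs @ drop (1 + 1) zs) \<zeta>0 \<zeta>L) (insert_arc 1 \<alpha>)
      = \<Psi> n b \<zeta>0 \<zeta>L \<alpha>"
    unfolding zs by (subst phi_insert) (auto simp: \<alpha>_def)
  also have "p_factor (n + 2) 1 zs \<zeta>0 \<zeta>L = (kf x \<zeta>0)\<^sup>2 * (kf x \<zeta>L)\<^sup>2 * (\<Prod>y\<leftarrow>b. kf x y ^ 4)"
  proof -
    have "{1..n + 2} - {1, 1 + 1} = (\<lambda>j. j + 3) ` {..<n}"
    proof (intro equalityI subsetI)
      fix j assume "j \<in> {1..n + 2} - {1, 1 + 1}"
      then have "3 \<le> j" "j \<le> n + 2" by auto
      then have "j = (j - 3) + 3" "j - 3 \<in> {..<n}" by auto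
      then show "j \<in> (\<lambda>j. j + 3) ` {..<n}" by (rule image_eqI)
    qed auto
    then have "(\<Prod>j\<in>{1..n + 2} - {1, 1 + 1}. kf x (zs ! (j - 1)) ^ 4) = (\<Prod>j<n. kf x (b ! j) ^ 4)"
      by (simp add: prod.reindex inj_on_def zs_def numeral_3_eq_3)
    then show ?thesis unfolding p_factor_def Let_def zs(2)
      by (simp add: prod.list_conv_set_nth n_def atLeast0LessThan)
  qed
  finally show ?thesis unfolding arc by (simp add: zs_def n_def \<alpha>_def)
qed

lemma right_recursion_opening:
  assumes rec: "right_recursion s \<Psi>" and nz: "\<zeta>0 \<noteq> 0" "\<zeta>L \<noteq> 0" "0 \<notin> set a"
  shows "\<Psi> (Suc (length a)) (a @ [\<zeta>L / q0]) \<zeta>0 \<zeta>L (replicate (Suc (length a)) Opening)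
    = - s\<^sup>2 * kf (1 / (s * \<zeta>L)) (s * \<zeta>0) * (\<Prod>y\<leftarrow>a. (kf (1 / (s * \<zeta>L)) (s * y))\<^sup>2)
      * \<Psi> (length a) a \<zeta>0 (\<zeta>L / q0) (replicate (length a) Opening)"
proof -
  define n where "n = length a"
  define zs where "zs = a @ [\<zeta>L / q0]"
  have "args (Suc n) zs \<zeta>0 \<zeta>L" "1 \<le> Suc n" "zs ! (Suc n - 1) = \<zeta>L / q0"
    "replicate (Suc n) Opening \<in> LP (Suc n)"
    using nz q0_neq by (auto simp: args_def zs_def n_def LP_def)
  then have "\<Psi> (Suc n) zs \<zeta>0 \<zeta>L (replicate (Suc n) Opening) = r_right s (Suc n) zs \<zeta>0 \<zeta>L
    * phi_right (Suc n) (\<Psi> (Suc n - 1) (butlast zs) \<zeta>0 (\<zeta>L / q0)) (replicate (Suc n) Opening)"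
    using rec unfolding right_recursion_def by blast
  also have "phi_right (Suc n) (\<Psi> (Suc n - 1) (butlast zs) \<zeta>0 (\<zeta>L / q0)) (replicate (Suc n) Opening)
     = \<Psi> n a \<zeta>0 (\<zeta>L / q0) (replicate n Opening)"
    using phi_right_snoc[of "replicate n Opening" "Suc n"] by (simp add: zs_def replicate_append_same)
  also have "r_right s (Suc n) zs \<zeta>0 \<zeta>L
     = - s\<^sup>2 * kf (1 / (s * \<zeta>L)) (s * \<zeta>0) * (\<Prod>y\<leftarrow>a. (kf (1 / (s * \<zeta>L)) (s * y))\<^sup>2)"
  proof -
    have "{1..Suc n - 1} = Suc ` {..<n}" by (simp add: image_Suc_lessThan)
    then have "(\<Prod>i\<in>{1..Suc n - 1}. (kf (1 / (s * \<zeta>L)) (s * zs ! (i - 1)))\<^sup>2) = (\<Prod>i<n. (kf (1 / (s * \<zeta>L)) (s * a ! i))\<^sup>2)"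
      by (simp add: prod.reindex zs_def n_def nth_append del: prod.lessThan_Suc)
    then show ?thesis unfolding r_right_def by (simp add: prod.list_conv_set_nth n_def atLeast0LessThan)
  qed
  finally show ?thesis by (simp add: zs_def n_def)
qed

lemma left_recursion_closing:
  assumes rec: "left_recursion \<Psi>" and nz: "\<zeta>0 \<noteq> 0" "\<zeta>L \<noteq> 0" "0 \<notin> set b"
  shows "\<Psi> (Suc (length b)) (q0 * \<zeta>0 # b) \<zeta>0 \<zeta>L (replicate (Suc (length b)) Closing)
    = - kf \<zeta>0 \<zeta>L * (\<Prod>y\<leftarrow>b. (kf \<zeta>0 y)\<^sup>2) * \<Psi> (length b) b (q0 * \<zeta>0) \<zeta>L (replicate (length b) Closing)"
proof -
  define n where "n = length b"
  define zs where "zs = q0 * \<zeta>0 # b"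
  have "args (Suc n) zs \<zeta>0 \<zeta>L" "1 \<le> Suc n" "zs ! 0 = q0 * \<zeta>0"
    "replicate (Suc n) Closing \<in> LP (Suc n)"
    using nz q0_neq by (auto simp: args_def zs_def n_def LP_def)
  then have "\<Psi> (Suc n) zs \<zeta>0 \<zeta>L (replicate (Suc n) Closing) = r_left (Suc n) zs \<zeta>0 \<zeta>L
    * phi_left (Suc n) (\<Psi> (Suc n - 1) (tl zs) (q0 * \<zeta>0) \<zeta>L) (replicate (Suc n) Closing)"
    using rec unfolding left_recursion_def by blast
  also have "phi_left (Suc n) (\<Psi> (Suc n - 1) (tl zs) (q0 * \<zeta>0) \<zeta>L) (replicate (Suc n) Closing)
     = \<Psi> n b (q0 * \<zeta>0) \<zeta>L (replicate n Closing)"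
    using phi_left_Cons[of "replicate n Closing" "Suc n"] by (simp add: zs_def)
  also have "r_left (Suc n) zs \<zeta>0 \<zeta>L = - kf \<zeta>0 \<zeta>L * (\<Prod>y\<leftarrow>b. (kf \<zeta>0 y)\<^sup>2)"
  proof -
    have "{2..Suc n} = (\<lambda>i. Suc (Suc i)) ` {..<n}"
      using image_Suc_lessThan[of n] by (simp flip: image_image add: numeral_2_eq_2)
    then have "(\<Prod>i\<in>{2..Suc n}. (kf \<zeta>0 (zs ! (i - 1)))\<^sup>2) = (\<Prod>i<n. (kf \<zeta>0 (b ! i))\<^sup>2)"
      by (simp add: prod.reindex inj_on_def zs_def)
    then show ?thesis unfolding r_left_def by (simp add: prod.list_conv_set_nth n_def atLeast0LessThan)
  qed
  finally show ?thesis by (simp add: zs_def n_def)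
qed

section \<open>Removal of the parameter s from the right boundary equation\<close>

lemma fourth_root_sq:
  assumes "s ^ 4 = (1 :: complex)"
  shows "s\<^sup>2 * s\<^sup>2 = 1" "s\<^sup>2 = 1 \<or> s\<^sup>2 = -1" "s \<noteq> 0"
proof -
  show *: "s\<^sup>2 * s\<^sup>2 = 1" using assms by (simp flip: power_add)
  then show "s\<^sup>2 = 1 \<or> s\<^sup>2 = -1" by (simp only: square_eq_1_iff)
  show "s \<noteq> 0" using assms by auto
qed

lemma br_sign: "a = 1 \<or> a = -1 \<Longrightarrow> br (a * x) = a * br x"
  by (auto simp: br_def)

text \<open>As s^2 is 1 or -1 and \<open>br\<close> is odd, the scaling only brings out a factor
  s^2. It is common to all terms of the right boundary equation.\<close>

lemma kf_scale:
  assumes s: "s ^ 4 = 1"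
  shows "kf (1 / (s * z)) (s * y) = s\<^sup>2 * kf (1 / z) y" "kf (s * z) (s * y) = s\<^sup>2 * kf z y"
proof -
  note s' = fourth_root_sq[OF s]
  have inv: "1 / s\<^sup>2 = s\<^sup>2" using s'(1,3) by (simp add: field_simps)
  have "1 / (s * z) / (q0 * (s * y)) = (1 / s\<^sup>2) * (1 / z / (q0 * y))" by (simp add: power2_eq_square)
  also have "\<dots> = s\<^sup>2 * (1 / z / (q0 * y))" by (simp only: inv)
  finally have 1: "1 / (s * z) / (q0 * (s * y)) = s\<^sup>2 * (1 / z / (q0 * y))" .
  have 2: "1 / (s * z) * (s * y) / q0 = 1 / z * y / q0" using s'(3) by simp
  have 3: "s * z / (q0 * (s * y)) = z / (q0 * y)" using s'(3) by simp
  have 4: "s * z * (s * y) / q0 = s\<^sup>2 * (z * y / q0)" by (simp add: power2_eq_square)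
  show "kf (1 / (s * z)) (s * y) = s\<^sup>2 * kf (1 / z) y"
    unfolding kf_def 1 2 br_sign[OF s'(2)] by (simp only: mult.assoc)
  show "kf (s * z) (s * y) = s\<^sup>2 * kf z y"
    unfolding kf_def 3 4 br_sign[OF s'(2)] by (simp only: mult.left_commute)
qed

lemma sq_scale:
  fixes s :: complex
  assumes s: "s ^ 4 = 1"
  shows "(1 / (s\<^sup>2 * z))\<^sup>2 = (1 / z)\<^sup>2"
proof -
  have "(1 / (s\<^sup>2 * z))\<^sup>2 = (1 / z)\<^sup>2 / (s\<^sup>2 * s\<^sup>2)" by (simp add: power_divide power_mult_distrib power2_eq_square)
  then show ?thesis by (simp only: fourth_root_sq(1)[OF s] div_by_1)
qed

text \<open>The component depends on the squares of the variables only, and 1/(s^2 z) has the same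
  square as 1/z. Together with \<open>kf_scale\<close> this turns the equation at the right boundary
  into the one without s.\<close>

lemma extremalI:
  assumes s: "s ^ 4 = 1" and nz: "\<zeta>0 \<noteq> 0" "\<zeta>L \<noteq> 0" and exch: "exchange \<zeta>0 f"
    and refl: "\<And>a z. 0 \<notin> set a \<Longrightarrow> z \<noteq> 0 \<Longrightarrow> kf (1 / (s * z)) (s * \<zeta>L) \<noteq> 0 \<Longrightarrow>
      kf (s * z) (s * \<zeta>L) * f (a @ [z]) + br (1 / q0) * br ((s * z)\<^sup>2) * (f (a @ [z]) + g (a @ [z]))
        = kf (1 / (s * z)) (s * \<zeta>L) * f (a @ [1 / (s\<^sup>2 * z)])"
    and fuse: "\<And>a x. 0 \<notin> set a \<Longrightarrow> x \<noteq> 0 \<Longrightarrow>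
      g (a @ [x, q0 * x]) = (kf x \<zeta>0)\<^sup>2 * (kf x \<zeta>L)\<^sup>2 * (\<Prod>y\<leftarrow>a. kf x y ^ 4) * f a"
    and laur: "\<And>N. 1 \<le> N \<Longrightarrow> \<exists>F. laurent_poly N (2 * int N - 1) F \<and>
      (\<forall>zs. length zs = N \<longrightarrow> 0 \<notin> set zs \<longrightarrow> f zs = F (map (\<lambda>z. z\<^sup>2) zs))"
  shows "extremal \<zeta>0 \<zeta>L f g"
proof
  note s' = fourth_root_sq[OF s]
  fix a :: "complex list" and z :: complex assume a: "0 \<notin> set a" "z \<noteq> 0" "kf (1 / z) \<zeta>L \<noteq> 0"
  obtain F where F: "\<And>zs. length zs = Suc (length a) \<Longrightarrow> 0 \<notin> set zs \<Longrightarrow> f zs = F (map (\<lambda>z. z\<^sup>2) zs)"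
    using laur[of "Suc (length a)"] by auto
  have f: "f (a @ [1 / (s\<^sup>2 * z)]) = f (a @ [1 / z])"
    using F[of "a @ [1 / (s\<^sup>2 * z)]"] F[of "a @ [1 / z]"] a s' sq_scale[OF s, of z] by simp
  have b: "br ((s * z)\<^sup>2) = s\<^sup>2 * br (z\<^sup>2)" by (simp only: power_mult_distrib br_sign[OF s'(2)])
  have "kf (1 / (s * z)) (s * \<zeta>L) \<noteq> 0" using a s' by (simp add: kf_scale[OF s])
  from refl[OF a(1,2) this]
  have "s\<^sup>2 * (kf z \<zeta>L * f (a @ [z]) + br (1 / q0) * br (z\<^sup>2) * (f (a @ [z]) + g (a @ [z])))
      = s\<^sup>2 * (kf (1 / z) \<zeta>L * f (a @ [1 / z]))"
    unfolding kf_scale[OF s] b f by (simp add: algebra_simps)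
  then show "kf z \<zeta>L * f (a @ [z]) + br (1 / q0) * br (z\<^sup>2) * (f (a @ [z]) + g (a @ [z]))
      = kf (1 / z) \<zeta>L * f (a @ [1 / z])"
    using s'(3) by simp
qed (use assms in auto)

lemma extremal_opening:
  assumes s: "s ^ 4 = 1" and qkz: "qKZ s \<Psi>" and laur: "laurent_components \<Psi>" and rec: "bulk_recursion \<Psi>"
    and nz: "\<zeta>0 \<noteq> 0" "\<zeta>L \<noteq> 0"
  shows "extremal \<zeta>0 \<zeta>L (\<lambda>zs. \<Psi> (length zs) zs \<zeta>0 \<zeta>L (replicate (length zs) Opening))
    (\<lambda>zs. \<Psi> (length zs) zs \<zeta>0 \<zeta>L (replicate (length zs - 1) Opening @ [Closing]))"
proof (rule extremalI[OF s nz])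
  show "exchange \<zeta>0 (\<lambda>zs. \<Psi> (length zs) zs \<zeta>0 \<zeta>L (replicate (length zs) Opening))"
    unfolding exchange_def
  proof (intro conjI allI impI)
    fix a b :: "complex list" and x y :: complex assume "0 \<notin> set (a @ x # y # b)"
    then show "br (q0 * y / x) * \<Psi> (length (a @ x # y # b)) (a @ x # y # b) \<zeta>0 \<zeta>L (replicate (length (a @ x # y # b)) Opening)
      = br (q0 * x / y) * \<Psi> (length (a @ y # x # b)) (a @ y # x # b) \<zeta>0 \<zeta>L (replicate (length (a @ y # x # b)) Opening)"
      using bulk_exchange[of \<Psi> \<zeta>0 \<zeta>L a x y b "length (a @ x # y # b)" Opening] qkz nz
      by (simp add: qKZ_def del: replicate_Suc)
  next
    fix b :: "complex list" and x :: complex assume "0 \<notin> set (x # b)"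
    then show "kf (1 / x) \<zeta>0 * \<Psi> (length (x # b)) (x # b) \<zeta>0 \<zeta>L (replicate (length (x # b)) Opening)
      = kf x \<zeta>0 * \<Psi> (length (1 / x # b)) (1 / x # b) \<zeta>0 \<zeta>L (replicate (length (1 / x # b)) Opening)"
      using left_exchange_opening[of \<Psi> \<zeta>0 \<zeta>L x b] qkz nz by (simp add: qKZ_def del: replicate_Suc)
  qed
next
  fix a :: "complex list" and z :: complex assume "0 \<notin> set a" "z \<noteq> 0" "kf (1 / (s * z)) (s * \<zeta>L) \<noteq> 0"
  then show "kf (s * z) (s * \<zeta>L) * \<Psi> (length (a @ [z])) (a @ [z]) \<zeta>0 \<zeta>L (replicate (length (a @ [z])) Opening)
    + br (1 / q0) * br ((s * z)\<^sup>2) * (\<Psi> (length (a @ [z])) (a @ [z]) \<zeta>0 \<zeta>L (replicate (length (a @ [z])) Opening)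
      + \<Psi> (length (a @ [z])) (a @ [z]) \<zeta>0 \<zeta>L (replicate (length (a @ [z]) - 1) Opening @ [Closing]))
    = kf (1 / (s * z)) (s * \<zeta>L) * \<Psi> (length (a @ [1 / (s\<^sup>2 * z)])) (a @ [1 / (s\<^sup>2 * z)]) \<zeta>0 \<zeta>L
        (replicate (length (a @ [1 / (s\<^sup>2 * z)])) Opening)"
    using right_reflect_opening[of s \<Psi> \<zeta>0 \<zeta>L a z] qkz nz by (simp add: qKZ_def del: replicate_Suc)
next
  fix a :: "complex list" and x :: complex assume "0 \<notin> set a" "x \<noteq> 0"
  then show "\<Psi> (length (a @ [x, q0 * x])) (a @ [x, q0 * x]) \<zeta>0 \<zeta>L (replicate (length (a @ [x, q0 * x]) - 1) Opening @ [Closing])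
    = (kf x \<zeta>0)\<^sup>2 * (kf x \<zeta>L)\<^sup>2 * (\<Prod>y\<leftarrow>a. kf x y ^ 4) * \<Psi> (length a) a \<zeta>0 \<zeta>L (replicate (length a) Opening)"
    using fuse_opening[OF rec nz, of a x] by (simp del: replicate_Suc)
next
  fix N :: nat assume "1 \<le> N"
  have "replicate N Opening \<in> LP N" by (simp add: LP_def)
  then obtain g where g: "laurent_poly N (2 * int N - 1) g"
    "\<And>zs. args N zs \<zeta>0 \<zeta>L \<Longrightarrow> \<Psi> N zs \<zeta>0 \<zeta>L (replicate N Opening) = g (map (\<lambda>z. z\<^sup>2) zs)"
    using laur nz unfolding laurent_components_def by meson
  then show "\<exists>F. laurent_poly N (2 * int N - 1) F \<and> (\<forall>zs. length zs = N \<longrightarrow> 0 \<notin> set zs \<longrightarrow>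
      \<Psi> (length zs) zs \<zeta>0 \<zeta>L (replicate (length zs) Opening) = F (map (\<lambda>z. z\<^sup>2) zs))"
    using nz by (intro exI[of _ g]) (auto simp: args_def)
qed

section \<open>Reflection of the component at )...)\<close>

lemma laurent_poly_reflect:
  assumes G: "laurent_poly N d G" and c: "c \<noteq> 0"
  shows "laurent_poly N d (\<lambda>xs. b * G (map (\<lambda>x. c / x) (rev xs)))"
proof -
  define M where "M = {m. length m = N \<and> set m \<subseteq> {-d..d}}"
  obtain e where e: "\<And>xs. length xs = N \<Longrightarrow> 0 \<notin> set xs \<Longrightarrow> G xs = (\<Sum>m\<in>M. e m * laurent_monom m xs)"
    unfolding M_def by (rule laurent_polyE[OF G]) blast
  \<comment> \<open>Reversing and negating the exponents is an involution of the index set; it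
    matches reversal and inversion of the arguments.\<close>
  define \<rho> where "\<rho> m = map uminus (rev m)" for m :: "int list"
  define e' where "e' m = b * e (\<rho> m) * (\<Prod>i<N. c powi (- (m ! i)))" for m
  have \<rho>: "\<rho> m \<in> M" "\<rho> (\<rho> m) = m" if "m \<in> M" for m
    using that by (auto simp: M_def \<rho>_def rev_map comp_def)
  have mono: "laurent_monom (\<rho> m) (map (\<lambda>x. c / x) (rev xs))
      = (\<Prod>i<N. c powi (- (m ! i))) * (\<Prod>i<N. (xs ! i) powi (m ! i))"
    if xs: "length xs = N" and m: "m \<in> M" for m xs
  proof -
    have len: "length m = N" using m by (simp add: M_def)
    have "laurent_monom (\<rho> m) (map (\<lambda>x. c / x) (rev xs))
       = (\<Prod>i<N. (c / xs ! (N - 1 - i)) powi (- (m ! (N - 1 - i))))"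
      unfolding laurent_monom_def by (rule prod.cong) (use len xs in \<open>auto simp: \<rho>_def rev_nth\<close>)
    also have "\<dots> = (\<Prod>i<N. (c / xs ! i) powi (- (m ! i)))"
      by (rule prod.reindex_bij_witness[of _ "\<lambda>i. N - 1 - i" "\<lambda>i. N - 1 - i"]) auto
    also have "\<dots> = (\<Prod>i<N. c powi (- (m ! i)) * (xs ! i) powi (m ! i))"
      by (rule prod.cong, rule refl, simp only: power_int_divide_distrib power_int_minus) (simp add: divide_inverse)
    finally show ?thesis by (simp add: prod.distrib)
  qed
  have "b * G (map (\<lambda>x. c / x) (rev xs)) = (\<Sum>m\<in>M. e' m * (\<Prod>i<N. (xs ! i) powi (m ! i)))"
    if xs: "length xs = N" "0 \<notin> set xs" for xs
  proof -
    have "G (map (\<lambda>x. c / x) (rev xs)) = (\<Sum>m\<in>M. e m * laurent_monom m (map (\<lambda>x. c / x) (rev xs)))"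
      by (rule e) (use xs c in auto)
    also have "\<dots> = (\<Sum>m\<in>M. e (\<rho> m) * laurent_monom (\<rho> m) (map (\<lambda>x. c / x) (rev xs)))"
      by (rule sum.reindex_bij_witness[of _ \<rho> \<rho>]) (use \<rho> in auto)
    finally show ?thesis
      by (simp add: sum_distrib_left e'_def mono[OF xs(1)] mult_ac cong: sum.cong)
  qed
  then show ?thesis unfolding laurent_poly_def M_def by blast
qed

text \<open>The reflection \<open>z\<^sub>i \<mapsto> 1/(s z\<^sub>L\<^sub>+\<^sub>1\<^sub>-\<^sub>i)\<close> exchanges the two boundaries and turns the closing
  component into an opening one.\<close>

definition mir :: "complex \<Rightarrow> complex \<Rightarrow> complex" where
  "mir s x = 1 / (s * x)"

text \<open>The sign \<open>(s\<^sup>2) ^ length zs\<close> absorbs the factor s^2 that the left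
  recursion acquires under the reflection, so that it takes the form of the right recursion for
  (...(.\<close>

definition mirror_comp ::
  "complex \<Rightarrow> family \<Rightarrow> (nat \<Rightarrow> bracket list) \<Rightarrow> complex \<Rightarrow> complex \<Rightarrow> complex list \<Rightarrow> complex" where
  "mirror_comp s \<Psi> \<beta> \<zeta>0 \<zeta>L zs = (s\<^sup>2) ^ length zs
     * \<Psi> (length zs) (map (mir s) (rev zs)) (mir s \<zeta>L) (mir s \<zeta>0) (\<beta> (length zs))"

lemma mir_mir: "s \<noteq> 0 \<Longrightarrow> mir s (mir s x) = x"
  by (simp add: mir_def)

lemma mir_ne_0: "s \<noteq> 0 \<Longrightarrow> mir s x = 0 \<longleftrightarrow> x = 0"
  by (simp add: mir_def)

lemma mir_set: "s \<noteq> 0 \<Longrightarrow> 0 \<notin> set zs \<Longrightarrow> 0 \<notin> set (map (mir s) (rev zs))"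
  by (auto simp: mir_def)

lemma kf_mir: 
  assumes "s ^ 4 = 1" "z \<noteq> 0" "y \<noteq> 0"
  shows "kf z (mir s y) = kf z (s * y)" "kf (mir s z) (mir s y) = s\<^sup>2 * kf (1 / z) y"
    "kf (mir s (q0 * z)) (mir s y) = s\<^sup>2 * kf z y"
proof -
  have s: "s \<noteq> 0" using fourth_root_sq assms by blast
  have *: "kf z (mir s y) = kf z (s * y)" if "z \<noteq> 0" for z
    unfolding mir_def using that assms s by (intro kf_sym_args) auto
  have **: "kf (mir s z) (mir s y) = s\<^sup>2 * kf (1 / z) y" if "z \<noteq> 0" for z
    using *[of "mir s z"] kf_scale(1)[OF assms(1), of z y] that s by (simp add: mir_def)
  show "kf z (mir s y) = kf z (s * y)" "kf (mir s z) (mir s y) = s\<^sup>2 * kf (1 / z) y"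
    using * ** assms by blast+
  show "kf (mir s (q0 * z)) (mir s y) = s\<^sup>2 * kf z y"
    using **[of "q0 * z"] kf_sym_args(2)[of z y] assms q0_neq by simp
qed

text \<open>Reversal and inversion compensate in the bulk: q \<open>mir s x\<close> /
  \<open>mir s y\<close> = q y / x. The right boundary equation, where the generator cannot produce
  )...), becomes the inversion relation at the left.\<close>

lemma exchange_closing:
  assumes s: "s ^ 4 = 1" and qkz: "qKZ s \<Psi>" and nz: "\<zeta>0 \<noteq> 0" "\<zeta>L \<noteq> 0"
  shows "exchange \<zeta>0 (mirror_comp s \<Psi> (\<lambda>L. replicate L Closing) \<zeta>0 \<zeta>L)"
  unfolding exchange_def
proof (intro conjI allI impI)
  note s' = fourth_root_sq[OF s]
  fix a b :: "complex list" and x y :: complex assume 0: "0 \<notin> set (a @ x # y # b)"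
  define A B where "A = map (mir s) (rev a)" and "B = map (mir s) (rev b)"
  define L where "L = length a + length b + 2"
  have xy: "x \<noteq> 0" "y \<noteq> 0" using 0 by auto
  have AB: "0 \<notin> set (B @ mir s y # mir s x # A)" using mir_set[OF s'(3) 0] by (simp add: A_def B_def)
  have "q0 * mir s x / mir s y = q0 * y / x" "q0 * mir s y / mir s x = q0 * x / y"
    using s'(3) xy by (simp_all add: mir_def field_simps)
  then have "br (q0 * y / x) * \<Psi> L (B @ mir s y # mir s x # A) (mir s \<zeta>L) (mir s \<zeta>0) (replicate L Closing)
    = br (q0 * x / y) * \<Psi> L (B @ mir s x # mir s y # A) (mir s \<zeta>L) (mir s \<zeta>0) (replicate L Closing)"
    using bulk_exchange[of \<Psi> "mir s \<zeta>L" "mir s \<zeta>0" B "mir s y" "mir s x" A L Closing] AB qkz nz s'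
    by (simp add: qKZ_def mir_ne_0 L_def A_def B_def)
  then show "br (q0 * y / x) * mirror_comp s \<Psi> (\<lambda>L. replicate L Closing) \<zeta>0 \<zeta>L (a @ x # y # b)
    = br (q0 * x / y) * mirror_comp s \<Psi> (\<lambda>L. replicate L Closing) \<zeta>0 \<zeta>L (a @ y # x # b)"
    by (simp add: mirror_comp_def A_def B_def L_def mult.left_commute)
next
  note s' = fourth_root_sq[OF s]
  fix x :: complex and b :: "complex list" assume 0: "0 \<notin> set (x # b)"
  define B where "B = map (mir s) (rev b)"
  define L where "L = Suc (length b)"
  have x: "x \<noteq> 0" using 0 by auto
  have B: "0 \<notin> set (B @ [mir s x])" using mir_set[OF s'(3) 0] by (simp add: B_def)
  have m: "1 / (s * mir s x) = x" "s * mir s x = 1 / x" "1 / (s\<^sup>2 * mir s x) = mir s (1 / x)" "s * mir s \<zeta>0 = 1 / \<zeta>0"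
    using s'(3) x nz by (simp_all add: mir_def power2_eq_square)
  have "kf x (1 / \<zeta>0) * \<Psi> L (B @ [mir s (1 / x)]) (mir s \<zeta>L) (mir s \<zeta>0) (replicate L Closing)
    = kf (1 / x) (1 / \<zeta>0) * \<Psi> L (B @ [mir s x]) (mir s \<zeta>L) (mir s \<zeta>0) (replicate L Closing)"
    using right_exchange_closing[of s \<Psi> "mir s \<zeta>L" "mir s \<zeta>0" B "mir s x" L] B qkz nz s'(3)
    unfolding m by (simp add: qKZ_def mir_ne_0 L_def B_def)
  then show "kf (1 / x) \<zeta>0 * mirror_comp s \<Psi> (\<lambda>L. replicate L Closing) \<zeta>0 \<zeta>L (x # b)
    = kf x \<zeta>0 * mirror_comp s \<Psi> (\<lambda>L. replicate L Closing) \<zeta>0 \<zeta>L (1 / x # b)"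
    using kf_sym_args(1)[of x \<zeta>0] kf_sym_args(1)[of "1 / x" \<zeta>0] x nz
    by (simp add: mirror_comp_def B_def L_def mult.left_commute)
qed

text \<open>The roles of the ends are exchanged: the left boundary equation supplies the reflection
  and the pair at sites 1, 2 the fusion. The signs s^2 disappear from the fusion because its weights
  occur to even powers.\<close>

lemma extremal_closing:
  assumes s: "s ^ 4 = 1" and qkz: "qKZ s \<Psi>" and laur: "laurent_components \<Psi>" and rec: "bulk_recursion \<Psi>"
    and nz: "\<zeta>0 \<noteq> 0" "\<zeta>L \<noteq> 0"
  shows "extremal \<zeta>0 \<zeta>L (mirror_comp s \<Psi> (\<lambda>L. replicate L Closing) \<zeta>0 \<zeta>L)
    (mirror_comp s \<Psi> (\<lambda>L. Opening # replicate (L - 1) Closing) \<zeta>0 \<zeta>L)"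
proof (rule extremalI[OF s nz exchange_closing[OF s qkz nz]])
  note s' = fourth_root_sq[OF s]
  have mnz: "mir s \<zeta>0 \<noteq> 0" "mir s \<zeta>L \<noteq> 0" using nz s' by (simp_all add: mir_ne_0)
  fix a :: "complex list" and z :: complex assume a: "0 \<notin> set a" "z \<noteq> 0" "kf (1 / (s * z)) (s * \<zeta>L) \<noteq> 0"
  define A where "A = map (mir s) (rev a)"
  define L where "L = Suc (length a)"
  have A: "0 \<notin> set (mir s z # A)" "L = length (mir s z # A)"
    using mir_set[OF s'(3), of "a @ [z]"] a by (simp_all add: A_def L_def)
  have m: "1 / mir s z = s * z" "mir s (1 / (s\<^sup>2 * z)) = s * z" using s'(3) by (simp_all add: mir_def power2_eq_square)
  have k: "kf (mir s z) (mir s \<zeta>L) = kf (1 / (s * z)) (s * \<zeta>L)" "kf (s * z) (mir s \<zeta>L) = kf (s * z) (s * \<zeta>L)"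
    using kf_mir(1)[OF s, of "mir s z" \<zeta>L] kf_mir(1)[OF s, of "s * z" \<zeta>L] a nz s' by (simp_all add: mir_def)
  have "qKZ_left \<Psi>" using qkz by (simp add: qKZ_def)
  define p where "p = (s\<^sup>2) ^ L"
  define h1 h2 h3 where "h1 = \<Psi> L (mir s z # A) (mir s \<zeta>L) (mir s \<zeta>0) (replicate L Closing)"
    and "h2 = \<Psi> L (mir s z # A) (mir s \<zeta>L) (mir s \<zeta>0) (Opening # replicate (L - 1) Closing)"
    and "h3 = \<Psi> L (s * z # A) (mir s \<zeta>L) (mir s \<zeta>0) (replicate L Closing)"
  have "kf (mir s z) (mir s \<zeta>L) \<noteq> 0" unfolding k by (rule a(3))
  from left_reflect_closing[OF \<open>qKZ_left \<Psi>\<close> mnz(2,1) A this]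
  have e: "kf (s * z) (s * \<zeta>L) * h1 + br (1 / q0) * br ((s * z)\<^sup>2) * (h1 + h2) = kf (1 / (s * z)) (s * \<zeta>L) * h3"
    unfolding m k by (simp only: h1_def h2_def h3_def)
  have c: "mirror_comp s \<Psi> (\<lambda>L. replicate L Closing) \<zeta>0 \<zeta>L (a @ [z]) = p * h1"
    "mirror_comp s \<Psi> (\<lambda>L. Opening # replicate (L - 1) Closing) \<zeta>0 \<zeta>L (a @ [z]) = p * h2"
    "mirror_comp s \<Psi> (\<lambda>L. replicate L Closing) \<zeta>0 \<zeta>L (a @ [1 / (s\<^sup>2 * z)]) = p * h3"
    by (simp_all add: mirror_comp_def h1_def h2_def h3_def p_def A_def L_def m(2) del: replicate_Suc)
  have "p * (kf (s * z) (s * \<zeta>L) * h1 + br (1 / q0) * br ((s * z)\<^sup>2) * (h1 + h2)) = p * (kf (1 / (s * z)) (s * \<zeta>L) * h3)"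
    by (simp only: e)
  then show "kf (s * z) (s * \<zeta>L) * mirror_comp s \<Psi> (\<lambda>L. replicate L Closing) \<zeta>0 \<zeta>L (a @ [z])
    + br (1 / q0) * br ((s * z)\<^sup>2) * (mirror_comp s \<Psi> (\<lambda>L. replicate L Closing) \<zeta>0 \<zeta>L (a @ [z])
      + mirror_comp s \<Psi> (\<lambda>L. Opening # replicate (L - 1) Closing) \<zeta>0 \<zeta>L (a @ [z]))
    = kf (1 / (s * z)) (s * \<zeta>L) * mirror_comp s \<Psi> (\<lambda>L. replicate L Closing) \<zeta>0 \<zeta>L (a @ [1 / (s\<^sup>2 * z)])"
    unfolding c by (simp only: distrib_left mult.left_commute)
next
  note s' = fourth_root_sq[OF s]
  have mnz: "mir s \<zeta>0 \<noteq> 0" "mir s \<zeta>L \<noteq> 0" using nz s' by (simp_all add: mir_ne_0)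
  fix a :: "complex list" and x :: complex assume a: "0 \<notin> set a" "x \<noteq> 0"
  define A where "A = map (mir s) (rev a)"
  \<comment> \<open>With this X the mirrored and reversed pair x, q x is X, q X, so that fusion
    applies to it.\<close>
  define X where "X = mir s (q0 * x)"
  have A: "0 \<notin> set A" "X \<noteq> 0" using mir_set[OF s'(3) a(1)] a q0_neq s' by (simp_all add: A_def X_def mir_ne_0)
  have qX: "q0 * X = mir s x" using q0_neq by (simp add: X_def mir_def)
  have kX: "kf X (mir s y) = s\<^sup>2 * kf x y" if "y \<noteq> 0" for y
    unfolding X_def using kf_mir(3)[OF s a(2) that] .
  have s2: "(s\<^sup>2) ^ 2 = 1" using s'(1) unfolding power2_eq_square[of "s\<^sup>2"] .
  moreover have "(s\<^sup>2) ^ 4 = ((s\<^sup>2) ^ 2) ^ 2" by (simp only: power_mult[symmetric]) simp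
  ultimately have s4: "(s\<^sup>2) ^ 4 = 1" by (simp only: power_one)
  have "(\<Prod>y\<leftarrow>rev a. h y) = (\<Prod>y\<leftarrow>a. h y)" for h :: "complex \<Rightarrow> complex"
    by (induction a) (simp_all add: mult.commute)
  then have "(\<Prod>y\<leftarrow>A. kf X y ^ 4) = (\<Prod>y\<leftarrow>a. kf X (mir s y) ^ 4)"
    by (simp add: A_def comp_def)
  also have "map (\<lambda>y. kf X (mir s y) ^ 4) a = map (\<lambda>y. kf x y ^ 4) a"
  proof (intro map_cong refl)
    fix y assume "y \<in> set a"
    then have "y \<noteq> 0" using a by auto
    then show "kf X (mir s y) ^ 4 = kf x y ^ 4" unfolding kX[OF \<open>y \<noteq> 0\<close>] power_mult_distrib s4 by simp
  qed
  finally have p: "(\<Prod>y\<leftarrow>A. kf X y ^ 4) = (\<Prod>y\<leftarrow>a. kf x y ^ 4)" .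
  define n where "n = length a"
  define h where "h = \<Psi> n A (mir s \<zeta>L) (mir s \<zeta>0) (replicate n Closing)"
  have n: "length A = n" by (simp add: A_def n_def)
  have e: "\<Psi> (n + 2) (X # q0 * X # A) (mir s \<zeta>L) (mir s \<zeta>0) (Opening # replicate (n + 1) Closing)
    = (kf x \<zeta>L)\<^sup>2 * (kf x \<zeta>0)\<^sup>2 * (\<Prod>y\<leftarrow>a. kf x y ^ 4) * h"
    using fuse_closing[OF rec mnz(2,1) A] unfolding p kX[OF nz(1)] kX[OF nz(2)] power_mult_distrib s2 n
    by (simp only: h_def mult_1)
  have "mirror_comp s \<Psi> (\<lambda>L. Opening # replicate (L - 1) Closing) \<zeta>0 \<zeta>L (a @ [x, q0 * x])
    = (s\<^sup>2) ^ (n + 2) * \<Psi> (n + 2) (X # q0 * X # A) (mir s \<zeta>L) (mir s \<zeta>0) (Opening # replicate (n + 1) Closing)"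
    unfolding qX by (simp add: mirror_comp_def n_def X_def A_def)
  also have "(s\<^sup>2) ^ (n + 2) = (s\<^sup>2) ^ n" by (simp only: power_add s2 mult_1_right)
  also note e
  also have "(s\<^sup>2) ^ n * ((kf x \<zeta>L)\<^sup>2 * (kf x \<zeta>0)\<^sup>2 * (\<Prod>y\<leftarrow>a. kf x y ^ 4) * h)
    = (kf x \<zeta>0)\<^sup>2 * (kf x \<zeta>L)\<^sup>2 * (\<Prod>y\<leftarrow>a. kf x y ^ 4) * ((s\<^sup>2) ^ n * h)"
    by (simp only: mult_ac)
  also have "(s\<^sup>2) ^ n * h = mirror_comp s \<Psi> (\<lambda>L. replicate L Closing) \<zeta>0 \<zeta>L a"
    by (simp add: mirror_comp_def h_def n_def A_def)
  finally show "mirror_comp s \<Psi> (\<lambda>L. Opening # replicate (L - 1) Closing) \<zeta>0 \<zeta>L (a @ [x, q0 * x])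
    = (kf x \<zeta>0)\<^sup>2 * (kf x \<zeta>L)\<^sup>2 * (\<Prod>y\<leftarrow>a. kf x y ^ 4) * mirror_comp s \<Psi> (\<lambda>L. replicate L Closing) \<zeta>0 \<zeta>L a" .
next
  note s' = fourth_root_sq[OF s]
  have mnz: "mir s \<zeta>0 \<noteq> 0" "mir s \<zeta>L \<noteq> 0" using nz s' by (simp_all add: mir_ne_0)
  fix N :: nat assume "1 \<le> N"
  have "replicate N Closing \<in> LP N" by (simp add: LP_def)
  then obtain g where g: "laurent_poly N (2 * int N - 1) g"
    "\<And>zs. args N zs (mir s \<zeta>L) (mir s \<zeta>0) \<Longrightarrow> \<Psi> N zs (mir s \<zeta>L) (mir s \<zeta>0) (replicate N Closing) = g (map (\<lambda>z. z\<^sup>2) zs)"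
    using laur mnz unfolding laurent_components_def by meson
  have "mirror_comp s \<Psi> (\<lambda>L. replicate L Closing) \<zeta>0 \<zeta>L zs
      = (s\<^sup>2) ^ N * g (map (\<lambda>x. (1 / s\<^sup>2) / x) (rev (map (\<lambda>z. z\<^sup>2) zs)))" if zs: "length zs = N" "0 \<notin> set zs" for zs
  proof -
    have "args N (map (mir s) (rev zs)) (mir s \<zeta>L) (mir s \<zeta>0)"
      using zs mnz mir_set[OF s'(3) zs(2)] by (simp add: args_def)
    moreover have "map (\<lambda>z. z\<^sup>2) (map (mir s) (rev zs)) = map (\<lambda>x. (1 / s\<^sup>2) / x) (rev (map (\<lambda>z. z\<^sup>2) zs))"
      by (simp add: rev_map comp_def mir_def power_divide power_mult_distrib)
    ultimately show ?thesis using g(2) zs(1) by (simp add: mirror_comp_def)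
  qed
  moreover have "laurent_poly N (2 * int N - 1) (\<lambda>xs. (s\<^sup>2) ^ N * g (map (\<lambda>x. (1 / s\<^sup>2) / x) (rev xs)))"
    by (rule laurent_poly_reflect[OF g(1)]) (use s' in auto)
  ultimately show "\<exists>F. laurent_poly N (2 * int N - 1) F \<and> (\<forall>zs. length zs = N \<longrightarrow> 0 \<notin> set zs \<longrightarrow>
      mirror_comp s \<Psi> (\<lambda>L. replicate L Closing) \<zeta>0 \<zeta>L zs = F (map (\<lambda>z. z\<^sup>2) zs))"
    by (intro exI[of _ "\<lambda>xs. (s\<^sup>2) ^ N * g (map (\<lambda>x. (1 / s\<^sup>2) / x) (rev xs))"]) blast
qed

section \<open>Normalisation in size 1\<close>

lemma tau_sum_three: "tau_sum [a, b, c] = a + b + c"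
proof -
  have c3: "cheb 3 = [:0, -2, 0, 1:]" by (simp add: numeral_3_eq_3 one_pCons)
  have t: "tau_poly 0 = 1" "tau_poly (Suc 0) = [:0, 1:]" "tau_poly (Suc (Suc 0)) = [:0, -2, 0, 1:]"
    using c3 by (simp_all add: tau_poly_def numeral_3_eq_3)
  have s1: "synthetic_div 1 x = 0" for x :: complex by (simp add: synthetic_div_eq_0_iff)
  \<comment> \<open>The matrix is triangular with diagonal 1, 1 and the second divided difference of
    y^3 - 2y, which is a + b + c.\<close>
  have "det (dd_mat tau_poly [a, b, c]) = prod_list (diag_mat (dd_mat tau_poly [a, b, c]))"
  proof (rule det_upper_triangular)
    show "upper_triangular (dd_mat tau_poly [a, b, c])"
      unfolding upper_triangular_def
      by (auto simp: dd_mat_def less_Suc_eq t s1)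
  qed (auto simp: dd_mat_def)
  also have "\<dots> = a + b + c"
    by (simp add: diag_mat_def dd_mat_def t upt_rec algebra_simps)
  finally show ?thesis by (simp add: tau_sum_def bialt_def)
qed

text \<open>The normalisation in size 1 follows from the right recursion either to size 0, or from size 2 at
  the shifted boundary parameter \<open>q\<zeta>\<^sub>L\<close>, unless both recursion factors vanish.\<close>

lemma normalisation_length_one:
  assumes ext: "\<And>\<zeta>. \<zeta> \<noteq> 0 \<Longrightarrow> extremal \<zeta>0 \<zeta> (\<phi> \<zeta>) (\<gamma> \<zeta>)" and init: "\<And>\<zeta>. \<zeta> \<noteq> 0 \<Longrightarrow> \<phi> \<zeta> [] = 1"
    and rec: "\<And>\<zeta> a. \<zeta> \<noteq> 0 \<Longrightarrow> 0 \<notin> set a \<Longrightarrow>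
      \<phi> \<zeta> (a @ [\<zeta> / q0]) = - kf (1 / \<zeta>) \<zeta>0 * (\<Prod>y\<leftarrow>a. (kf (1 / \<zeta>) y)\<^sup>2) * \<phi> (\<zeta> / q0) a"
    and \<sigma>: "\<And>z. z \<noteq> 0 \<Longrightarrow> \<phi> \<zeta>L [z] = - \<sigma> * kf z \<zeta>0" and nz: "\<zeta>0 \<noteq> 0" "\<zeta>L \<noteq> 0"
    and nondeg: "kf \<zeta>L \<zeta>0 \<noteq> 0 \<or> kf (1 / \<zeta>L) \<zeta>0 \<noteq> 0"
  shows "\<sigma> = 1"
  using nondeg
proof
  assume k: "kf (1 / \<zeta>L) \<zeta>0 \<noteq> 0"
  have "kf (\<zeta>L / q0) \<zeta>0 = kf (1 / \<zeta>L) \<zeta>0" using kf_sym_args(2)[of "1 / \<zeta>L" \<zeta>0] nz by simp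
  then have "\<sigma> * kf (1 / \<zeta>L) \<zeta>0 = kf (1 / \<zeta>L) \<zeta>0"
    using rec[OF nz(2), of "[]"] \<sigma>[of "\<zeta>L / q0"] init[of "\<zeta>L / q0"] nz q0_neq by simp
  then show "\<sigma> = 1" using k by simp
next
  assume k: "kf \<zeta>L \<zeta>0 \<noteq> 0"
  obtain z where "z \<notin> insert 0 (excluded \<zeta>0 \<zeta>L [])"
    using ex_new_if_finite[OF infinite_UNIV_char_0, of "insert 0 (excluded \<zeta>0 \<zeta>L [])"] finite_excluded by auto
  then have z: "z \<noteq> 0" and g: "generic \<zeta>0 \<zeta>L [z]"
    using generic_snoc[of \<zeta>0 \<zeta>L "[]" z] by (auto simp: generic_def)
  have kz: "kf z \<zeta>0 \<noteq> 0" "kf \<zeta>L z \<noteq> 0"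
    using kf_ne_0[of z \<zeta>0] kf_ne_0[of \<zeta>L z] g z nz generic_pair_sym[of z \<zeta>L] by (simp_all add: generic_def)
  have q: "q0 * \<zeta>L \<noteq> 0" "q0 * \<zeta>L / q0 = \<zeta>L" using nz q0_neq by simp_all
  \<comment> \<open>Even sizes descend from size 0 alone, so size 2 is known before size 1, for
    every right boundary parameter.\<close>
  have "\<phi> (q0 * \<zeta>L) [z, \<zeta>L] = ext_comp \<zeta>0 (q0 * \<zeta>L) [z, \<zeta>L]"
    by (rule extremal.even_length[OF ext[OF q(1)] init[OF q(1)], of _ 1]) (use z nz in auto)
  also have "\<dots> = - (kf z \<zeta>0 * kf \<zeta>L \<zeta>0 * kf \<zeta>L z * (sq_sum z + sq_sum \<zeta>L + sq_sum (q0 * \<zeta>L)))"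
    by (simp add: ext_comp_def ext_sym_def tau_sum_three tau_sum_short algebra_simps)
  also have "sq_sum z + sq_sum \<zeta>L + sq_sum (q0 * \<zeta>L) = - kf \<zeta>L z"
    using z nz by (simp add: kf_eq)
  finally have e: "\<phi> (q0 * \<zeta>L) [z, \<zeta>L] = kf z \<zeta>0 * kf \<zeta>L \<zeta>0 * (kf \<zeta>L z)\<^sup>2"
    by (simp add: power2_eq_square)
  have "\<phi> (q0 * \<zeta>L) [z, \<zeta>L] = - kf (1 / (q0 * \<zeta>L)) \<zeta>0 * (kf (1 / (q0 * \<zeta>L)) z)\<^sup>2 * \<phi> \<zeta>L [z]"
    using rec[OF q(1), of "[z]"] z unfolding q(2) by simp
  also have "\<dots> = \<sigma> * (kf z \<zeta>0 * kf \<zeta>L \<zeta>0 * (kf \<zeta>L z)\<^sup>2)"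
    unfolding \<sigma>[OF z] kf_sym_args(2)[OF nz(2,1)] kf_sym_args(2)[OF nz(2) z] by simp
  finally have "(kf z \<zeta>0 * kf \<zeta>L \<zeta>0 * (kf \<zeta>L z)\<^sup>2) = \<sigma> * (kf z \<zeta>0 * kf \<zeta>L \<zeta>0 * (kf \<zeta>L z)\<^sup>2)"
    unfolding e .
  then show "\<sigma> = 1" using k kz by simp
qed

lemma kf_sign_sq: 
  assumes "s ^ 4 = (1 :: complex)"
  shows "(s\<^sup>2 * x)\<^sup>2 = x\<^sup>2"
proof -
  have "(s\<^sup>2 * x)\<^sup>2 = (s\<^sup>2 * s\<^sup>2) * x\<^sup>2" by (simp add: power2_eq_square)
  then show ?thesis by (simp only: fourth_root_sq(1)[OF assms] mult_1)
qed

lemma opening_right_rec: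
  assumes s: "s ^ 4 = 1" and rec: "right_recursion s \<Psi>" and nz: "\<zeta>0 \<noteq> 0" "\<zeta> \<noteq> 0" "0 \<notin> set a"
  shows "\<Psi> (length (a @ [\<zeta> / q0])) (a @ [\<zeta> / q0]) \<zeta>0 \<zeta> (replicate (length (a @ [\<zeta> / q0])) Opening)
    = - kf (1 / \<zeta>) \<zeta>0 * (\<Prod>y\<leftarrow>a. (kf (1 / \<zeta>) y)\<^sup>2) * \<Psi> (length a) a \<zeta>0 (\<zeta> / q0) (replicate (length a) Opening)"
proof -
  have "- s\<^sup>2 * (s\<^sup>2 * kf (1 / \<zeta>) \<zeta>0) = - (s\<^sup>2 * s\<^sup>2) * kf (1 / \<zeta>) \<zeta>0" by simp
  then have "- s\<^sup>2 * (s\<^sup>2 * kf (1 / \<zeta>) \<zeta>0) = - kf (1 / \<zeta>) \<zeta>0" unfolding fourth_root_sq(1)[OF s] by simp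
  then show ?thesis
    using right_recursion_opening[OF rec nz] unfolding kf_scale[OF s] kf_sign_sq[OF s]
    by (simp del: replicate_Suc)
qed

lemma closing_right_rec:
  assumes s: "s ^ 4 = 1" and rec: "left_recursion \<Psi>" and nz: "\<zeta>0 \<noteq> 0" "\<zeta> \<noteq> 0" "0 \<notin> set a"
  shows "mirror_comp s \<Psi> (\<lambda>L. replicate L Closing) \<zeta>0 \<zeta> (a @ [\<zeta> / q0])
    = - kf (1 / \<zeta>) \<zeta>0 * (\<Prod>y\<leftarrow>a. (kf (1 / \<zeta>) y)\<^sup>2) * mirror_comp s \<Psi> (\<lambda>L. replicate L Closing) \<zeta>0 (\<zeta> / q0) a"
proof -
  note s' = fourth_root_sq[OF s]
  define n where "n = length a"
  define A where "A = map (mir s) (rev a)"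
  define h where "h = \<Psi> n A (q0 * mir s \<zeta>) (mir s \<zeta>0) (replicate n Closing)"
  have m: "mir s (\<zeta> / q0) = q0 * mir s \<zeta>" by (simp add: mir_def)
  have mnz: "mir s \<zeta> \<noteq> 0" "mir s \<zeta>0 \<noteq> 0" "0 \<notin> set A"
    using nz s' mir_set[OF s'(3) nz(3)] by (simp_all add: mir_ne_0 A_def)
  have n: "length A = n" by (simp add: A_def n_def)
  have "(\<Prod>y\<leftarrow>rev a. h y) = (\<Prod>y\<leftarrow>a. h y)" for h :: "complex \<Rightarrow> complex"
    by (induction a) (simp_all add: mult.commute)
  then have "(\<Prod>y\<leftarrow>A. (kf (mir s \<zeta>) y)\<^sup>2) = (\<Prod>y\<leftarrow>a. (kf (mir s \<zeta>) (mir s y))\<^sup>2)"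
    by (simp add: A_def comp_def)
  also have "map (\<lambda>y. (kf (mir s \<zeta>) (mir s y))\<^sup>2) a = map (\<lambda>y. (kf (1 / \<zeta>) y)\<^sup>2) a"
  proof (intro map_cong refl)
    fix y assume "y \<in> set a"
    then have "y \<noteq> 0" using nz by auto
    show "(kf (mir s \<zeta>) (mir s y))\<^sup>2 = (kf (1 / \<zeta>) y)\<^sup>2"
      unfolding kf_mir(2)[OF s nz(2) \<open>y \<noteq> 0\<close>] by (rule kf_sign_sq[OF s])
  qed
  finally have p: "(\<Prod>y\<leftarrow>A. (kf (mir s \<zeta>) y)\<^sup>2) = (\<Prod>y\<leftarrow>a. (kf (1 / \<zeta>) y)\<^sup>2)" .
  have "mirror_comp s \<Psi> (\<lambda>L. replicate L Closing) \<zeta>0 \<zeta> (a @ [\<zeta> / q0])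
    = (s\<^sup>2) ^ Suc n * \<Psi> (Suc n) (q0 * mir s \<zeta> # A) (mir s \<zeta>) (mir s \<zeta>0) (replicate (Suc n) Closing)"
    by (simp add: mirror_comp_def n_def A_def m)
  also have "\<Psi> (Suc n) (q0 * mir s \<zeta> # A) (mir s \<zeta>) (mir s \<zeta>0) (replicate (Suc n) Closing)
    = - (s\<^sup>2 * kf (1 / \<zeta>) \<zeta>0) * (\<Prod>y\<leftarrow>a. (kf (1 / \<zeta>) y)\<^sup>2) * h"
    using left_recursion_closing[OF rec mnz] unfolding n p kf_mir(2)[OF s nz(2,1)] by (simp only: h_def)
  also have "(s\<^sup>2) ^ Suc n * (- (s\<^sup>2 * kf (1 / \<zeta>) \<zeta>0) * (\<Prod>y\<leftarrow>a. (kf (1 / \<zeta>) y)\<^sup>2) * h)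
    = (s\<^sup>2 * s\<^sup>2) * (- kf (1 / \<zeta>) \<zeta>0 * (\<Prod>y\<leftarrow>a. (kf (1 / \<zeta>) y)\<^sup>2) * ((s\<^sup>2) ^ n * h))"
    by (simp add: mult_ac)
  also have "(s\<^sup>2) ^ n * h = mirror_comp s \<Psi> (\<lambda>L. replicate L Closing) \<zeta>0 (\<zeta> / q0) a"
    by (simp add: mirror_comp_def h_def n_def A_def m)
  finally show ?thesis by (simp only: s'(1) mult_1)
qed

text \<open>By \<open>kf_eq\<close> the weights are u or v minus a term in x or y, and the
  coefficient of the generator is v - u. With x = zeta_0 and y = zeta_L this is the right boundary
  equation in size 1 for the components -k(z, zeta_0) and -k(1/z, zeta_L).\<close>

lemma kf_reflection_identity:
  assumes "z \<noteq> 0" "x \<noteq> 0" "y \<noteq> 0"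
  shows "kf z y * kf z x + br (1 / q0) * br (z\<^sup>2) * (kf z x + kf (1 / z) y) = kf (1 / z) y * kf (1 / z) x"
proof -
  define u v where "u = - sq_sum z - sq_sum (q0 * z)" and "v = - sq_sum z - sq_sum (q0 / z)"
  have k: "kf z y = u - sq_sum y" "kf z x = u - sq_sum x" "kf (1 / z) y = v - sq_sum y" "kf (1 / z) x = v - sq_sum x"
    using assms by (simp_all add: kf_eq u_def v_def sq_sum_1_div)
  have "br (1 / q0) * br (z\<^sup>2) = (1 / q0 - q0) * (z\<^sup>2 - 1 / z\<^sup>2)" by (simp add: br_def)
  also have "\<dots> = (q0\<^sup>2 - q0) * (z\<^sup>2 - 1 / z\<^sup>2)" by (simp only: q0_inverse)
  also have "\<dots> = v - u"
  proof -
    have "sq_sum (q0 * z) = z\<^sup>2 * q0\<^sup>2 + (1 / q0\<^sup>2) / z\<^sup>2" "sq_sum (q0 / z) = q0\<^sup>2 / z\<^sup>2 + (1 / q0\<^sup>2) * z\<^sup>2"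
      by (simp_all add: sq_sum_def power_mult_distrib power_divide)
    then have "sq_sum (q0 * z) = z\<^sup>2 * q0\<^sup>2 + q0 / z\<^sup>2" "sq_sum (q0 / z) = q0\<^sup>2 / z\<^sup>2 + q0 * z\<^sup>2"
      by (simp_all only: q0_inverse)
    then show ?thesis by (simp add: u_def v_def algebra_simps diff_divide_distrib)
  qed
  finally have b: "br (1 / q0) * br (z\<^sup>2) = v - u" .
  show ?thesis unfolding k b by (simp add: algebra_simps)
qed

text \<open>If k(a, b) and k(1/a, b) both vanish, then a^4 = 1. Applied on both sides this gives x^4
  = y^4 = 1, and a zero of k(y, x) would then force q^4 = 1.\<close>

lemma kf_nondegenerate:
  assumes nz: "x \<noteq> 0" "y \<noteq> 0"
  shows "\<not> (kf y x = 0 \<and> kf (1 / y) x = 0 \<and> kf x y = 0 \<and> kf (1 / x) y = 0)"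
proof
  have sq: "(a\<^sup>2)\<^sup>2 = 1" if "a \<noteq> 0" "b \<noteq> 0" "kf a b = 0" "kf (1 / a) b = 0" for a b
  proof -
    \<comment> \<open>The identity is used at 1 and at q, two values with different
      \<open>sq_sum\<close>: the weights k(1/a, 1) and k(1/a, q) cannot both vanish, so
      \<open>br (a\<^sup>2)\<close> has to.\<close>
    have "kf a 1 * kf a b + br (1 / q0) * br (a\<^sup>2) * (kf a b + kf (1 / a) 1) = kf (1 / a) 1 * kf (1 / a) b"
      by (rule kf_reflection_identity) (use that in auto)
    then have 1: "br (1 / q0) * br (a\<^sup>2) * kf (1 / a) 1 = 0" using that by simp
    have "kf a q0 * kf a b + br (1 / q0) * br (a\<^sup>2) * (kf a b + kf (1 / a) q0) = kf (1 / a) q0 * kf (1 / a) b"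
      by (rule kf_reflection_identity) (use that q0_neq in auto)
    then have 2: "br (1 / q0) * br (a\<^sup>2) * kf (1 / a) q0 = 0" using that by simp
    have "kf (1 / a) 1 - kf (1 / a) q0 = sq_sum q0 - sq_sum 1" using that q0_neq by (simp add: kf_eq)
    also have "\<dots> = q0\<^sup>2 + q0 - 2" by (simp add: sq_sum_def q0_inverse)
    also have "\<dots> = -3" by (simp add: q0_sq)
    finally have "br (1 / q0) * br (a\<^sup>2) * (kf (1 / a) 1 - kf (1 / a) q0) \<noteq> 0 \<or> br (a\<^sup>2) = 0"
      using br_q0_ne_0 by auto
    then have "br (a\<^sup>2) = 0" using 1 2 by (simp add: right_diff_distrib)
    then show ?thesis using that br_eq_0_iff[of "a\<^sup>2"] by simp
  qed
  assume z: "kf y x = 0 \<and> kf (1 / y) x = 0 \<and> kf x y = 0 \<and> kf (1 / x) y = 0"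
  then have xy: "(x\<^sup>2)\<^sup>2 = 1" "(y\<^sup>2)\<^sup>2 = 1" using sq[of x y] sq[of y x] nz by blast+
  have "br (y / (q0 * x)) = 0 \<or> br (y * x / q0) = 0" using z by (auto simp: kf_def)
  then have "(y / (q0 * x))\<^sup>2 = 1 \<or> (y * x / q0)\<^sup>2 = 1"
    using br_eq_0_iff[of "y / (q0 * x)"] br_eq_0_iff[of "y * x / q0"] nz q0_neq by auto
  then have "((y / (q0 * x))\<^sup>2)\<^sup>2 = 1 \<or> ((y * x / q0)\<^sup>2)\<^sup>2 = 1"
    by (elim disjE) (simp_all only: power_one simp_thms)
  then have "(q0\<^sup>2)\<^sup>2 = 1" 
    unfolding power_divide power_mult_distrib xy by auto
  moreover have "(q0\<^sup>2)\<^sup>2 = q0 ^ 3 * q0" by (simp add: power2_eq_square power3_eq_cube)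
  ultimately show False using q0_cube q0_neq by simp
qed

section \<open>Passage to the products and characters of the stated formulas\<close>

lemma tau_sum_rev: "tau_sum (rev ys) = tau_sum ys"
proof -
  have "tau_sum (rev ys @ b) = tau_sum (ys @ b)" for b
  proof (induction ys arbitrary: b)
    case (Cons y ys)
    then show ?case using tau_sum_move[of ys y b] by simp
  qed simp
  from this[of "[]"] show ?thesis by simp
qed

lemma ext_comp_opening:
  assumes "0 \<notin> set zs" "\<zeta>L \<noteq> 0" "length zs = L"
  shows "ext_comp \<zeta>0 \<zeta>L zs = (-1) ^ (L * (L + 1) div 2)
    * (\<Prod>(i, j) \<in> {(i, j). i < j \<and> j \<le> L}. kf ((\<zeta>0 # zs @ [\<zeta>L]) ! j) ((\<zeta>0 # zs @ [\<zeta>L]) ! i))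
    * tau (L + 1) (zs @ [\<zeta>L]) * tau L zs"
proof -
  have "kprod (\<zeta>0 # zs) = (\<Prod>(i, j)\<in>{(i, j). i < j \<and> j < length (\<zeta>0 # zs)}. kf ((\<zeta>0 # zs) ! j) ((\<zeta>0 # zs) ! i))"
    by (rule kprod_pairs)
  also have "\<dots> = (\<Prod>(i, j)\<in>{(i, j). i < j \<and> j \<le> L}. kf ((\<zeta>0 # zs @ [\<zeta>L]) ! j) ((\<zeta>0 # zs @ [\<zeta>L]) ! i))"
    by (rule prod.cong) (use assms in \<open>auto simp: less_Suc_eq_le nth_append nth_Cons split: nat.splits\<close>)
  finally show ?thesis
    using tau_eq[of "zs @ [\<zeta>L]" "L + 1"] tau_eq[of zs L] assms by (simp add: ext_comp_def ext_sym_def mult_ac)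
qed

lemma ext_comp_closing:
  assumes s: "s ^ 4 = 1" and zs: "0 \<notin> set zs" "\<zeta>0 \<noteq> 0" "\<zeta>L \<noteq> 0" "length zs = L"
  shows "ext_comp (mir s \<zeta>L) (mir s \<zeta>0) (map (mir s) (rev zs)) = (-1) ^ (L * (L + 1) div 2)
    * (\<Prod>(i, j) \<in> {(i, j). 1 \<le> i \<and> i < j \<and> j \<le> L + 1}.
        kf (1 / (s * (\<zeta>0 # zs @ [\<zeta>L]) ! i)) (s * (\<zeta>0 # zs @ [\<zeta>L]) ! j))
    * tau (L + 1) (map (\<lambda>z. s * z) (\<zeta>0 # zs)) * tau L (map (\<lambda>z. s * z) zs)"
proof -
  note s' = fourth_root_sq[OF s]
  define Z where "Z = (\<lambda>i. (\<zeta>0 # zs @ [\<zeta>L]) ! i)"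
  define W where "W = map (mir s) (rev (zs @ [\<zeta>L]))"
  have W: "length W = L + 1" "W ! i = mir s (Z (L + 1 - i))" if "i \<le> L" for i
    using that zs(4) by (auto simp: W_def Z_def rev_nth nth_Cons' simp del: rev_append)
  have lW: "length W = L + 1" using zs(4) by (simp add: W_def)
  have Znz: "Z i \<noteq> 0" if "i \<le> L + 1" for i
  proof -
    have "Z i \<in> set (\<zeta>0 # zs @ [\<zeta>L])" unfolding Z_def by (rule nth_mem) (use that zs(4) in simp)
    then show ?thesis using zs by auto
  qed
  have "kprod (mir s \<zeta>L # map (mir s) (rev zs)) = kprod W" by (simp add: W_def)
  also have "\<dots> = (\<Prod>(i, j)\<in>{(i, j). i < j \<and> j < L + 1}. kf (W ! j) (W ! i))"
    unfolding kprod_pairs lW ..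
  also have "\<dots> = (\<Prod>(i, j)\<in>{(i, j). 1 \<le> i \<and> i < j \<and> j \<le> L + 1}. kf (1 / (s * Z i)) (s * Z j))"
  \<comment> \<open>Reversing the list sends the positions (i, j) to (L + 1 - j, L + 1 - i);
    inverting the second argument of k replaces \<open>mir s\<close> by multiplication with
    s.\<close>
  proof (rule prod.reindex_bij_witness[of _ "\<lambda>(i, j). (L + 1 - j, L + 1 - i)" "\<lambda>(i, j). (L + 1 - j, L + 1 - i)"])
    fix p assume "p \<in> {(i, j). i < j \<and> j < L + 1}"
    then obtain i j where p: "p = (i, j)" "i < j" "j \<le> L" by auto
    have "kf (mir s (Z (L + 1 - j))) (mir s (Z (L + 1 - i))) = kf (mir s (Z (L + 1 - j))) (s * Z (L + 1 - i))"
      by (rule kf_mir(1)[OF s]) (use Znz s' in \<open>auto simp: mir_ne_0\<close>)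
    then show "(case case p of (i, j) \<Rightarrow> (L + 1 - j, L + 1 - i) of (i, j) \<Rightarrow> kf (1 / (s * Z i)) (s * Z j))
      = (case p of (i, j) \<Rightarrow> kf (W ! j) (W ! i))"
      using p by (simp add: W(2) mir_def)
  qed auto
  finally have k: "kprod (mir s \<zeta>L # map (mir s) (rev zs))
    = (\<Prod>(i, j)\<in>{(i, j). 1 \<le> i \<and> i < j \<and> j \<le> L + 1}. kf (1 / (s * Z i)) (s * Z j))" .
  have sm: "sq_sum (mir s x) = sq_sum (s * x)" for x by (simp add: mir_def sq_sum_1_div)
  have t1: "tau_sum (map sq_sum (map (mir s) (rev zs) @ [mir s \<zeta>0])) = tau (L + 1) (map (\<lambda>z. s * z) (\<zeta>0 # zs))"
  proof -
    have "map sq_sum (map (mir s) (rev zs) @ [mir s \<zeta>0]) = rev (map sq_sum (map (\<lambda>z. s * z) (\<zeta>0 # zs)))"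
      by (simp add: sm comp_def rev_map)
    moreover have "0 \<notin> set (map (\<lambda>z. s * z) (\<zeta>0 # zs))" using zs s'(3) by auto
    ultimately show ?thesis using tau_eq[of "map (\<lambda>z. s * z) (\<zeta>0 # zs)" "L + 1"] zs(4)
      by (simp add: tau_sum_rev del: list.map rev.simps)
  qed
  have t2: "tau_sum (map sq_sum (map (mir s) (rev zs))) = tau L (map (\<lambda>z. s * z) zs)"
  proof -
    have "map sq_sum (map (mir s) (rev zs)) = rev (map sq_sum (map (\<lambda>z. s * z) zs))"
      by (simp add: sm comp_def rev_map)
    moreover have "0 \<notin> set (map (\<lambda>z. s * z) zs)" using zs s'(3) by auto
    ultimately show ?thesis using tau_eq[of "map (\<lambda>z. s * z) zs" L] zs(4)
      by (simp add: tau_sum_rev del: list.map rev.simps)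
  qed
  have l: "length (map (mir s) (rev zs)) = L" using zs(4) by simp
  have ac: "p * (e * (a * b)) = e * p * a * b" for p e a b :: complex by simp
  show ?thesis
    unfolding ext_comp_def ext_sym_def k t1 t2 l Z_def by (rule ac)
qed

section \<open>Both extremal components of a solution\<close>

context
  fixes s :: complex and \<Psi> :: family
  assumes s: "s ^ 4 = 1"
    and init: "\<And>\<zeta>0 \<zeta>L. \<zeta>0 \<noteq> 0 \<Longrightarrow> \<zeta>L \<noteq> 0 \<Longrightarrow> \<Psi> 0 [] \<zeta>0 \<zeta>L [] = 1"
    and qkz: "qKZ s \<Psi>" and laur: "laurent_components \<Psi>"
    and bulk: "bulk_recursion \<Psi>" and left: "left_recursion \<Psi>" and right: "right_recursion s \<Psi>"
begin

definition open_comp :: "complex \<Rightarrow> complex \<Rightarrow> complex list \<Rightarrow> complex" where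
  "open_comp \<zeta>0 \<zeta>L zs = \<Psi> (length zs) zs \<zeta>0 \<zeta>L (replicate (length zs) Opening)"

definition close_comp :: "complex \<Rightarrow> complex \<Rightarrow> complex list \<Rightarrow> complex" where
  "close_comp = mirror_comp s \<Psi> (\<lambda>L. replicate L Closing)"

lemma ext_opening:
  "\<zeta>0 \<noteq> 0 \<Longrightarrow> \<zeta>L \<noteq> 0 \<Longrightarrow> extremal \<zeta>0 \<zeta>L (open_comp \<zeta>0 \<zeta>L)
    (\<lambda>zs. \<Psi> (length zs) zs \<zeta>0 \<zeta>L (replicate (length zs - 1) Opening @ [Closing]))"
  unfolding open_comp_def[abs_def] by (rule extremal_opening[OF s qkz laur bulk])

lemma ext_closing:
  "\<zeta>0 \<noteq> 0 \<Longrightarrow> \<zeta>L \<noteq> 0 \<Longrightarrow> extremal \<zeta>0 \<zeta>L (close_comp \<zeta>0 \<zeta>L)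
    (mirror_comp s \<Psi> (\<lambda>L. Opening # replicate (L - 1) Closing) \<zeta>0 \<zeta>L)"
  unfolding close_comp_def by (rule extremal_closing[OF s qkz laur bulk])

lemma init_opening: "\<zeta>0 \<noteq> 0 \<Longrightarrow> \<zeta>L \<noteq> 0 \<Longrightarrow> open_comp \<zeta>0 \<zeta>L [] = 1"
  by (simp add: open_comp_def init)

lemma init_closing: "\<zeta>0 \<noteq> 0 \<Longrightarrow> \<zeta>L \<noteq> 0 \<Longrightarrow> close_comp \<zeta>0 \<zeta>L [] = 1"
  using fourth_root_sq(3)[OF s] by (simp add: close_comp_def mirror_comp_def init mir_ne_0)

text \<open>In size 1 the right boundary equation couples the two components. By
  \<open>kf_reflection_identity\<close> it holds for equal scalars, so at a generic z their
  difference is annihilated by a nonzero factor.\<close>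

lemma boundary_scalars_eq:
  assumes nz: "\<zeta>0 \<noteq> 0" "\<zeta>L \<noteq> 0"
    and \<sigma>: "\<And>z. z \<noteq> 0 \<Longrightarrow> open_comp \<zeta>0 \<zeta>L [z] = - \<sigma> * kf z \<zeta>0"
    and \<sigma>': "\<And>z. z \<noteq> 0 \<Longrightarrow> close_comp (mir s \<zeta>L) (mir s \<zeta>0) [z] = - \<sigma>' * kf z (mir s \<zeta>L)"
  shows "\<sigma> = \<sigma>'"
proof -
  note s' = fourth_root_sq[OF s]
  obtain z where "z \<notin> insert 0 (excluded \<zeta>0 \<zeta>L [])"
    using ex_new_if_finite[OF infinite_UNIV_char_0, of "insert 0 (excluded \<zeta>0 \<zeta>L [])"] finite_excluded by auto
  then have z: "z \<noteq> 0" and g: "generic \<zeta>0 \<zeta>L [z]"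
    using generic_snoc[of \<zeta>0 \<zeta>L "[]" z] by (auto simp: generic_def)
  have k: "kf (1 / z) \<zeta>L \<noteq> 0" using g z nz by (intro kf_ne_0) (auto simp: generic_def)
  have bz: "br (z\<^sup>2) \<noteq> 0"
  proof
    assume "br (z\<^sup>2) = 0"
    then have "(z\<^sup>2)\<^sup>2 = 1" using br_eq_0_iff[of "z\<^sup>2"] z by simp
    then have "((z\<^sup>2)\<^sup>2) ^ 3 = 1" by (simp only: power_one)
    then have "z ^ 12 = 1" by (simp only: power_mult[symmetric]) simp
    then show False using g by (simp add: generic_def)
  qed
  define g1 where "g1 = \<Psi> 1 [z] \<zeta>0 \<zeta>L [Closing]"
  have "close_comp (mir s \<zeta>L) (mir s \<zeta>0) [mir s z] = s\<^sup>2 * g1"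
    using mir_mir[OF s'(3)] by (simp add: close_comp_def mirror_comp_def g1_def)
  moreover have "close_comp (mir s \<zeta>L) (mir s \<zeta>0) [mir s z] = - \<sigma>' * (s\<^sup>2 * kf (1 / z) \<zeta>L)"
    using \<sigma>'[of "mir s z"] z s' kf_mir(2)[OF s z nz(2)] by (simp add: mir_ne_0)
  ultimately have "s\<^sup>2 * g1 = - \<sigma>' * (s\<^sup>2 * kf (1 / z) \<zeta>L)" by (rule trans[OF sym])
  then have "s\<^sup>2 * g1 = s\<^sup>2 * (- \<sigma>' * kf (1 / z) \<zeta>L)" by (simp only: mult.left_commute)
  then have g1: "g1 = - \<sigma>' * kf (1 / z) \<zeta>L" using s'(3) unfolding mult_cancel_left by auto
  define b where "b = br (1 / q0) * br (z\<^sup>2)"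
  have b0: "b \<noteq> 0" using bz br_q0_ne_0 by (simp add: b_def)
  have "kf z \<zeta>L * open_comp \<zeta>0 \<zeta>L [z] + b * (open_comp \<zeta>0 \<zeta>L [z] + g1) = kf (1 / z) \<zeta>L * open_comp \<zeta>0 \<zeta>L [1 / z]"
    using extremal.reflect[OF ext_opening[OF nz], of "[]" z] k z by (simp add: b_def g1_def)
  then have "\<sigma> * (kf z \<zeta>L * kf z \<zeta>0 + b * kf z \<zeta>0) + b * (\<sigma>' * kf (1 / z) \<zeta>L) = \<sigma> * (kf (1 / z) \<zeta>L * kf (1 / z) \<zeta>0)"
    using \<sigma>[OF z] \<sigma>[of "1 / z"] z unfolding g1 by (simp add: algebra_simps)
  also have "kf (1 / z) \<zeta>L * kf (1 / z) \<zeta>0 = kf z \<zeta>L * kf z \<zeta>0 + b * (kf z \<zeta>0 + kf (1 / z) \<zeta>L)"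
    using kf_reflection_identity[OF z nz] by (simp only: b_def)
  finally have "(b * kf (1 / z) \<zeta>L) * (\<sigma>' - \<sigma>) = 0" by (simp add: algebra_simps)
  then show ?thesis using b0 k by simp
qed

text \<open>\<open>kf_nondegenerate\<close> ensures that at one of the two ends a recursion factor
  survives. It fixes the scalar of one component, and \<open>boundary_scalars_eq\<close> passes the
  value on to the other.\<close>

lemma length_one_opening_closing:
  assumes nz: "\<zeta>0 \<noteq> 0" "\<zeta>L \<noteq> 0" and z: "z \<noteq> 0"
  shows "open_comp \<zeta>0 \<zeta>L [z] = - kf z \<zeta>0"
    "close_comp (mir s \<zeta>L) (mir s \<zeta>0) [z] = - kf z (mir s \<zeta>L)"
proof -
  note s' = fourth_root_sq[OF s]
  have mnz: "mir s \<zeta>L \<noteq> 0" "mir s \<zeta>0 \<noteq> 0" using nz s' by (simp_all add: mir_ne_0)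
  obtain \<sigma> where \<sigma>: "\<And>z. z \<noteq> 0 \<Longrightarrow> open_comp \<zeta>0 \<zeta>L [z] = - \<sigma> * kf z \<zeta>0"
    using extremal.length_one[OF ext_opening[OF nz]] by blast
  obtain \<sigma>' where \<sigma>': "\<And>z. z \<noteq> 0 \<Longrightarrow> close_comp (mir s \<zeta>L) (mir s \<zeta>0) [z] = - \<sigma>' * kf z (mir s \<zeta>L)"
    using extremal.length_one[OF ext_closing[OF mnz]] by blast
  have eq: "\<sigma> = \<sigma>'" by (rule boundary_scalars_eq[OF nz \<sigma> \<sigma>'])
  have "\<sigma> = 1"
  proof (cases "kf \<zeta>L \<zeta>0 \<noteq> 0 \<or> kf (1 / \<zeta>L) \<zeta>0 \<noteq> 0")
    case True
    show ?thesis
    proof (rule normalisation_length_one[where \<phi> = "open_comp \<zeta>0", OF ext_opening[OF nz(1)] init_opening[OF nz(1)] _ \<sigma> nz True])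
      show "open_comp \<zeta>0 \<zeta> (a @ [\<zeta> / q0]) = - kf (1 / \<zeta>) \<zeta>0 * (\<Prod>y\<leftarrow>a. (kf (1 / \<zeta>) y)\<^sup>2) * open_comp \<zeta>0 (\<zeta> / q0) a"
        if "\<zeta> \<noteq> 0" "0 \<notin> set a" for \<zeta> a
        unfolding open_comp_def by (rule opening_right_rec[OF s right nz(1) that])
    qed
  next
    case False
    then have "kf \<zeta>0 \<zeta>L \<noteq> 0 \<or> kf (1 / \<zeta>0) \<zeta>L \<noteq> 0" using kf_nondegenerate[OF nz] by blast
    moreover have "kf (mir s \<zeta>0) (mir s \<zeta>L) = s\<^sup>2 * kf (1 / \<zeta>0) \<zeta>L" by (rule kf_mir(2)[OF s nz])
    moreover have "kf (1 / mir s \<zeta>0) (mir s \<zeta>L) = s\<^sup>2 * kf \<zeta>0 \<zeta>L"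
      using kf_mir(1)[OF s, of "s * \<zeta>0" \<zeta>L] kf_scale(2)[OF s, of \<zeta>0 \<zeta>L] nz s' by (simp add: mir_def)
    ultimately have nd: "kf (mir s \<zeta>0) (mir s \<zeta>L) \<noteq> 0 \<or> kf (1 / mir s \<zeta>0) (mir s \<zeta>L) \<noteq> 0" using s'(3) by auto
    have "\<sigma>' = 1"
    proof (rule normalisation_length_one[where \<phi> = "close_comp (mir s \<zeta>L)", OF ext_closing[OF mnz(1)] init_closing[OF mnz(1)] _ \<sigma>' mnz nd])
      show "close_comp (mir s \<zeta>L) \<zeta> (a @ [\<zeta> / q0]) = - kf (1 / \<zeta>) (mir s \<zeta>L) * (\<Prod>y\<leftarrow>a. (kf (1 / \<zeta>) y)\<^sup>2)
           * close_comp (mir s \<zeta>L) (\<zeta> / q0) a"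
        if "\<zeta> \<noteq> 0" "0 \<notin> set a" for \<zeta> a
        unfolding close_comp_def by (rule closing_right_rec[OF s left mnz(1) that])
    qed
    then show ?thesis by (simp only: eq)
  qed
  then show "open_comp \<zeta>0 \<zeta>L [z] = - kf z \<zeta>0" "close_comp (mir s \<zeta>L) (mir s \<zeta>0) [z] = - kf z (mir s \<zeta>L)"
    using \<sigma>[OF z] \<sigma>'[OF z] eq by simp_all
qed

lemma extremal_components:
  assumes nz: "\<zeta>0 \<noteq> 0" "\<zeta>L \<noteq> 0" and zs: "0 \<notin> set zs"
  shows "open_comp \<zeta>0 \<zeta>L zs = ext_comp \<zeta>0 \<zeta>L zs"
    "close_comp (mir s \<zeta>L) (mir s \<zeta>0) zs = ext_comp (mir s \<zeta>L) (mir s \<zeta>0) zs"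
proof -
  have mnz: "mir s \<zeta>L \<noteq> 0" "mir s \<zeta>0 \<noteq> 0" using nz fourth_root_sq[OF s] by (simp_all add: mir_ne_0)
  have "open_comp \<zeta>0 \<zeta>L zs = ext_comp \<zeta>0 \<zeta>L zs \<and> close_comp (mir s \<zeta>L) (mir s \<zeta>0) zs = ext_comp (mir s \<zeta>L) (mir s \<zeta>0) zs"
  proof (cases "even (length zs)")
    case True
    then obtain m where m: "length zs = 2 * m" by (auto elim: evenE)
    show ?thesis
      using extremal.even_length[OF ext_opening[OF nz] init_opening[OF nz] m zs]
        extremal.even_length[OF ext_closing[OF mnz] init_closing[OF mnz] m zs] by blast
  next
    case False
    then obtain m where m: "length zs = 2 * m + 1" by (auto elim: oddE)
    show ?thesis
      using extremal.odd_length[OF ext_opening[OF nz] length_one_opening_closing(1)[OF nz] m zs]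
        extremal.odd_length[OF ext_closing[OF mnz] length_one_opening_closing(2)[OF nz] m zs] by blast
  qed
  then show "open_comp \<zeta>0 \<zeta>L zs = ext_comp \<zeta>0 \<zeta>L zs"
    "close_comp (mir s \<zeta>L) (mir s \<zeta>0) zs = ext_comp (mir s \<zeta>L) (mir s \<zeta>0) zs" by blast+
qed

lemma opening_component:
  assumes "\<zeta>0 \<noteq> 0" "\<zeta>L \<noteq> 0" "0 \<notin> set zs" "length zs = L"
  shows "\<Psi> L zs \<zeta>0 \<zeta>L (replicate L Opening) = ext_comp \<zeta>0 \<zeta>L zs"
  using extremal_components(1)[OF assms(1-3)] assms(4) by (simp add: open_comp_def)

lemma closing_component:
  assumes nz: "\<zeta>0 \<noteq> 0" "\<zeta>L \<noteq> 0" and zs: "0 \<notin> set zs" "length zs = L"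
  shows "\<Psi> L zs \<zeta>0 \<zeta>L (replicate L Closing)
    = (s\<^sup>2) ^ L * ext_comp (mir s \<zeta>L) (mir s \<zeta>0) (map (mir s) (rev zs))"
proof -
  note s' = fourth_root_sq[OF s]
  have mm: "map (mir s \<circ> mir s) zs = zs" using mir_mir[OF s'(3)] by (simp add: map_idI)
  have "close_comp (mir s \<zeta>L) (mir s \<zeta>0) (map (mir s) (rev zs)) = (s\<^sup>2) ^ L * \<Psi> L zs \<zeta>0 \<zeta>L (replicate L Closing)"
    using zs(2) mm mir_mir[OF s'(3)] by (simp add: close_comp_def mirror_comp_def rev_map)
  moreover have "close_comp (mir s \<zeta>L) (mir s \<zeta>0) (map (mir s) (rev zs)) = ext_comp (mir s \<zeta>L) (mir s \<zeta>0) (map (mir s) (rev zs))"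
    by (rule extremal_components(2)[OF nz mir_set[OF s'(3) zs(1)]])
  \<comment> \<open>The sign prefactor is its own inverse, so it can be moved to the other
    side.\<close>
  moreover have "(s\<^sup>2) ^ L * (s\<^sup>2) ^ L = (s\<^sup>2 * s\<^sup>2) ^ L" by (rule power_mult_distrib[symmetric])
  then have "(s\<^sup>2) ^ L * (s\<^sup>2) ^ L = 1" by (simp only: s'(1) power_one)
  ultimately show ?thesis by (metis mult.assoc mult_1)
qed

end


theorem mainTheorem3:
  fixes s :: complex and \<Psi> :: family
  assumes "s ^ 4 = 1"
    and "ground_state \<Psi>"
    and "\<And>\<zeta>0 \<zeta>L. \<zeta>0 \<noteq> 0 \<Longrightarrow> \<zeta>L \<noteq> 0 \<Longrightarrow> \<Psi> 0 [] \<zeta>0 \<zeta>L [] = 1"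
    and "qKZ s \<Psi>"
    and "laurent_components \<Psi>"
    and "bulk_recursion \<Psi>"
    and "left_recursion \<Psi>"
    and "right_recursion s \<Psi>"
  shows "\<forall>L zs \<zeta>0 \<zeta>L. 1 \<le> L \<and> length zs = L \<and> 0 \<notin> set zs \<and> \<zeta>0 \<noteq> 0 \<and> \<zeta>L \<noteq> 0 \<longrightarrow>
    (let Z = (\<lambda>i. (\<zeta>0 # zs @ [\<zeta>L]) ! i) in
      \<Psi> L zs \<zeta>0 \<zeta>L (replicate L Opening) =
        (-1) ^ (L * (L + 1) div 2)
        * (\<Prod>(i, j) \<in> {(i, j). i < j \<and> j \<le> L}. kf (Z j) (Z i))
        * tau (L + 1) (zs @ [\<zeta>L]) * tau L zs
      \<and>
      \<Psi> L zs \<zeta>0 \<zeta>L (replicate L Closing) =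
        (-1) ^ (L * (L + 1) div 2) * (s\<^sup>2) ^ L
        * (\<Prod>(i, j) \<in> {(i, j). 1 \<le> i \<and> i < j \<and> j \<le> L + 1}. kf (1 / (s * Z i)) (s * Z j))
        * tau (L + 1) (map (\<lambda>z. s * z) (\<zeta>0 # zs)) * tau L (map (\<lambda>z. s * z) zs))"
proof (intro allI impI, elim conjE)
  fix L :: nat and zs :: "complex list" and \<zeta>0 \<zeta>L :: complex
  assume *: "1 \<le> L" "length zs = L" "0 \<notin> set zs" "\<zeta>0 \<noteq> 0" "\<zeta>L \<noteq> 0"
  have ac: "q * (e * p * a * b) = e * q * p * a * b" for q e p a b :: complex by simp
  show "let Z = (\<lambda>i. (\<zeta>0 # zs @ [\<zeta>L]) ! i) in
      \<Psi> L zs \<zeta>0 \<zeta>L (replicate L Opening) =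
        (-1) ^ (L * (L + 1) div 2)
        * (\<Prod>(i, j) \<in> {(i, j). i < j \<and> j \<le> L}. kf (Z j) (Z i))
        * tau (L + 1) (zs @ [\<zeta>L]) * tau L zs
      \<and>
      \<Psi> L zs \<zeta>0 \<zeta>L (replicate L Closing) =
        (-1) ^ (L * (L + 1) div 2) * (s\<^sup>2) ^ L
        * (\<Prod>(i, j) \<in> {(i, j). 1 \<le> i \<and> i < j \<and> j \<le> L + 1}. kf (1 / (s * Z i)) (s * Z j))
        * tau (L + 1) (map (\<lambda>z. s * z) (\<zeta>0 # zs)) * tau L (map (\<lambda>z. s * z) zs)"
    unfolding Let_def
  proof
    show "\<Psi> L zs \<zeta>0 \<zeta>L (replicate L Opening) = (-1) ^ (L * (L + 1) div 2)
        * (\<Prod>(i, j) \<in> {(i, j). i < j \<and> j \<le> L}. kf ((\<zeta>0 # zs @ [\<zeta>L]) ! j) ((\<zeta>0 # zs @ [\<zeta>L]) ! i))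
        * tau (L + 1) (zs @ [\<zeta>L]) * tau L zs"
      using opening_component[OF assms(1,3-8) *(4,5,3,2)] ext_comp_opening[OF *(3,5,2)] by (rule trans)
    show "\<Psi> L zs \<zeta>0 \<zeta>L (replicate L Closing) = (-1) ^ (L * (L + 1) div 2) * (s\<^sup>2) ^ L
        * (\<Prod>(i, j) \<in> {(i, j). 1 \<le> i \<and> i < j \<and> j \<le> L + 1}.
            kf (1 / (s * (\<zeta>0 # zs @ [\<zeta>L]) ! i)) (s * (\<zeta>0 # zs @ [\<zeta>L]) ! j))
        * tau (L + 1) (map (\<lambda>z. s * z) (\<zeta>0 # zs)) * tau L (map (\<lambda>z. s * z) zs)"
      using closing_component[OF assms(1,3-8) *(4,5,3,2)] unfolding ext_comp_closing[OF assms(1) *(3-5,2)] ac .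
  qed
qed


end
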